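(* Let $\sigma$ be a finite nonnegative measure with infinite support on $[-1,1]$, let $s_{-1}\in\mathbb R$, and let $$\mathfrak F(\lambda)=\frac1\lambda\int_{-1}^1\frac{d\sigma(t)}{t-\lambda}-\frac{s_{-1}}{\lambda}\in\mathbf D^+_{-\infty},\qquad F(\lambda)=\int_{-1}^1\frac{d\sigma(t)}{t-\lambda}.$$ Let $\{\mathfrak n_j\}_{j\ge1}$ be the normal indices of the coefficient sequence $\mathfrak s_0=s_{-1}$, $\mathfrak s_{j}=\int t^{j-1}d\sigma(t)$ ($j\ge1$) of $\mathfrak F$, and $\mathfrak n_0=0$. Then the following statements are equivalent: (i) the operator $\mathfrak L$ in the block $LU$-factorization $\mathfrak J=\mathfrak L\mathfrak U$ of the monic generalized Jacobi matrix $\mathfrak J$ associated with $\mathfrak F$ is bounded in $\ell^2_{[0,\infty)}$; (ii) the operator $\mathfrak L=\mathfrak L(s_{-1})$ in the block $UL$-factorization $J=\mathfrak U\mathfrak L$, with the parameter $s_{-1}=\mathfrak s_0$, of the monic Jacobi matrix $J$ associated with $F$ is bounded in $\ell^2_{[0,\infty)}$; (iii) the sequence $\{\mathfrak F^{[\mathfrak n_j/\mathfrak n_j]}\}_{j=0}^\infty$ of diagonal Padé approximants converges to $\mathfrak F$ locally uniformly in $\widehat{\mathbb C}\setminus[-1-\varepsilon,1+\varepsilon]$ for some $\varepsilon\ge0$.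
   Context: $\widehat{\mathbb C}=\mathbb C\cup\{\infty\}$ with the spherical metric. $\lambda\widehat\to\infty$ means that $\lambda\to\infty$ inside a sector $\varepsilon<\arg\lambda<\pi-\varepsilon$, $\varepsilon>0$; $\mathfrak F(\lambda)\sim-\sum_j\mathfrak s_j\lambda^{-j-1}$ denotes the asymptotic expansion to all orders as $\lambda\widehat\to\infty$. $\mathbf N_{-\infty}$ is the class of functions $\int_{\mathbb R}\frac{d\mu(t)}{t-\lambda}$ with $\mu$ a finite measure with all moments finite. $\mathbf D^+_{-\infty}$: functions $\mathfrak F$ meromorphic in $\mathbb C_+$ with $\mathfrak F\sim-\sum_{j\ge0}\mathfrak s_j\lambda^{-j-1}$, $\mathfrak s_j\in\mathbb R$, and $\lambda\mathfrak F(\lambda)+\mathfrak s_0\in\mathbf N_{-\infty}$. Padé approximants: for a formal power series $\mathfrak F=-\sum_{j\ge0}\mathfrak s_j\lambda^{-j-1}$, the $[L/M]$ approximant is a ratio $A(1/\lambda)/B(1/\lambda)$ of polynomials of formal degrees $L$ and $M$ with $B(0)\neq0$ and $\sum_{j=0}^{L+M-1}\mathfrak s_j\lambda^{-j-1}+\mathfrak F^{[L/M]}(\lambda)=O(\lambda^{-L-M-1})$, $\lambda\to\infty$. Jacobi matrix: $s_j=\int t^jd\sigma$, $j\ge0$; the monic orthogonal polynomials $P_j$ of $\sigma/s_0$ satisfy $\lambda P_j=P_{j+1}+b_jP_j+c_{j-1}P_{j-1}$, $P_{-1}=0$, $P_0=1$; $Q_j(\lambda)=\int\frac{P_j(\lambda)-P_j(t)}{\lambda-t}d\sigma(t)$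 are the polynomials of the second kind; the monic Jacobi matrix associated with $F$ has $J_{j,j}=b_j$, $J_{j,j+1}=1$, $J_{j+1,j}=c_j$. Normal indices of $\{\mathfrak s_j\}_{j\ge0}$: integers $n\ge1$ with $\det(\mathfrak s_{i+k})_{i,k=0}^{n-1}\ne0$, listed increasingly $\mathfrak n_1<\mathfrak n_2<\dots$; $\mathfrak n_0=0$, $\mathfrak k_j=\mathfrak n_{j+1}-\mathfrak n_j\in\{1,2\}$. Generalized Jacobi matrix: $\mathfrak F$ (nonrational) is normalized if its first nonzero coefficient $\mathfrak s_{\mathfrak n_1-1}$ has modulus $1$. For normalized $\mathfrak F$ put $\mathfrak F_0=\mathfrak F$ and recursively $-1/\mathfrak F_j(\lambda)=\epsilon_j\mathfrak p_j(\lambda)+\mathfrak b_j^2\mathfrak F_{j+1}(\lambda)$, where $\epsilon_j=\pm1$ is the first nonzero asymptotic coefficient of $\mathfrak F_j$, $\mathfrak p_j$ is the monic polynomial (of degree $\mathfrak k_j$) with $-1/\mathfrak F_j-\epsilon_j\mathfrak p_j=o(1)$ as $\lambda\widehat\to\infty$, and $\mathfrak b_j>0$ makes $\mathfrak F_{j+1}$ normalized. Put $\mathfrak c_j=\epsilon_j\epsilon_{j+1}\mathfrak b_j^2$; $\mathfrak p_j(\lambda)=\lambda+\mathfrak p_0^{(j)}$ if $\mathfrak k_j=1$, $\mathfrak p_j(\lambda)=\lambda^2+\mathfrak p_1^{(j)}\lambda+\mathfrak p_0^{(j)}$ if $\mathfrak k_j=2$. The monic generalized Jacobi matrix associated with $\mathfrak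 F$ is the block tridiagonal matrix with diagonal blocks $-\mathfrak p_0^{(j)}$ ($\mathfrak k_j=1$) or $\begin{pmatrix}0&1\\-\mathfrak p_0^{(j)}&-\mathfrak p_1^{(j)}\end{pmatrix}$ ($\mathfrak k_j=2$), superdiagonal $\mathfrak k_j\times\mathfrak k_{j+1}$ blocks with lower-left entry $1$ and other entries $0$, and subdiagonal $\mathfrak k_{j+1}\times\mathfrak k_j$ blocks with lower-left entry $\mathfrak c_j$ and other entries $0$. For $\mathfrak F$ not normalized one uses $\mathfrak F/|\mathfrak s_{\mathfrak n_1-1}|$. Form of $\mathfrak L$ and $\mathfrak U$: $\mathfrak L$ is block lower bidiagonal with diagonal blocks $\mathfrak E_j$ and subdiagonal blocks $\mathfrak L_j$ ($\mathfrak k_j\times\mathfrak k_{j-1}$, in block row $j\ge1$, lower-right entry $\mathfrak l_j$, other entries $0$); $\mathfrak U$ is block upper bidiagonal with diagonal blocks $\mathfrak U_j$ and superdiagonal blocks $\mathfrak D_j$ ($\mathfrak k_j\times\mathfrak k_{j+1}$, lower-left entry $1$, other entries $0$); here $\mathfrak U_j=\mathfrak u_j$, $\mathfrak E_j=1$ if $\mathfrak k_j=1$, and $\mathfrak U_j=\begin{pmatrix}0&1\\ \mathfrak u_j&0\end{pmatrix}$, $\mathfrak E_j=\begin{pmatrix}1&0\\ \mathfrak e_j&1\end{pmatrix}$ if $\mathfrak k_j=2$. In (i), $\mathfrak J=\mathfrak L\mathfrak U$ is the factorization of this form with $\mathfrak u_j=-\mathfrak P_{j+1}(0)/\mathfrak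 P_j(0)$, $\mathfrak l_{j+1}=\mathfrak c_j/\mathfrak u_j$, $\mathfrak e_j=-\mathfrak p_1^{(j)}$, where $\mathfrak P_{-1}=0$, $\mathfrak P_0=1$, $\mathfrak P_{j+1}=\mathfrak p_j\mathfrak P_j-\mathfrak c_{j-1}\mathfrak P_{j-1}$ (one has $\mathfrak P_j(0)\ne0$). In (ii), $J=\mathfrak U\mathfrak L$ is the factorization of this form with $\mathfrak l_j=-\widehat P_{\mathfrak n_{j+1}-1}(0)/\widehat P_{\mathfrak n_j-1}(0)$, $j\in\mathbb N$, where $\widehat P_j=Q_j+s_{-1}P_j$ (one has $\widehat P_{\mathfrak n_j-1}(0)\neq0$). A matrix is bounded in $\ell^2_{[0,\infty)}$ if it defines a bounded operator there. *)

theory Defs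
  imports
    "HOL-Complex_Analysis.Complex_Analysis"
    "HOL-Library.Landau_Symbols"
    "Jordan_Normal_Form.Determinant"
begin

section \<open>The measure, its Stieltjes transform and orthogonal polynomials\<close>

definition measure_support :: "real measure \<Rightarrow> real set" where
  "measure_support \<sigma> = {x. \<forall>U. open U \<longrightarrow> x \<in> U \<longrightarrow> emeasure \<sigma> U > 0}"

definition moment :: "real measure \<Rightarrow> nat \<Rightarrow> real" where
  "moment \<sigma> j = (\<integral>t. t ^ j \<partial>\<sigma>)"

definition stieltjes :: "real measure \<Rightarrow> complex \<Rightarrow> complex" where
  "stieltjes \<sigma> z = (\<integral>t. 1 / (complex_of_real t - z) \<partial>\<sigma>)"

text \<open>The argument \<open>sm1\<close> is the real parameter written $s_{-1}$.\<close>

definition frakF :: "real measure \<Rightarrow> real \<Rightarrow> complex \<Rightarrow> complex" where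
  "frakF \<sigma> sm1 z = 1 / z * stieltjes \<sigma> z - complex_of_real sm1 / z"

definition frak_s :: "real measure \<Rightarrow> real \<Rightarrow> nat \<Rightarrow> real" where
  "frak_s \<sigma> sm1 j = (case j of 0 \<Rightarrow> sm1 | Suc i \<Rightarrow> moment \<sigma> i)"

definition orth_poly :: "real measure \<Rightarrow> nat \<Rightarrow> real poly" where
  "orth_poly \<sigma> j = (THE p. Polynomial.degree p = j \<and> lead_coeff p = 1 \<and>
     (\<forall>q. Polynomial.degree q < j \<longrightarrow> (\<integral>t. poly p t * poly q t \<partial>\<sigma>) = 0))"

text \<open>The quotient \<open>(P x - P t) / (x - t)\<close> is a polynomial in \<open>x\<close> and \<open>t\<close>, and has to be read as
  such also for \<open>t = x\<close>, since \<open>\<sigma>\<close> may have an atom at \<open>x\<close>. Its value is that of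
  \<open>synthetic_div P t\<close> at \<open>x\<close>.\<close>

definition second_kind :: "real measure \<Rightarrow> nat \<Rightarrow> real \<Rightarrow> real" where
  "second_kind \<sigma> j x = (\<integral>t. poly (synthetic_div (orth_poly \<sigma> j) t) x \<partial>\<sigma>)"

definition jacobi_coeffs :: "real measure \<Rightarrow> (nat \<Rightarrow> real) \<times> (nat \<Rightarrow> real)" where
  "jacobi_coeffs \<sigma> = (THE (b, c). \<forall>j.
     [:0, 1:] * orth_poly \<sigma> j = orth_poly \<sigma> (Suc j) + Polynomial.smult (b j) (orth_poly \<sigma> j) +
       (case j of 0 \<Rightarrow> 0 | Suc i \<Rightarrow> Polynomial.smult (c i) (orth_poly \<sigma> i)))"

definition monic_jacobi :: "real measure \<Rightarrow> nat \<Rightarrow> nat \<Rightarrow> real" where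
  "monic_jacobi \<sigma> i j = (case jacobi_coeffs \<sigma> of (b, c) \<Rightarrow>
     if j = i then b i else if j = Suc i then 1 else if i = Suc j then c j else 0)"

section \<open>Asymptotic expansions in sectors\<close>

definition sector_at_infinity :: "real \<Rightarrow> complex filter" where
  "sector_at_infinity \<delta> = inf at_infinity (principal {z. \<delta> < Arg z \<and> Arg z < pi - \<delta>})"

definition asym_expansion :: "(complex \<Rightarrow> complex) \<Rightarrow> (nat \<Rightarrow> real) \<Rightarrow> bool" where
  "asym_expansion G s \<longleftrightarrow> (\<forall>\<delta>>0. \<forall>n.
     ((\<lambda>z. z ^ (n + 1) * (G z + (\<Sum>j\<le>n. complex_of_real (s j) / z ^ (j + 1)))) \<longlongrightarrow> 0)
       (sector_at_infinity \<delta>))"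

definition asym_coeffs :: "(complex \<Rightarrow> complex) \<Rightarrow> nat \<Rightarrow> real" where
  "asym_coeffs G = (THE s. asym_expansion G s)"

definition first_coeff :: "(complex \<Rightarrow> complex) \<Rightarrow> real" where
  "first_coeff G = asym_coeffs G (LEAST j. asym_coeffs G j \<noteq> 0)"

definition N_minf :: "(complex \<Rightarrow> complex) set" where
  "N_minf = {G. \<exists>\<mu> :: real measure. sets \<mu> = sets borel \<and> finite_measure \<mu> \<and>
     (\<forall>n. integrable \<mu> (\<lambda>t. t ^ n)) \<and> (\<forall>z. Im z > 0 \<longrightarrow> G z = stieltjes \<mu> z)}"

definition D_plus_minf :: "(complex \<Rightarrow> complex) set" where
  "D_plus_minf = {G. G meromorphic_on {z. Im z > 0} \<and>
     (\<exists>s. asym_expansion G s \<and> (\<lambda>z. z * G z + complex_of_real (s 0)) \<in> N_minf)}"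

section \<open>Normal indices and block matrices\<close>

definition normal_indices :: "(nat \<Rightarrow> real) \<Rightarrow> nat set" where
  "normal_indices s =
     {n. n \<ge> 1 \<and> Determinant.det (Matrix.mat n n (\<lambda>(i, k). s (i + k))) \<noteq> 0}"

definition normal_index :: "(nat \<Rightarrow> real) \<Rightarrow> nat \<Rightarrow> nat" where
  "normal_index s j = (case j of 0 \<Rightarrow> 0 | Suc i \<Rightarrow> enumerate (normal_indices s) i)"

definition block_size :: "(nat \<Rightarrow> nat) \<Rightarrow> nat \<Rightarrow> nat" where
  "block_size n j = n (Suc j) - n j"

definition block_of :: "(nat \<Rightarrow> nat) \<Rightarrow> nat \<Rightarrow> nat" where
  "block_of n a = (THE i. n i \<le> a \<and> a < n (Suc i))"

text \<open>The infinite matrix whose block \<open>(i, j)\<close>, occupying rows \<open>n i..<n (i + 1)\<close> and columns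
  \<open>n j..<n (j + 1)\<close>, has the entries \<open>B i j r c\<close>, with \<open>r\<close> and \<open>c\<close> counted from 0 within
  the block.\<close>

definition block_matrix ::
    "(nat \<Rightarrow> nat) \<Rightarrow> (nat \<Rightarrow> nat \<Rightarrow> nat \<Rightarrow> nat \<Rightarrow> real) \<Rightarrow> nat \<Rightarrow> nat \<Rightarrow> real" where
  "block_matrix n B a b =
     (let i = block_of n a; j = block_of n b in B i j (a - n i) (b - n j))"

definition lower_left :: "nat \<Rightarrow> real \<Rightarrow> nat \<Rightarrow> nat \<Rightarrow> real" where
  "lower_left nr x r c = (if r = nr - 1 \<and> c = 0 then x else 0)"

definition lower_right :: "nat \<Rightarrow> nat \<Rightarrow> real \<Rightarrow> nat \<Rightarrow> nat \<Rightarrow> real" where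
  "lower_right nr nc x r c = (if r = nr - 1 \<and> c = nc - 1 then x else 0)"

definition block_L ::
    "(nat \<Rightarrow> nat) \<Rightarrow> (nat \<Rightarrow> real) \<Rightarrow> (nat \<Rightarrow> real) \<Rightarrow> nat \<Rightarrow> nat \<Rightarrow> real" where
  "block_L n l e = block_matrix n (\<lambda>i j r c.
     if i = j then (if block_size n j = 1 then [[1]] else [[1, 0], [e j, 1]]) ! r ! c
     else if i = Suc j then lower_right (block_size n i) (block_size n j) (l i) r c
     else 0)"

definition block_U :: "(nat \<Rightarrow> nat) \<Rightarrow> (nat \<Rightarrow> real) \<Rightarrow> nat \<Rightarrow> nat \<Rightarrow> real" where
  "block_U n u = block_matrix n (\<lambda>i j r c.
     if i = j then (if block_size n j = 1 then [[u j]] else [[0, 1], [u j, 0]]) ! r ! c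
     else if j = Suc i then lower_left (block_size n i) 1 r c
     else 0)"

text \<open>All products formed below have only finitely many nonzero summands in each entry.\<close>

definition inf_mat_mult ::
    "(nat \<Rightarrow> nat \<Rightarrow> real) \<Rightarrow> (nat \<Rightarrow> nat \<Rightarrow> real) \<Rightarrow> nat \<Rightarrow> nat \<Rightarrow> real" where
  "inf_mat_mult A B a b = (\<Sum>k. A a k * B k b)"

definition ell2 :: "(nat \<Rightarrow> complex) set" where
  "ell2 = {x. summable (\<lambda>i. (norm (x i))\<^sup>2)}"

definition bounded_in_ell2 :: "(nat \<Rightarrow> nat \<Rightarrow> real) \<Rightarrow> bool" where
  "bounded_in_ell2 A \<longleftrightarrow> (\<exists>C. \<forall>x\<in>ell2.
     (\<forall>i. summable (\<lambda>k. complex_of_real (A i k) * x k)) \<and>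
     (let y = (\<lambda>i. \<Sum>k. complex_of_real (A i k) * x k)
      in y \<in> ell2 \<and> (\<Sum>i. (norm (y i))\<^sup>2) \<le> C * (\<Sum>i. (norm (x i))\<^sup>2)))"

section \<open>The generalized Jacobi matrix\<close>

definition normalized :: "(complex \<Rightarrow> complex) \<Rightarrow> bool" where
  "normalized G \<longleftrightarrow> \<bar>first_coeff G\<bar> = 1"

definition cf_sign :: "(complex \<Rightarrow> complex) \<Rightarrow> real" where
  "cf_sign G = first_coeff G"

definition cf_poly :: "(complex \<Rightarrow> complex) \<Rightarrow> real poly" where
  "cf_poly G = (THE p. lead_coeff p = 1 \<and> (\<forall>\<delta>>0.
     ((\<lambda>z. - 1 / G z - complex_of_real (cf_sign G) * poly (map_poly complex_of_real p) z)
        \<longlongrightarrow> 0) (sector_at_infinity \<delta>)))"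

definition cf_remainder :: "(complex \<Rightarrow> complex) \<Rightarrow> complex \<Rightarrow> complex" where
  "cf_remainder G z =
     - 1 / G z - complex_of_real (cf_sign G) * poly (map_poly complex_of_real (cf_poly G)) z"

definition cf_b :: "(complex \<Rightarrow> complex) \<Rightarrow> real" where
  "cf_b G = (THE b. b > 0 \<and> normalized (\<lambda>z. cf_remainder G z / complex_of_real (b\<^sup>2)))"

text \<open>\<open>cf G j\<close> is the \<open>j\<close>-th function of the recursion, started at \<open>G\<close> divided by the modulus of
  its first nonzero coefficient (which is 1 if \<open>G\<close> is normalized).\<close>

primrec cf :: "(complex \<Rightarrow> complex) \<Rightarrow> nat \<Rightarrow> complex \<Rightarrow> complex" where
  "cf G 0 = (\<lambda>z. G z / complex_of_real \<bar>first_coeff G\<bar>)"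
| "cf G (Suc j) = (\<lambda>z. cf_remainder (cf G j) z / complex_of_real ((cf_b (cf G j))\<^sup>2))"

definition gj_p :: "(complex \<Rightarrow> complex) \<Rightarrow> nat \<Rightarrow> real poly" where
  "gj_p G j = cf_poly (cf G j)"

definition gj_c :: "(complex \<Rightarrow> complex) \<Rightarrow> nat \<Rightarrow> real" where
  "gj_c G j = cf_sign (cf G j) * cf_sign (cf G (Suc j)) * (cf_b (cf G j))\<^sup>2"

fun gj_P :: "(complex \<Rightarrow> complex) \<Rightarrow> nat \<Rightarrow> real poly" where
  "gj_P G 0 = 1"
| "gj_P G (Suc 0) = gj_p G 0"
| "gj_P G (Suc (Suc j)) = gj_p G (Suc j) * gj_P G (Suc j) - Polynomial.smult (gj_c G j) (gj_P G j)"

text \<open>In the following, \<open>n\<close> is the sequence of normal indices of the coefficients of \<open>G\<close>,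
  starting with \<open>n 0 = 0\<close>.\<close>

definition gen_jacobi :: "(nat \<Rightarrow> nat) \<Rightarrow> (complex \<Rightarrow> complex) \<Rightarrow> nat \<Rightarrow> nat \<Rightarrow> real" where
  "gen_jacobi n G = block_matrix n (\<lambda>i j r c.
     if i = j then
       (if block_size n j = 1 then [[- Polynomial.coeff (gj_p G j) 0]]
        else [[0, 1], [- Polynomial.coeff (gj_p G j) 0, - Polynomial.coeff (gj_p G j) 1]]) ! r ! c
     else if j = Suc i then lower_left (block_size n i) 1 r c
     else if i = Suc j then lower_left (block_size n i) (gj_c G j) r c
     else 0)"

section \<open>The two block factorizations\<close>

definition LU_lower_factor ::
    "(nat \<Rightarrow> nat) \<Rightarrow> (complex \<Rightarrow> complex) \<Rightarrow> (nat \<Rightarrow> nat \<Rightarrow> real) \<Rightarrow> bool" where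
  "LU_lower_factor n G L \<longleftrightarrow> (\<exists>u l e.
     (\<forall>j. u j = - poly (gj_P G (Suc j)) 0 / poly (gj_P G j) 0) \<and>
     (\<forall>j. l (Suc j) = gj_c G j / u j) \<and>
     (\<forall>j. block_size n j = 2 \<longrightarrow> e j = - Polynomial.coeff (gj_p G j) 1) \<and>
     L = block_L n l e \<and> gen_jacobi n G = inf_mat_mult L (block_U n u))"

definition P_hat :: "real measure \<Rightarrow> real \<Rightarrow> nat \<Rightarrow> real \<Rightarrow> real" where
  "P_hat \<sigma> sm1 j x = second_kind \<sigma> j x + sm1 * poly (orth_poly \<sigma> j) x"

text \<open>The entries \<open>u\<close> and \<open>e\<close> are determined by \<open>l\<close> and the factorization.\<close>

definition UL_lower_factor ::
    "(nat \<Rightarrow> nat) \<Rightarrow> real measure \<Rightarrow> real \<Rightarrow> (nat \<Rightarrow> nat \<Rightarrow> real) \<Rightarrow> bool" where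
  "UL_lower_factor n \<sigma> sm1 L \<longleftrightarrow> (\<exists>u l e.
     (\<forall>j\<ge>1. l j = - P_hat \<sigma> sm1 (n (Suc j) - 1) 0 / P_hat \<sigma> sm1 (n j - 1) 0) \<and>
     L = block_L n l e \<and> monic_jacobi \<sigma> = inf_mat_mult (block_U n u) L)"

section \<open>The Riemann sphere and Pade approximants\<close>

text \<open>A point of the Riemann sphere is a \<^typ>\<open>complex option\<close>, with \<^term>\<open>None\<close> the point at
  infinity.\<close>

type_synonym csphere = "complex option"

fun chordal :: "csphere \<Rightarrow> csphere \<Rightarrow> real" where
  "chordal (Some z) (Some w) =
     2 * cmod (z - w) / (sqrt (1 + (cmod z)\<^sup>2) * sqrt (1 + (cmod w)\<^sup>2))"
| "chordal (Some z) None = 2 / sqrt (1 + (cmod z)\<^sup>2)"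
| "chordal None (Some w) = 2 / sqrt (1 + (cmod w)\<^sup>2)"
| "chordal None None = 0"

definition loc_unif_conv ::
    "csphere set \<Rightarrow> (nat \<Rightarrow> csphere \<Rightarrow> csphere) \<Rightarrow> (csphere \<Rightarrow> csphere) \<Rightarrow> bool" where
  "loc_unif_conv S f g \<longleftrightarrow> (\<forall>z\<in>S. \<exists>r>0. \<forall>\<eta>>0. \<forall>\<^sub>F j in sequentially.
     \<forall>w\<in>S. chordal z w < r \<longrightarrow> chordal (f j w) (g w) < \<eta>)"

fun sphere_recip :: "csphere \<Rightarrow> csphere" where
  "sphere_recip None = Some 0"
| "sphere_recip (Some z) = (if z = 0 then None else Some (1 / z))"

text \<open>The rational map \<open>A / B\<close> of the sphere, for coprime \<open>A\<close> and \<open>B\<close>.\<close>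

fun ratio_map :: "complex poly \<Rightarrow> complex poly \<Rightarrow> csphere \<Rightarrow> csphere" where
  "ratio_map A B (Some x) = (if poly B x = 0 then None else Some (poly A x / poly B x))"
| "ratio_map A B None =
     (if Polynomial.degree A > Polynomial.degree B then None
      else Some (Polynomial.coeff A (Polynomial.degree B) / lead_coeff B))"

definition is_pade ::
    "(nat \<Rightarrow> real) \<Rightarrow> nat \<Rightarrow> nat \<Rightarrow> complex poly \<Rightarrow> complex poly \<Rightarrow> bool" where
  "is_pade s L M A B \<longleftrightarrow> Polynomial.degree A \<le> L \<and> Polynomial.degree B \<le> M \<and> poly B 0 \<noteq> 0 \<and>
     (\<lambda>z. (\<Sum>j<L + M. complex_of_real (s j) / z ^ (j + 1)) + poly A (1 / z) / poly B (1 / z))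
       \<in> O[at_infinity](\<lambda>z. 1 / z ^ (L + M + 1))"

text \<open>The numerator and denominator are unique only up to common factors; the rational map is
  unique.\<close>

definition pade :: "(nat \<Rightarrow> real) \<Rightarrow> nat \<Rightarrow> nat \<Rightarrow> csphere \<Rightarrow> csphere" where
  "pade s L M = (THE f. \<exists>A B. is_pade s L M A B \<and> coprime A B \<and>
     f = (\<lambda>z. ratio_map A B (sphere_recip z)))"

text \<open>The extension of \<^const>\<open>frakF\<close> to infinity, where it tends to 0. It is only used off the
  convex hull of the support of \<open>\<sigma>\<close> and of 0.\<close>

definition frakF_sphere :: "real measure \<Rightarrow> real \<Rightarrow> csphere \<Rightarrow> csphere" where
  "frakF_sphere \<sigma> sm1 z = (case z of None \<Rightarrow> Some 0 | Some w \<Rightarrow> Some (frakF \<sigma> sm1 w))"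

definition slit_sphere :: "real \<Rightarrow> csphere set" where
  "slit_sphere \<epsilon> = UNIV - (\<lambda>t. Some (complex_of_real t)) ` {- 1 - \<epsilon>..1 + \<epsilon>}"

end

theory Submission
  imports
    Defs
    "HOL-Computational_Algebra.Fundamental_Theorem_Algebra"
begin

text \<open>Let \<open>P n\<close> be the monic orthogonal polynomials of \<open>\<sigma>\<close>, with recurrence coefficients \<open>b\<close>, \<open>c\<close> and
  square norms \<open>N n\<close>, and let \<open>S\<close> be the functional with moments \<open>frak_s\<close>, so that \<open>S (X * p)\<close> is the
  integral of \<open>p\<close>. Everything is governed by the numbers \<open>h n = S (P n)\<close>, which are the values at 0
  of the polynomials \<open>P_hat\<close>. A number \<open>n \<ge> 1\<close> is a normal index exactly if \<open>h (n - 1) \<noteq> 0\<close>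
  (\<open>hankel_det_zero_iff\<close>), and two consecutive \<open>h\<close> never vanish together because of the Wronskian
  identity, whence the blocks have size 1 or 2. For a normal index \<open>n = nn j\<close> the monic orthogonal
  polynomial of \<open>S\<close> is \<open>V j = P n + \<alpha> n P (n - 1)\<close> with \<open>\<alpha> n = - h n / h (n - 1)\<close>.

  Equivalence of (i) and (ii). With \<open>W j = P (nn j - 1)\<close> the two families satisfy an interlaced
  recurrence (\<open>W_Suc\<close>, \<open>X_W_Suc\<close>), whose coefficients are the entries of the block factors. Read
  for the basis \<open>P\<close> it says \<open>J = U L\<close>; eliminating \<open>W\<close> gives the three-term recurrence of \<open>V\<close>, that is
  the product \<open>L U\<close> in the other order. The functions of the second kind obey the same recurrence,
  and a continued fraction of functions that are holomorphic at infinity is determined by its first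
  term (locale \<open>continued_fraction\<close>), so that this product is the generalized Jacobi matrix of the
  perturbed transform. The lower factors in (i) and (ii) are thus the same matrix \<open>L_factor\<close>, and (i)
  and (ii) say literally the same. Its entries other than the \<open>l j\<close> are bounded by 1; therefore it is
  bounded if and only if the \<open>\<alpha> (nn j)\<close> are (\<open>bounded_L_factor\<close>).

  Equivalence with (iii). The approximant at \<open>nn j\<close> has the denominator \<open>V j\<close>, its numerator has no
  zero in common with \<open>V j\<close>, and its error is the Cauchy transform of \<open>V j\<close> divided by \<open>z V j(z)\<close>,
  up to sign. If \<open>\<bar>\<alpha>\<bar> \<le> A\<close>, this tends to 0 geometrically: off the real line by the
  Christoffel-Darboux formula, as a real \<open>\<alpha>\<close> does not affect the imaginary part that it computes,
  and for \<open>\<bar>z\<bar> \<ge> A + 4\<close> because \<open>P (n + 1) / P n\<close> is within distance 2 of \<open>z\<close>. Conversely, by the same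
  estimate and the intermediate value theorem, a large \<open>\<alpha>\<close> forces a real zero of \<open>V j\<close> far away, hence
  a pole of the approximant at a point where the limit is small. This contradicts convergence near
  infinity.\<close>

section \<open>Integrals of polynomials over the unit interval\<close>

locale unit_interval_measure = finite_measure \<sigma> for \<sigma> :: "real measure" +
  assumes sets_borel [measurable_cong]: "sets \<sigma> = sets borel"
    and support_subset: "measure_support \<sigma> \<subseteq> {-1..1}"
    and infinite_support: "infinite (measure_support \<sigma>)"
begin

lemma space_UNIV [simp]: "space \<sigma> = UNIV"
  using sets_eq_imp_space_eq[OF sets_borel] by simp

text \<open>The complement of the support is a union of open null sets, and by Lindelof countably many of
  them cover it.\<close>

lemma AE_unit: "AE t in \<sigma>. t \<in> {-1..1}"
proof -
  define F where "F = {U :: real set. open U \<and> emeasure \<sigma> U = 0}"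
  have op: "\<And>S. S \<in> F \<Longrightarrow> open S" by (auto simp: F_def)
  obtain F' where F': "F' \<subseteq> F" "countable F'" "\<Union>F' = \<Union>F"
    using Lindelof[of F] op by metis
  have "(\<Union>U\<in>F'. U) \<in> null_sets \<sigma>"
    using F' by (intro null_sets_UN') (auto simp: F_def null_sets_def sets_borel)
  moreover have "- {-1..1} \<subseteq> \<Union>F"
  proof
    fix x :: real assume "x \<in> - {-1..1}"
    then have "x \<notin> measure_support \<sigma>" using support_subset by auto
    then show "x \<in> \<Union>F" unfolding measure_support_def F_def
      by (auto simp: not_gr_zero)
  qed
  ultimately have "- {-1..1} \<subseteq> \<Union>F'" "\<Union>F' \<in> null_sets \<sigma>" using F' by auto
  then show ?thesis
    by (intro AE_I[of _ _ "\<Union>F'"]) auto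
qed

lemma integrable_bounded_on_unit:
  fixes f :: "real \<Rightarrow> 'b :: {banach, second_countable_topology}"
  assumes "f \<in> borel_measurable borel" and "\<And>t. t \<in> {-1..1} \<Longrightarrow> norm (f t) \<le> B"
  shows "integrable \<sigma> f"
proof (rule integrable_const_bound)
  show "AE t in \<sigma>. norm (f t) \<le> B" using AE_unit by eventually_elim (rule assms(2))
  show "f \<in> borel_measurable \<sigma>" using assms(1) by measurable
qed

lemma norm_integral_le_unit:
  fixes f :: "real \<Rightarrow> 'b :: {banach, second_countable_topology}"
  assumes "f \<in> borel_measurable borel" and "\<And>t. t \<in> {-1..1} \<Longrightarrow> norm (f t) \<le> B"
  shows "norm (\<integral>t. f t \<partial>\<sigma>) \<le> B * measure \<sigma> UNIV"
proof -
  have "norm (\<integral>t. f t \<partial>\<sigma>) \<le> (\<integral>t. norm (f t) \<partial>\<sigma>)" by (rule integral_norm_bound)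
  also have "\<dots> \<le> (\<integral>t. B \<partial>\<sigma>)"
    using AE_unit assms by (intro integral_mono_AE integrable_norm integrable_bounded_on_unit[OF assms]) auto
  finally show ?thesis by (simp add: mult.commute)
qed

lemma poly_bounded_on_unit: "\<exists>B. \<forall>t\<in>{-1..1}. \<bar>poly p t\<bar> \<le> (B::real)"
proof -
  have "compact (poly p ` {-1..1::real})" 
    by (intro compact_continuous_image continuous_intros) auto
  then have "bounded (poly p ` {-1..1})" by (rule compact_imp_bounded)
  then show ?thesis by (auto simp: bounded_iff)
qed

lemma poly_borel: "(\<lambda>t. poly p t) \<in> borel_measurable borel" for p :: "real poly"
  by (intro borel_measurable_continuous_onI continuous_intros)

lemma integrable_poly: "integrable \<sigma> (\<lambda>t. poly p t)"
  using poly_bounded_on_unit[of p] by (auto intro!: integrable_bounded_on_unit poly_borel)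

definition I :: "real poly \<Rightarrow> real" where "I p = (\<integral>t. poly p t \<partial>\<sigma>)"

lemma I_add: "I (p + q) = I p + I q"
proof -
  have "I (p + q) = (\<integral>t. poly p t + poly q t \<partial>\<sigma>)" unfolding I_def by (intro arg_cong[where f = "integral\<^sup>L \<sigma>"]) auto
  then show ?thesis by (simp add: I_def integrable_poly)
qed

lemma I_smult: "I (Polynomial.smult a p) = a * I p"
proof -
  have "I (Polynomial.smult a p) = (\<integral>t. a * poly p t \<partial>\<sigma>)" unfolding I_def by (intro arg_cong[where f = "integral\<^sup>L \<sigma>"]) auto
  then show ?thesis by (simp add: I_def)
qed

lemma I_diff: "I (p - q) = I p - I q"
  using I_add[of p "- q"] I_smult[of "-1" q] by simp

lemma I_0: "I 0 = 0"
  using I_smult[of 0 0] by simp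

lemmas I_lin = I_add I_diff I_smult I_0

lemma I_mono: assumes "\<And>t. t \<in> {-1..1} \<Longrightarrow> poly p t \<le> poly q t" shows "I p \<le> I q"
  unfolding I_def using AE_unit assms by (intro integral_mono_AE integrable_poly) auto

text \<open>Otherwise the open set where \<open>p\<close> does not vanish would be null, and the support would consist of
  the finitely many zeros of \<open>p\<close>. All nondegeneracy comes from this lemma.\<close>

lemma I_square_pos:
  assumes "p \<noteq> 0" shows "I (p * p) > 0"
proof (rule ccontr)
  assume "\<not> I (p * p) > 0"
  moreover have "I (p * p) \<ge> 0" unfolding I_def by (intro Bochner_Integration.integral_nonneg) auto
  ultimately have "I (p * p) = 0" by simp
  then have "AE t in \<sigma>. poly (p * p) t = 0"
    unfolding I_def by (subst (asm) integral_nonneg_eq_0_iff_AE) (auto simp: integrable_poly)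
  then have ae: "AE t in \<sigma>. poly p t = 0" by simp
  define Z where "Z = {t. poly p t \<noteq> 0}"
  have "open Z" unfolding Z_def by (intro open_Collect_neq continuous_intros)
  then have "Z \<in> sets \<sigma>" by (simp add: sets_borel)
  with ae have "emeasure \<sigma> Z = 0" unfolding Z_def by (subst (asm) AE_iff_measurable[of Z]) (auto simp: Z_def)
  with \<open>open Z\<close> have "measure_support \<sigma> \<subseteq> {t. poly p t = 0}"
    unfolding measure_support_def by (force simp: Z_def)
  with poly_roots_finite[OF assms] infinite_support show False using finite_subset by blast
qed

section \<open>Monic orthogonal polynomials and their recurrence\<close>

abbreviation X :: "real poly" where "X \<equiv> [:0, 1:]"

lemma integral_poly_mult: "(\<integral>t. poly p t * poly q t \<partial>\<sigma>) = I (p * q)"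
  unfolding I_def by (intro arg_cong[where f = "integral\<^sup>L \<sigma>"]) auto

text \<open>The property in the description that defines \<^const>\<open>orth_poly\<close>. Stated as a predicate it can be
  constructed through the three-term recurrence, before existence is known.\<close>

definition monic_orth :: "nat \<Rightarrow> real poly \<Rightarrow> bool" where
  "monic_orth n p \<longleftrightarrow> Polynomial.degree p = n \<and> lead_coeff p = 1 \<and>
     (\<forall>q. Polynomial.degree q < n \<longrightarrow> I (p * q) = 0)"

lemma monic_orthD:
  assumes "monic_orth n p"
  shows "Polynomial.degree p = n" "Polynomial.coeff p n = 1" "p \<noteq> 0" "I (p * p) > 0"
  using assms by (auto simp: monic_orth_def intro!: I_square_pos)

lemma monic_orth_zero: "monic_orth n p \<Longrightarrow> Polynomial.degree q < n \<or> q = 0 \<Longrightarrow> I (p * q) = 0"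
  by (auto simp: monic_orth_def I_0)

lemma monic_orth_diff:
  assumes "monic_orth n p" "Polynomial.degree q \<le> n" "Polynomial.coeff q n = a"
  shows "Polynomial.degree (q - Polynomial.smult a p) < n \<or> q - Polynomial.smult a p = 0"
proof -
  have "Polynomial.degree (q - Polynomial.smult a p) \<le> n"
    using assms monic_orthD[OF assms(1)] by (intro degree_diff_le) auto
  moreover have "Polynomial.coeff (q - Polynomial.smult a p) n = 0"
    using assms monic_orthD[OF assms(1)] by simp
  ultimately show ?thesis using eq_zero_or_degree_less by blast
qed

lemma monic_orth_unique:
  assumes "monic_orth n p" "monic_orth n q" shows "p = q"
proof -
  have d: "Polynomial.degree (q - p) < n \<or> q - p = 0"
    using monic_orth_diff[OF assms(1), of q 1] monic_orthD[OF assms(2)] by simp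
  have "I ((q - p) * (q - p)) = I (q * (q - p)) - I (p * (q - p))"
    by (simp add: I_diff[symmetric] algebra_simps)
  also have "\<dots> = 0" using monic_orth_zero[OF assms(1) d] monic_orth_zero[OF assms(2) d] by simp
  finally show ?thesis using I_square_pos[of "q - p"] by force
qed

lemma monic_orth_0: "monic_orth 0 1"
  by (simp add: monic_orth_def)

lemma monic_orth_1: "monic_orth (Suc 0) (X - [:I X / I 1:])"
proof -
  have pos: "I 1 > 0" using I_square_pos[of 1] by simp
  have "I ((X - [:I X / I 1:]) * q) = 0" if "Polynomial.degree q < Suc 0" for q
  proof -
    have "Polynomial.degree q = 0" using that by simp
    then obtain a where a: "q = [:a:]" by (rule degree_eq_zeroE)
    have e: "(X - [:I X / I 1:]) * q = Polynomial.smult a (X - Polynomial.smult (I X / I 1) 1)" using a by simp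
    show ?thesis unfolding e I_lin using pos by simp
  qed
  then show ?thesis by (simp add: monic_orth_def)
qed

text \<open>A polynomial of degree at most \<open>n + 1\<close> is a combination of \<open>p\<close>, \<open>p'\<close> and some \<open>r'\<close> of degree
  below \<open>n\<close>; since \<open>X * r'\<close> has degree at most \<open>n\<close>, orthogonality to \<open>r'\<close> is inherited. The two
  coefficients are chosen to achieve orthogonality to \<open>p\<close> and \<open>p'\<close>.\<close>

lemma monic_orth_step:
  assumes p: "monic_orth (Suc n) p" and p': "monic_orth n p'"
  shows "monic_orth (Suc (Suc n))
    (X * p - Polynomial.smult (I (X * (p * p)) / I (p * p)) p - Polynomial.smult (I (p * p) / I (p' * p')) p')"
    (is "monic_orth _ ?R")
proof -
  note D = monic_orthD[OF p] and D' = monic_orthD[OF p']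
  define b c where "b = I (X * (p * p)) / I (p * p)" and "c = I (p * p) / I (p' * p')"
  have ip: "I (p * p') = 0" using D' by (intro monic_orth_zero[OF p]) auto
  have xp': "I (p * (X * p')) = I (p * p)"
  proof -
    have "Polynomial.degree (X * p' - Polynomial.smult 1 p) < Suc n \<or> X * p' - Polynomial.smult 1 p = 0"
      using D' by (intro monic_orth_diff[OF p]) (auto simp: coeff_pCons)
    from monic_orth_zero[OF p this] have "I (p * (X * p') - p * p) = 0" by (simp add: algebra_simps)
    then show ?thesis by (simp only: I_diff)
  qed
  have R: "?R = X * p - Polynomial.smult b p - Polynomial.smult c p'" by (simp add: b_def c_def)
  have exp: "I (?R * q) = I (p * (X * q)) - b * I (p * q) - c * I (p' * q)" for q
  proof -
    have "?R * q = p * (X * q) - Polynomial.smult b (p * q) - Polynomial.smult c (p' * q)"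
      unfolding R by (simp add: algebra_simps)
    then show ?thesis by (simp only: I_lin)
  qed
  have 1: "I (?R * p) = 0" unfolding exp using ip D by (simp add: b_def mult.commute mult.left_commute)
  have 2: "I (?R * p') = 0" unfolding exp using ip xp' D' by (simp add: c_def mult.commute)
  have "I (?R * q) = 0" if q: "Polynomial.degree q < Suc (Suc n)" for q
  proof -
    define \<alpha> where "\<alpha> = Polynomial.coeff q (Suc n)"
    define r where "r = q - Polynomial.smult \<alpha> p"
    have r: "Polynomial.degree r < Suc n \<or> r = 0" unfolding r_def using q
      by (intro monic_orth_diff[OF p]) (auto simp: \<alpha>_def)
    define \<beta> where "\<beta> = Polynomial.coeff r n"
    define r' where "r' = r - Polynomial.smult \<beta> p'"
    have r': "Polynomial.degree r' < n \<or> r' = 0" unfolding r'_def using r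
      by (intro monic_orth_diff[OF p']) (auto simp: \<beta>_def)
    have 3: "I (?R * r') = 0"
    proof -
      have "I (p * (X * r')) = 0" using r' by (intro monic_orth_zero[OF p]) auto
      moreover have "I (p * r') = 0" using r' by (intro monic_orth_zero[OF p]) auto
      moreover have "I (p' * r') = 0" using r' by (intro monic_orth_zero[OF p']) auto
      ultimately show ?thesis unfolding exp by simp
    qed
    have q_eq: "q = Polynomial.smult \<alpha> p + Polynomial.smult \<beta> p' + r'"
      by (simp add: r'_def r_def)
    have "F * q = Polynomial.smult \<alpha> (F * p) + Polynomial.smult \<beta> (F * p') + F * r'" for F
      unfolding q_eq by (simp add: algebra_simps)
    then have "I (?R * q) = \<alpha> * I (?R * p) + \<beta> * I (?R * p') + I (?R * r')" by (simp only: I_lin)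
    then show ?thesis by (simp only: 1 2 3)
  qed
  moreover have "Polynomial.degree ?R = Suc (Suc n)" "Polynomial.coeff ?R (Suc (Suc n)) = 1"
  proof -
    have X: "Polynomial.degree (X * p) = Suc (Suc n)" using D by (simp add: degree_mult_eq)
    have s: "Polynomial.degree (Polynomial.smult b p + Polynomial.smult c p') < Suc (Suc n)"
      using D D' by (intro le_less_trans[OF degree_add_le[of _ "Suc n"]]) auto
    have R': "?R = X * p + - (Polynomial.smult b p + Polynomial.smult c p')" unfolding R by simp
    show "Polynomial.degree ?R = Suc (Suc n)" unfolding R' by (subst degree_add_eq_left) (simp_all only: degree_minus X s)
    show "Polynomial.coeff ?R (Suc (Suc n)) = 1"
      using D D' by (simp add: coeff_pCons coeff_eq_0)
  qed
  ultimately show ?thesis unfolding monic_orth_def by metis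
qed

lemma ex_monic_orth: "\<exists>p. monic_orth n p"
proof (induction n rule: less_induct)
  case (less n)
  consider "n = 0" | "n = 1" | m where "n = Suc (Suc m)" by (metis One_nat_def not0_implies_Suc)
  then show ?case
    using monic_orth_0 monic_orth_1 monic_orth_step less by cases (auto, metis lessI less_SucI)
qed

abbreviation P :: "nat \<Rightarrow> real poly" where "P \<equiv> orth_poly \<sigma>"

lemma monic_orth_P: "monic_orth n (P n)"
proof -
  have "P n = (THE p. monic_orth n p)"
    unfolding orth_poly_def monic_orth_def integral_poly_mult ..
  then show ?thesis using theI'[of "monic_orth n"] ex_monic_orth monic_orth_unique by metis
qed

lemma P_eqI: "monic_orth n p \<Longrightarrow> P n = p"
  using monic_orth_P monic_orth_unique by blast

definition N :: "nat \<Rightarrow> real" where "N n = I (P n * P n)"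
definition b :: "nat \<Rightarrow> real" where "b n = I (X * (P n * P n)) / N n"
definition c :: "nat \<Rightarrow> real" where "c n = N (Suc n) / N n"

lemma N_pos [simp]: "N n > 0" using monic_orthD(4)[OF monic_orth_P] by (simp add: N_def)
lemma N_nonzero [simp]: "N n \<noteq> 0" using N_pos[of n] by linarith
lemma c_pos [simp]: "c n > 0" by (simp add: c_def)
lemma c_nonzero [simp]: "c n \<noteq> 0" using c_pos[of n] by linarith
lemma N_Suc: "N (Suc n) = c n * N n" by (simp add: c_def)

lemma P_0 [simp]: "P 0 = 1" by (rule P_eqI[OF monic_orth_0])
lemma degree_P [simp]: "Polynomial.degree (P n) = n" using monic_orthD(1)[OF monic_orth_P] .
lemma coeff_P [simp]: "Polynomial.coeff (P n) n = 1" using monic_orthD(2)[OF monic_orth_P] .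
lemma P_orth: "Polynomial.degree q < n \<Longrightarrow> I (P n * q) = 0" using monic_orth_zero[OF monic_orth_P] by blast
lemma N_0: "N 0 = I 1" by (simp add: N_def)
lemma P_1: "P (Suc 0) = [:- b 0, 1:]"
  by (subst P_eqI[OF monic_orth_1]) (simp add: b_def N_0)
lemma P_rec: "P (Suc (Suc n)) = [:- b (Suc n), 1:] * P (Suc n) - Polynomial.smult (c n) (P n)"
  using P_eqI[OF monic_orth_step[OF monic_orth_P[of "Suc n"] monic_orth_P[of n]]]
  by (simp add: b_def c_def N_def)

lemma abs_b_le: "\<bar>b n\<bar> \<le> 1"
proof -
  have m: "t * (x * x) \<le> x * x" "- (x * x) \<le> t * (x * x)" if "t \<in> {-1..1}" for t x :: real
    using that mult_right_mono[of t 1 "x * x"] mult_right_mono[of "-1" t "x * x"] by auto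
  have "I (X * (P n * P n)) \<le> N n" unfolding N_def
    by (rule I_mono) (simp add: m)
  moreover have "- N n \<le> I (X * (P n * P n))"
  proof -
    have "I (Polynomial.smult (-1) (P n * P n)) \<le> I (X * (P n * P n))"
      by (rule I_mono) (simp add: m)
    then show ?thesis unfolding I_smult N_def by simp
  qed
  ultimately show ?thesis by (simp add: b_def abs_le_iff field_simps)
qed

text \<open>\<open>P (n + 1)\<close> is the projection of \<open>X * P n\<close> to the orthogonal complement of the lower degrees, and
  multiplication by \<open>X\<close> is a contraction on the interval.\<close>

lemma N_Suc_le: "N (Suc n) \<le> N n"
proof -
  have d: "Polynomial.degree (P (Suc n) - X * P n) < Suc n \<or> P (Suc n) - X * P n = 0"
  proof -
    have "Polynomial.degree (P (Suc n) - X * P n) \<le> Suc n" by (intro degree_diff_le) auto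
    moreover have "Polynomial.coeff (P (Suc n) - X * P n) (Suc n) = 0" by (simp add: coeff_pCons)
    ultimately show ?thesis using eq_zero_or_degree_less by blast
  qed
  define r where "r = X * P n - P (Suc n)"
  have "Polynomial.degree r < Suc n \<or> r = 0" using d unfolding r_def
    by (metis degree_minus minus_diff_eq neg_equal_0_iff_equal)
  then have o: "I (P (Suc n) * r) = 0" using monic_orth_zero[OF monic_orth_P] by blast
  have "X * P n = P (Suc n) + r" by (simp add: r_def)
  then have "I ((X * P n) * (X * P n)) = I (P (Suc n) * P (Suc n) + P (Suc n) * r + P (Suc n) * r + r * r)"
    by (simp only:) (simp add: algebra_simps)
  also have "\<dots> = N (Suc n) + I (r * r)" unfolding I_lin o N_def by simp
  finally have "N (Suc n) \<le> I ((X * P n) * (X * P n))"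
    using I_square_pos[of r] by (cases "r = 0") (auto simp: I_0)
  also have "\<dots> \<le> N n" unfolding N_def
  proof (rule I_mono)
    fix t :: real assume "t \<in> {-1..1}"
    then have "t\<^sup>2 \<le> 1" by (auto simp: abs_square_le_1 abs_le_iff)
    then have "t\<^sup>2 * (poly (P n) t)\<^sup>2 \<le> 1 * (poly (P n) t)\<^sup>2" by (rule mult_right_mono) simp
    then show "poly ((X * P n) * (X * P n)) t \<le> poly (P n * P n) t"
      by (simp add: power2_eq_square algebra_simps)
  qed
  finally show ?thesis .
qed

lemma N_antimono: "m \<le> n \<Longrightarrow> N n \<le> N m" 
  using lift_Suc_antimono_le[of N] N_Suc_le by blast

lemma c_le_1: "c n \<le> 1" using N_Suc_le[of n] by (simp add: c_def)

text \<open>Uniqueness follows by comparing first the coefficients of degree \<open>j\<close> and then the multiples of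
  \<open>P (j - 1)\<close> that remain.\<close>

lemma jacobi_coeffs_eq: "jacobi_coeffs \<sigma> = (b, c)"
proof -
  let ?R = "\<lambda>b c j. X * P j = P (Suc j) + Polynomial.smult (b j) (P j) +
       (case j of 0 \<Rightarrow> 0 | Suc i \<Rightarrow> Polynomial.smult (c i) (P i))"
  have rec: "?R b c j" for j
    by (cases j) (auto simp: P_1 P_rec algebra_simps)
  have uniq: "b' = b \<and> c' = c" if R: "\<And>j. ?R b' c' j" for b' c'
  proof -
    have bj: "b' j = b j" for j
    proof -
      have "Polynomial.coeff (X * P j - P (Suc j)) j = b' j" 
        using R[of j] by (cases j) (auto simp: coeff_eq_0)
      moreover have "Polynomial.coeff (X * P j - P (Suc j)) j = b j" 
        using rec[of j] by (cases j) (auto simp: coeff_eq_0)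
      ultimately show ?thesis by simp
    qed
    have "c' i = c i" for i
    proof -
      have "Polynomial.smult (c' i) (P i) = Polynomial.smult (c i) (P i)"
        using R[of "Suc i"] rec[of "Suc i"] by (simp add: bj)
      then show ?thesis using coeff_P[of i] by (metis coeff_smult mult.right_neutral)
    qed
    with bj show ?thesis by auto
  qed
  show ?thesis unfolding jacobi_coeffs_def
    by (rule the_equality) (use rec uniq in \<open>auto split: prod.splits\<close>)
qed

end

section \<open>Polynomials and functions of the second kind\<close>

abbreviation cpoly :: "real poly \<Rightarrow> complex poly" where
  "cpoly p \<equiv> map_poly complex_of_real p"

lemma cpoly_pCons [simp]: "cpoly (pCons a p) = pCons (of_real a) (cpoly p)"
  by (cases "p = 0 \<and> a = 0") (auto simp: map_poly_pCons)
lemma cpoly_add: "cpoly (p + q) = cpoly p + cpoly q"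
  by (rule poly_eqI) (simp add: coeff_map_poly)
lemma cpoly_diff: "cpoly (p - q) = cpoly p - cpoly q"
  by (rule poly_eqI) (simp add: coeff_map_poly)
lemma cpoly_smult: "cpoly (Polynomial.smult a p) = Polynomial.smult (of_real a) (cpoly p)"
  by (rule poly_eqI) (simp add: coeff_map_poly)
lemma cpoly_mult: "cpoly (p * q) = cpoly p * cpoly q"
  by (induction p) (simp_all add: cpoly_add cpoly_smult)
lemma cpoly_1: "cpoly 1 = 1"
  by (simp add: one_pCons)
lemma poly_cpoly_of_real: "poly (cpoly p) (of_real x) = of_real (poly p x)"
  by (induction p) auto
lemma degree_cpoly [simp]: "Polynomial.degree (cpoly p) = Polynomial.degree p"
  by (rule degree_map_poly) auto

lemma synthetic_div_add: "synthetic_div (p + q) t = synthetic_div p t + synthetic_div q t"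
  by (induction p q rule: poly_induct2) (simp_all add: synthetic_div_pCons)
lemma synthetic_div_smult: "synthetic_div (Polynomial.smult a p) t = Polynomial.smult a (synthetic_div p t)"
  by (induction p) (simp_all add: synthetic_div_pCons)

definition unit_segment :: "complex set" where
  "unit_segment = complex_of_real ` {-1..1}"

lemma unit_segment_dist:
  assumes "z \<notin> unit_segment"
  shows "\<exists>d>0. \<forall>t\<in>{-1..1}. d \<le> cmod (of_real t - z)"
proof (cases "Im z = 0")
  case False
  have "\<bar>Im z\<bar> \<le> cmod (of_real t - z)" for t using abs_Im_le_cmod[of "of_real t - z"] by simp
  then show ?thesis using False by (intro exI[of _ "\<bar>Im z\<bar>"]) auto
next
  case True
  then have z: "z = of_real (Re z)" by (simp add: complex_eq_iff)
  have "\<bar>Re z\<bar> > 1"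
  proof (rule ccontr)
    assume "\<not> \<bar>Re z\<bar> > 1"
    then have "z \<in> unit_segment" unfolding unit_segment_def by (subst z, intro imageI) auto
    then show False using assms by simp
  qed
  moreover have "\<bar>Re z\<bar> - 1 \<le> cmod (of_real t - z)" if "t \<in> {-1..1}" for t
    using that abs_Re_le_cmod[of "of_real t - z"] by auto
  ultimately show ?thesis by (intro exI[of _ "\<bar>Re z\<bar> - 1"]) auto
qed

context unit_interval_measure
begin

lemma I_P_Suc: "I (P (Suc n)) = 0"
  using P_orth[of 1 "Suc n"] by simp

text \<open>The recurrence of \<open>P\<close> with other initial values; \<open>second_kind_eq\<close> below identifies these as
  the polynomials of the second kind.\<close>

fun Q :: "nat \<Rightarrow> real poly" where
  "Q 0 = 0"
| "Q (Suc 0) = [:N 0:]"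
| "Q (Suc (Suc n)) = [:- b (Suc n), 1:] * Q (Suc n) - Polynomial.smult (c n) (Q n)"

text \<open>The integral of the divided difference \<open>(p x - p t) / (x - t)\<close> over \<open>t\<close>.\<close>

definition div_diff_int :: "real poly \<Rightarrow> real \<Rightarrow> real" where
  "div_diff_int p x = (\<integral>t. poly (synthetic_div p t) x \<partial>\<sigma>)"

lemma ex_synthetic_div_poly: "\<exists>r. \<forall>t. poly (synthetic_div p t) x = poly r (t::real)"
proof (induction p)
  case (pCons a p)
  then obtain r where "\<forall>t. poly (synthetic_div p t) x = poly r t" by blast
  then show ?case by (intro exI[of _ "p + Polynomial.smult x r"]) (simp add: synthetic_div_pCons)
qed (auto intro: exI[of _ 0])

lemma integrable_synthetic_div: "integrable \<sigma> (\<lambda>t. poly (synthetic_div p t) x)"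
  using ex_synthetic_div_poly[of p x] integrable_poly by auto

lemma div_diff_int_add: "div_diff_int (p + q) x = div_diff_int p x + div_diff_int q x"
  unfolding div_diff_int_def synthetic_div_add poly_add
  by (intro Bochner_Integration.integral_add integrable_synthetic_div)
lemma div_diff_int_smult: "div_diff_int (Polynomial.smult a p) x = a * div_diff_int p x"
  unfolding div_diff_int_def synthetic_div_smult poly_smult by simp
lemma div_diff_int_diff: "div_diff_int (p - q) x = div_diff_int p x - div_diff_int q x"
  using div_diff_int_add[of p "- q"] div_diff_int_smult[of "-1" q] by simp
lemma div_diff_int_X: "div_diff_int (X * p) x = x * div_diff_int p x + I p"
proof -
  have "div_diff_int (X * p) x = (\<integral>t. poly p t + x * poly (synthetic_div p t) x \<partial>\<sigma>)"
    unfolding div_diff_int_def by (simp add: synthetic_div_pCons)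
  then show ?thesis by (simp add: div_diff_int_def I_def integrable_poly integrable_synthetic_div)
qed

lemma second_kind_eq: "second_kind \<sigma> n x = poly (Q n) x"
proof -
  have "div_diff_int (P n) x = poly (Q n) x"
  proof (induction n rule: Q.induct)
    case 1
    show ?case by (simp add: div_diff_int_def one_pCons synthetic_div_pCons)
  next
    case 2
    have "P (Suc 0) = X * 1 - Polynomial.smult (b 0) 1" by (simp add: P_1)
    then have "div_diff_int (P (Suc 0)) x = x * div_diff_int 1 x + I 1 - b 0 * div_diff_int 1 x"
      by (simp only: div_diff_int_diff div_diff_int_smult div_diff_int_X)
    moreover have "div_diff_int 1 x = 0" by (simp add: div_diff_int_def one_pCons synthetic_div_pCons)
    ultimately show ?case by (simp add: N_0)
  next
    case (3 n)
    have "P (Suc (Suc n)) = X * P (Suc n) - Polynomial.smult (b (Suc n)) (P (Suc n)) - Polynomial.smult (c n) (P n)"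
      by (simp add: P_rec)
    then have "div_diff_int (P (Suc (Suc n))) x = x * div_diff_int (P (Suc n)) x - b (Suc n) * div_diff_int (P (Suc n)) x - c n * div_diff_int (P n) x"
      by (simp only: div_diff_int_diff div_diff_int_smult div_diff_int_X I_P_Suc)
    then show ?case by (simp add: 3 algebra_simps)
  qed
  then show ?thesis by (simp add: second_kind_def div_diff_int_def)
qed

text \<open>Each step of the recurrence multiplies the determinant by \<open>c n\<close>.\<close>

lemma wronskian: "P n * Q (Suc n) - P (Suc n) * Q n = [:N n:]"
proof (induction n)
  case (Suc n)
  have "P (Suc n) * Q (Suc (Suc n)) - P (Suc (Suc n)) * Q (Suc n)
      = Polynomial.smult (c n) (P n * Q (Suc n) - P (Suc n) * Q n)"
    by (simp add: P_rec smult_diff_right algebra_simps)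
  also have "\<dots> = [:N (Suc n):]" by (simp add: Suc.IH N_Suc)
  finally show ?case .
qed simp

lemma cauchy_integrand_borel:
  "(\<lambda>t. complex_of_real (poly p t) / (complex_of_real t - z)) \<in> borel_measurable borel"
  using poly_borel[of p] by measurable

lemma borel_measurableI_sigma: "f \<in> borel_measurable borel \<Longrightarrow> f \<in> borel_measurable \<sigma>"
  using measurable_cong_sets[OF sets_borel refl] by blast

lemma integrable_cauchy:
  assumes "z \<notin> unit_segment"
  shows "integrable \<sigma> (\<lambda>t. complex_of_real (poly p t) / (complex_of_real t - z))"
proof -
  obtain d where d: "d > 0" "\<forall>t\<in>{-1..1}. d \<le> cmod (of_real t - z)" using unit_segment_dist[OF assms] by blast
  obtain B where B: "\<forall>t\<in>{-1..1}. \<bar>poly p t\<bar> \<le> B" using poly_bounded_on_unit by blast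
  show ?thesis
  proof (rule integrable_bounded_on_unit[OF cauchy_integrand_borel])
    fix t :: real assume "t \<in> {-1..1}"
    then show "norm (complex_of_real (poly p t) / (complex_of_real t - z)) \<le> B / d"
      using d B by (auto simp: norm_divide intro!: frac_le)
  qed
qed

text \<open>The Cauchy transform of \<open>p\<close> times \<open>\<sigma>\<close>; for \<open>p = P n\<close> it is the function of the second kind.\<close>

definition E :: "real poly \<Rightarrow> complex \<Rightarrow> complex" where
  "E p z = (\<integral>t. complex_of_real (poly p t) / (complex_of_real t - z) \<partial>\<sigma>)"

lemma E_add: "z \<notin> unit_segment \<Longrightarrow> E (p + q) z = E p z + E q z"
  unfolding E_def by (simp add: add_divide_distrib integrable_cauchy)
lemma E_smult: "E (Polynomial.smult a p) z = of_real a * E p z"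
  unfolding E_def by (simp flip: times_divide_eq_right)
lemma E_diff: "z \<notin> unit_segment \<Longrightarrow> E (p - q) z = E p z - E q z"
  using E_add[of z p "- q"] E_smult[of "-1" q z] by simp

lemma of_real_I: "(\<integral>t. complex_of_real (poly p t) \<partial>\<sigma>) = of_real (I p)"
  unfolding I_def by simp

text \<open>Integrate \<open>t / (t - z) = 1 + z / (t - z)\<close> against \<open>p\<close>.\<close>

lemma E_X: assumes "z \<notin> unit_segment" shows "E (X * p) z = z * E p z + of_real (I p)"
proof -
  have "E (X * p) z = (\<integral>t. z * (complex_of_real (poly p t) / (complex_of_real t - z)) + complex_of_real (poly p t) \<partial>\<sigma>)"
    unfolding E_def
  proof (rule integral_cong_AE)
    show "AE t in \<sigma>. complex_of_real (poly (X * p) t) / (complex_of_real t - z) =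
        z * (complex_of_real (poly p t) / (complex_of_real t - z)) + complex_of_real (poly p t)"
      using AE_unit
    proof eventually_elim
      case (elim t)
      then have "complex_of_real t - z \<noteq> 0" using assms by (auto simp: unit_segment_def)
      then show ?case by (simp add: field_simps)
    qed
    show "(\<lambda>t. complex_of_real (poly (X * p) t) / (complex_of_real t - z)) \<in> borel_measurable \<sigma>"
      by (intro borel_measurableI_sigma cauchy_integrand_borel)
    have "(\<lambda>t. complex_of_real (poly p t)) \<in> borel_measurable borel" using poly_borel[of p] by measurable
    then show "(\<lambda>t. z * (complex_of_real (poly p t) / (complex_of_real t - z)) + complex_of_real (poly p t)) \<in> borel_measurable \<sigma>"
      by (intro borel_measurableI_sigma borel_measurable_add borel_measurable_times borel_measurable_const cauchy_integrand_borel)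
  qed
  also have "\<dots> = z * E p z + of_real (I p)"
    by (subst Bochner_Integration.integral_add;
        (intro integrable_mult_right integrable_cauchy assms integrable_of_real integrable_poly)?)
       (simp only: integral_mult_right_zero E_def of_real_I)
  finally show ?thesis .
qed

lemma E_1: "E 1 z = stieltjes \<sigma> z"
  by (simp add: E_def stieltjes_def)

text \<open>By \<open>E_X\<close> both sides satisfy the same recurrence.\<close>

lemma E_P: assumes z: "z \<notin> unit_segment"
  shows "E (P n) z = poly (cpoly (P n)) z * stieltjes \<sigma> z + poly (cpoly (Q n)) z"
proof (induction n rule: Q.induct)
  case 1
  show ?case by (simp add: E_1)
next
  case 2
  have "P (Suc 0) = X * 1 - Polynomial.smult (b 0) 1" by (simp add: P_1)
  then have "E (P (Suc 0)) z = z * E 1 z + of_real (I 1) - of_real (b 0) * E 1 z"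
    by (simp only: E_diff[OF z] E_smult E_X[OF z])
  then show ?case by (simp add: E_1 P_1 N_0 algebra_simps)
next
  case (3 n)
  have "P (Suc (Suc n)) = X * P (Suc n) - Polynomial.smult (b (Suc n)) (P (Suc n)) - Polynomial.smult (c n) (P n)"
    by (simp add: P_rec)
  then have "E (P (Suc (Suc n))) z = z * E (P (Suc n)) z - b (Suc n) * E (P (Suc n)) z - c n * E (P n) z"
    by (simp only: E_diff[OF z] E_smult E_X[OF z] I_P_Suc) simp
  then show ?case by (simp add: 3 P_rec cpoly_diff cpoly_mult cpoly_add cpoly_smult algebra_simps)
qed

lemma E_cnj: "E p (cnj z) = cnj (E p z)"
  unfolding E_def by (subst Bochner_Integration.integral_cnj[symmetric]) simp

text \<open>The Cauchy-Schwarz inequality bounds the integral of \<open>\<bar>P n\<bar>\<close> by \<open>sqrt (N 0 * N n)\<close>.\<close>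

lemma norm_E_P_le:
  assumes "d > 0" "\<And>t. t \<in> {-1..1} \<Longrightarrow> d \<le> cmod (of_real t - z)"
  shows "cmod (E (P n) z) \<le> sqrt (N 0 * N n) / d"
proof -
  have *: "cmod (E (P n) z) \<le> (\<integral>t. \<bar>poly (P n) t\<bar> \<partial>\<sigma>) / d"
  proof -
    have zs: "z \<notin> unit_segment" using assms by (force simp: unit_segment_def)
    have "cmod (E (P n) z) \<le> (\<integral>t. cmod (complex_of_real (poly (P n) t) / (complex_of_real t - z)) \<partial>\<sigma>)"
      unfolding E_def by (rule integral_norm_bound)
    also have "\<dots> \<le> (\<integral>t. \<bar>poly (P n) t\<bar> / d \<partial>\<sigma>)"
    proof (rule integral_mono_AE)
      show "AE t in \<sigma>. cmod (complex_of_real (poly (P n) t) / (complex_of_real t - z)) \<le> \<bar>poly (P n) t\<bar> / d"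
        using AE_unit by eventually_elim (use assms in \<open>auto simp: norm_divide intro!: frac_le\<close>)
    qed (auto intro!: integrable_norm integrable_cauchy zs integrable_abs integrable_poly)
    finally show ?thesis by simp
  qed
  have "((\<integral>t. \<bar>poly (P n) t\<bar> \<partial>\<sigma>))\<^sup>2 \<le> N 0 * N n"
  proof -
    define A where "A = (\<integral>t. \<bar>poly (P n) t\<bar> \<partial>\<sigma>)"
    define s where "s = A / N 0"
    \<comment> \<open>Here \<open>s\<close> is the mean of \<open>\<bar>P n\<bar>\<close>, the best constant approximation of it.\<close>
    have "0 \<le> (\<integral>t. (\<bar>poly (P n) t\<bar> - s)\<^sup>2 \<partial>\<sigma>)" by (intro Bochner_Integration.integral_nonneg) auto
    also have "\<dots> = (\<integral>t. poly (P n * P n) t - 2 * s * \<bar>poly (P n) t\<bar> + s\<^sup>2 * poly 1 t \<partial>\<sigma>)"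
      by (intro Bochner_Integration.integral_cong) (auto simp: power2_eq_square algebra_simps)
    also have "\<dots> = N n - 2 * s * A + s\<^sup>2 * N 0"
      unfolding N_def A_def I_def 
      by (subst Bochner_Integration.integral_add Bochner_Integration.integral_diff;
          (intro Bochner_Integration.integrable_diff integrable_mult_right integrable_abs integrable_poly)?)+
         (simp del: poly_1)
    also have "\<dots> = N n - A\<^sup>2 / N 0" by (simp add: s_def field_simps power2_eq_square)
    finally show ?thesis unfolding A_def[symmetric] by (simp add: field_simps)
  qed
  then have "(\<integral>t. \<bar>poly (P n) t\<bar> \<partial>\<sigma>) \<le> sqrt (N 0 * N n)" by (rule real_le_rsqrt)
  with * show ?thesis using assms(1) by (meson divide_right_mono less_imp_le order_trans)
qed

end

section \<open>The Geronimus functional and its normal indices\<close>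

lemma real_poly_eqI: "(\<And>x. poly p x = poly q x) \<Longrightarrow> p = (q :: real poly)"
  by (simp add: poly_eq_poly_eq_iff[symmetric] fun_eq_iff)

locale geronimus_functional = unit_interval_measure +
  fixes s :: real
begin

text \<open>The Geronimus transform of \<open>\<sigma>\<close>: division by the variable, and a free choice of the moment of
  order 0.\<close>

definition S :: "real poly \<Rightarrow> real" where "S p = s * poly p 0 + div_diff_int p 0"

lemma S_add: "S (p + q) = S p + S q" by (simp add: S_def div_diff_int_add algebra_simps)
lemma S_smult: "S (Polynomial.smult a p) = a * S p" by (simp add: S_def div_diff_int_smult algebra_simps)
lemma S_X: "S (X * p) = I p" by (simp add: S_def div_diff_int_X del: mult_pCons_left)
lemma S_1: "S 1 = s" by (simp add: S_def div_diff_int_def one_pCons synthetic_div_pCons)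
lemma S_0: "S 0 = 0" using S_smult[of 0 0] by simp
lemma S_sum: "S (sum f A) = (\<Sum>x\<in>A. S (f x))"
  by (induction A rule: infinite_finite_induct) (simp_all add: S_0 S_add)

lemma frak_s_eq: "frak_s \<sigma> s j = S (Polynomial.monom 1 j)"
proof (cases j)
  case 0
  then show ?thesis by (simp add: frak_s_def S_1)
next
  case (Suc i)
  have "Polynomial.monom 1 (Suc i) = X * Polynomial.monom (1::real) i" by (simp add: monom_Suc)
  then show ?thesis using Suc by (simp only: S_X) (simp add: frak_s_def moment_def I_def poly_monom)
qed

text \<open>Orthogonality of \<open>P n\<close> with respect to \<open>\<sigma>\<close> is orthogonality to \<open>X, ..., X ^ n\<close> with respect to
  \<open>S\<close>; \<open>h n\<close> measures the failure at the constant polynomials.\<close>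

definition h :: "nat \<Rightarrow> real" where "h n = S (P n)"

lemma P_hat_eq: "P_hat \<sigma> s n x = poly (Q n) x + s * poly (P n) x"
  by (simp add: P_hat_def second_kind_eq)

lemma h_eq: "h n = poly (Q n) 0 + s * poly (P n) 0"
  using second_kind_eq[of n 0] by (simp add: h_def S_def div_diff_int_def second_kind_def)

lemma h_P_hat: "P_hat \<sigma> s n 0 = h n"
  by (simp add: P_hat_eq h_eq)

lemma h_0: "h 0 = s" by (simp add: h_eq)
lemma h_1: "h (Suc 0) = N 0 - b 0 * s" by (simp add: h_eq P_1)
lemma h_rec: "h (Suc (Suc n)) = - b (Suc n) * h (Suc n) - c n * h n"
  by (simp add: h_eq P_rec algebra_simps)

lemma h_wronskian: "poly (P n) 0 * h (Suc n) - poly (P (Suc n)) 0 * h n = N n"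
proof -
  have "poly (P n) 0 * h (Suc n) - poly (P (Suc n)) 0 * h n
      = poly (P n * Q (Suc n) - P (Suc n) * Q n) 0" by (simp add: h_eq algebra_simps)
  then show ?thesis by (simp add: wronskian)
qed

lemma h_not_both_zero: "h n = 0 \<Longrightarrow> h (Suc n) \<noteq> 0"
  using h_wronskian[of n] by auto

lemma hankel_mult_vec:
  assumes "v \<in> carrier_vec n" "i < n"
  shows "(Matrix.mat n n (\<lambda>(i, k). frak_s \<sigma> s (i + k)) *\<^sub>v v) $ i
    = S (Polynomial.monom 1 i * (\<Sum>k<n. Polynomial.monom (v $ k) k))"
proof -
  have "(Matrix.mat n n (\<lambda>(i, k). frak_s \<sigma> s (i + k)) *\<^sub>v v) $ i
     = (\<Sum>k<n. frak_s \<sigma> s (i + k) * v $ k)"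
    using assms by (simp add: scalar_prod_def atLeast0LessThan)
  also have "\<dots> = (\<Sum>k<n. S (Polynomial.monom 1 i * Polynomial.monom (v $ k) k))"
  proof (rule sum.cong)
    fix k
    have "Polynomial.monom 1 i * Polynomial.monom (v $ k) k = Polynomial.smult (v $ k) (Polynomial.monom 1 (i + k))"
      by (simp add: mult_monom smult_monom)
    then show "frak_s \<sigma> s (i + k) * v $ k = S (Polynomial.monom 1 i * Polynomial.monom (v $ k) k)"
      by (simp add: S_smult frak_s_eq)
  qed simp
  finally show ?thesis by (simp add: sum_distrib_left S_sum)
qed

text \<open>A vector in the kernel of the Hankel matrix consists of the coefficients of a polynomial \<open>f\<close> of
  degree at most \<open>n\<close> with \<open>S (X ^ i * f) = 0\<close> for \<open>i \<le> n\<close>. The equations with \<open>i \<ge> 1\<close> concern \<open>\<sigma>\<close> only and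
  make \<open>f\<close> a multiple of \<open>P n\<close>; the equation with \<open>i = 0\<close> is then \<open>h n = 0\<close>.\<close>

lemma hankel_det_zero_iff:
  "Determinant.det (Matrix.mat (Suc n) (Suc n) (\<lambda>(i, k). frak_s \<sigma> s (i + k))) = 0 \<longleftrightarrow> h n = 0"
  (is "Determinant.det ?H = 0 \<longleftrightarrow> _")
proof -
  have H: "?H \<in> carrier_mat (Suc n) (Suc n)" by simp
  have eqs: "?H *\<^sub>v v = 0\<^sub>v (Suc n) \<longleftrightarrow> S f = 0 \<and> (\<forall>i<n. I (Polynomial.monom 1 i * f) = 0)"
    if v: "v \<in> carrier_vec (Suc n)" and f: "f = (\<Sum>k<Suc n. Polynomial.monom (v $ k) k)" for v :: "real Matrix.vec" and f
  proof -
    have "?H *\<^sub>v v = 0\<^sub>v (Suc n) \<longleftrightarrow> (\<forall>i<Suc n. (?H *\<^sub>v v) $ i = 0)"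
      using v by (auto simp: vec_eq_iff)
    also have "\<dots> \<longleftrightarrow> (\<forall>i<Suc n. S (Polynomial.monom 1 i * f) = 0)"
      using hankel_mult_vec[OF v] f by auto
    also have "\<dots> \<longleftrightarrow> S f = 0 \<and> (\<forall>i<n. S (Polynomial.monom 1 (Suc i) * f) = 0)"
      unfolding All_less_Suc2 by simp
    also have "(\<lambda>i. S (Polynomial.monom 1 (Suc i) * f)) = (\<lambda>i. I (Polynomial.monom 1 i * f))"
      unfolding S_X[symmetric] by (simp add: monom_Suc)
    finally show ?thesis by meson
  qed
  show ?thesis
  proof
    assume "Determinant.det ?H = 0"
    then obtain v where v: "v \<in> carrier_vec (Suc n)" "v \<noteq> 0\<^sub>v (Suc n)" "?H *\<^sub>v v = 0\<^sub>v (Suc n)"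
      using det_0_iff_vec_prod_zero[OF H] by blast
    define f where "f = (\<Sum>k<Suc n. Polynomial.monom (v $ k) k)"
    have cf: "Polynomial.coeff f k = (if k < Suc n then v $ k else 0)" for k
      unfolding f_def coeff_sum coeff_monom by (subst sum.delta) auto
    have "f \<noteq> 0"
    proof
      assume "f = 0"
      then have "v = 0\<^sub>v (Suc n)" using v(1) cf by (intro eq_vecI) (auto, metis coeff_0)
      then show False using v by simp
    qed
    have degf: "Polynomial.degree f \<le> n" by (rule degree_le) (simp add: cf)
    have Sf: "S f = 0" and If: "\<forall>i<n. I (Polynomial.monom 1 i * f) = 0"
      using eqs[OF v(1) f_def] v(3) by auto
    have If': "I (r * f) = 0" if r: "Polynomial.degree r < n \<or> r = 0" for r
    proof (cases "r = 0")
      case False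
      have "r = (\<Sum>i\<le>Polynomial.degree r. Polynomial.monom (Polynomial.coeff r i) i)"
        by (rule poly_as_sum_of_monoms[symmetric])
      also have "\<dots> * f = (\<Sum>i\<le>Polynomial.degree r. Polynomial.smult (Polynomial.coeff r i) (Polynomial.monom 1 i * f))"
        unfolding sum_distrib_right
        by (intro sum.cong refl) (metis mult_smult_left smult_monom mult.right_neutral)
      finally have "r * f = (\<Sum>i\<le>Polynomial.degree r. Polynomial.smult (Polynomial.coeff r i) (Polynomial.monom 1 i * f))" .
      moreover have "I (sum g A) = (\<Sum>x\<in>A. I (g x))" for g and A :: "nat set"
        by (induction A rule: infinite_finite_induct) (simp_all add: I_lin)
      ultimately show ?thesis using If r False by (auto simp: I_lin intro!: sum.neutral)
    qed (simp add: I_0)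
    define a where "a = Polynomial.coeff f n"
    define r where "r = f - Polynomial.smult a (P n)"
    have r: "Polynomial.degree r < n \<or> r = 0"
      unfolding r_def a_def by (rule monic_orth_diff[OF monic_orth_P degf refl])
    have "r * r = r * f - Polynomial.smult a (P n * r)"
      by (rule real_poly_eqI) (simp add: r_def algebra_simps)
    then have "I (r * r) = 0" using If'[OF r] monic_orth_zero[OF monic_orth_P r] by (simp add: I_lin)
    then have "r = 0" using I_square_pos[of r] by force
    then have fa: "f = Polynomial.smult a (P n)" by (simp add: r_def)
    with \<open>f \<noteq> 0\<close> have "a \<noteq> 0" by auto
    with Sf fa show "h n = 0" by (simp add: S_smult h_def)
  next
    assume h: "h n = 0"
    define v where "v = Matrix.vec (Suc n) (\<lambda>k. Polynomial.coeff (P n) k)"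
    have v: "v \<in> carrier_vec (Suc n)" by (simp add: v_def)
    have "v $ n = 1" by (simp add: v_def)
    then have "v \<noteq> 0\<^sub>v (Suc n)" by auto
    moreover have Pn: "P n = (\<Sum>k<Suc n. Polynomial.monom (v $ k) k)"
      using poly_as_sum_of_monoms[of "P n"] by (simp add: v_def lessThan_Suc_atMost)
    have "S (P n) = 0 \<and> (\<forall>i<n. I (Polynomial.monom 1 i * P n) = 0)"
      using h by (auto simp: h_def mult.commute[of _ "P n"] degree_monom_eq intro!: P_orth)
    then have "?H *\<^sub>v v = 0\<^sub>v (Suc n)" using eqs[OF v Pn] by blast
    ultimately show "Determinant.det ?H = 0" using v det_0_iff_vec_prod_zero[OF H] by blast
  qed
qed

abbreviation nn :: "nat \<Rightarrow> nat" where "nn \<equiv> normal_index (frak_s \<sigma> s)"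

lemma normal_indices_eq: "normal_indices (frak_s \<sigma> s) = {m. m \<ge> 1 \<and> h (m - 1) \<noteq> 0}"
  unfolding normal_indices_def
proof (intro Collect_cong conj_cong refl)
  fix m :: nat assume "m \<ge> 1"
  then show "(Determinant.det (Matrix.mat m m (\<lambda>(i, k). frak_s \<sigma> s (i + k))) \<noteq> 0) = (h (m - 1) \<noteq> 0)"
    using hankel_det_zero_iff[of "m - 1"] by simp
qed

lemma nn_0 [simp]: "nn 0 = 0" by (simp add: normal_index_def)

text \<open>A zero of \<open>h\<close> is isolated, so that at most one number is skipped.\<close>

lemma nn_Suc: "nn (Suc j) = (if h (nn j) = 0 then Suc (Suc (nn j)) else Suc (nn j))"
proof -
  let ?A = "normal_indices (frak_s \<sigma> s)"
  have "\<exists>k>m. k \<in> ?A" for m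
    unfolding normal_indices_eq using h_not_both_zero[of m]
    by (cases "h m = 0") (auto intro: exI[of _ "Suc m"] exI[of _ "Suc (Suc m)"])
  then have inf: "infinite ?A" unfolding infinite_nat_iff_unbounded by blast
  have "nn (Suc j) = (LEAST m. m \<in> ?A \<and> nn j < m)"
  proof (cases j)
    case 0
    then show ?thesis
      by (auto intro!: arg_cong[where f = Least] simp: normal_index_def enumerate_0 normal_indices_eq)
  next
    case (Suc i)
    then show ?thesis unfolding normal_index_def using enumerate_Suc''[OF inf] by simp
  qed
  also have "\<dots> = (if h (nn j) = 0 then Suc (Suc (nn j)) else Suc (nn j))"
  proof (rule Least_equality)
    show "(if h (nn j) = 0 then Suc (Suc (nn j)) else Suc (nn j)) \<in> ?A \<and>
        nn j < (if h (nn j) = 0 then Suc (Suc (nn j)) else Suc (nn j))"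
      using h_not_both_zero by (auto simp: normal_indices_eq)
    fix y assume y: "y \<in> ?A \<and> nn j < y"
    show "(if h (nn j) = 0 then Suc (Suc (nn j)) else Suc (nn j)) \<le> y"
    proof (cases "h (nn j) = 0")
      case True
      then have "y \<noteq> Suc (nn j)" using y by (auto simp: normal_indices_eq)
      then show ?thesis using y True by auto
    qed (use y in auto)
  qed
  finally show ?thesis .
qed

lemma h_nn: "h (nn (Suc j) - 1) \<noteq> 0"
  using h_not_both_zero[of "nn j"] by (auto simp: nn_Suc)

lemma nn_Suc_pos: "nn (Suc j) > 0" by (simp add: nn_Suc)

lemma nn_strict_mono: "strict_mono nn"
  by (rule strict_mono_Suc_iff[THEN iffD2]) (simp add: nn_Suc)

lemma block_size_nn: "block_size nn j = (if h (nn j) = 0 then 2 else 1)"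
  by (simp add: block_size_def nn_Suc)

subsection \<open>An interlaced recurrence\<close>

definition \<alpha> :: "nat \<Rightarrow> real" where "\<alpha> n = - h n / h (n - 1)"

text \<open>The orthogonal polynomials of \<open>S\<close> at the normal indices: \<open>\<alpha>\<close> makes \<open>S\<close> annihilate the
  combination (see \<open>S_V\<close>). In front of a block of size 2 the correction \<open>\<alpha> (nn j)\<close> is 0.\<close>

definition V :: "nat \<Rightarrow> real poly" where
  "V j = (if j = 0 then 1 else P (nn j) + Polynomial.smult (\<alpha> (nn j)) (P (nn j - 1)))"
text \<open>The last of the polynomials \<open>P\<close> before the block \<open>j\<close>. The value 0 for \<open>j = 0\<close> stands for \<open>P\<close> at
  the index \<open>-1\<close>.\<close>

definition W :: "nat \<Rightarrow> real poly" where
  "W j = (if j = 0 then 0 else P (nn j - 1))"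
definition q :: "nat \<Rightarrow> real poly" where
  "q j = (if h (nn j) = 0 then [:- b (nn j), 1:] else 1)"
text \<open>The entries \<open>l\<close> of the lower block factor. The value 0 at \<open>j = 0\<close> makes the recurrences
  below hold from the start.\<close>

definition l :: "nat \<Rightarrow> real" where
  "l j = (if j = 0 then 0 else - h (nn (Suc j) - 1) / h (nn j - 1))"
definition u :: "nat \<Rightarrow> real" where
  "u j = - poly (V (Suc j)) 0 / poly (V j) 0"

lemma V_at_0: "poly (V (Suc j)) 0 = - N (nn (Suc j) - 1) / h (nn (Suc j) - 1)"
proof -
  define m where "m = nn (Suc j) - 1"
  have m: "nn (Suc j) = Suc m" using nn_Suc_pos[of j] by (simp add: m_def)
  have "h m \<noteq> 0" using h_nn[of j] m by simp
  then show ?thesis using h_wronskian[of m] by (simp add: V_def m \<alpha>_def field_simps)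
qed

lemma V_at_0_nonzero: "poly (V j) 0 \<noteq> 0"
proof (cases j)
  case (Suc i)
  then show ?thesis using h_nn[of i] by (simp only: V_at_0) simp
qed (simp add: V_def)

lemma u_nonzero: "u j \<noteq> 0" by (simp add: u_def V_at_0_nonzero)

lemma S_V: "S (V (Suc j)) = 0"
proof -
  have "S (V (Suc j)) = h (nn (Suc j)) + \<alpha> (nn (Suc j)) * h (nn (Suc j) - 1)"
    by (simp add: V_def S_add S_smult h_def)
  also have "\<dots> = 0" using h_nn[of j] by (simp add: \<alpha>_def)
  finally show ?thesis .
qed

lemma nn_Suc_eq_Suc: "\<exists>m. nn (Suc j) = Suc m \<and> h m \<noteq> 0"
  using h_nn[of j] nn_Suc_pos[of j] by (metis Suc_pred' One_nat_def)

text \<open>This is the last row of the block \<open>j\<close> in the identity that \<open>L\<close> maps the sequence of the \<open>P\<close> to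
  the sequence of the \<open>V\<close>, with \<open>X * V\<close> as second entry of a block of size 2.\<close>

lemma W_Suc: "W (Suc j) = q j * V j - Polynomial.smult (l j) (W j)"
proof (cases j)
  case 0
  then show ?thesis by (auto simp: W_def q_def V_def l_def nn_Suc P_1)
next
  case (Suc i)
  then obtain m where m: "nn j = Suc m" "h m \<noteq> 0" and j: "j \<noteq> 0" using nn_Suc_eq_Suc by blast
  show ?thesis
  proof (cases "h (Suc m) = 0")
    case True
    then have "h (Suc (Suc m)) = - c m * h m" by (simp add: h_rec)
    then show ?thesis using True m j by (simp add: W_def q_def V_def l_def nn_Suc P_rec \<alpha>_def)
  next
    case False
    then show ?thesis using m j by (simp add: W_def q_def V_def l_def nn_Suc \<alpha>_def flip: smult_add_left)
  qed
qed

text \<open>The corresponding row of \<open>U\<close>. After the recurrence of \<open>P\<close> is inserted, the relation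
  between three consecutive values of \<open>h\<close> makes what remains proportional to \<open>V j\<close>.\<close>

lemma ex_X_W_Suc: "\<exists>a. X * W (Suc j) = Polynomial.smult a (V j) + V (Suc j)"
proof -
  obtain m where m: "nn (Suc j) = Suc m" "h m \<noteq> 0" using nn_Suc_eq_Suc by blast
  have Vs: "V (Suc j) = P (Suc m) - Polynomial.smult (h (Suc m) / h m) (P m)" using m by (simp add: V_def \<alpha>_def)
  have Ws: "W (Suc j) = P m" using m by (simp add: W_def)
  consider (zero) "m = 0" | (two) i where "m = Suc i" "nn j = i" "h i = 0" | (one) i where "m = Suc i" "nn j = m"
    using m(1) by (cases m) (auto simp: nn_Suc split: if_splits)
  then show ?thesis
  proof cases
    case zero
    then have "nn j = 0" using m by (auto simp: nn_Suc split: if_splits)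
    then have "j = 0" using nn_Suc_pos by (metis gr0_implies_Suc not_gr_zero nat_less_le)
    then show ?thesis using zero unfolding Vs Ws
      by (intro exI[of _ "b 0 + h (Suc m) / h m"]) (simp add: V_def P_1)
  next
    case (two i)
    have Vj: "V j = P i" using two nn_strict_mono by (auto simp: V_def \<alpha>_def)
    have "h (Suc m) = - b m * h m" using two by (simp add: h_rec)
    then have "h (Suc m) / h m = - b m" using m by simp
    then show ?thesis unfolding Vs Ws Vj
      by (intro exI[of _ "c i"]) (simp add: two P_rec)
  next
    case (one i)
    then have "j \<noteq> 0" by (metis nat.distinct(1) nn_0)
    then have Vj: "V j = P m + Polynomial.smult (- h m / h i) (P i)" using one by (simp add: V_def \<alpha>_def)
    have hi: "h i \<noteq> 0" using \<open>j \<noteq> 0\<close> h_nn[of "j - 1"] one by simp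
    have e: "h (Suc m) / h m = - b m - c i * h i / h m" using one m by (simp add: h_rec field_simps)
    have "X * P m = P (Suc m) + Polynomial.smult (b m) (P m) + Polynomial.smult (c i) (P i)"
      using one by (simp add: P_rec)
    then show ?thesis unfolding Vs Ws Vj e using hi m
      by (intro exI[of _ "- c i * h i / h m"] real_poly_eqI) (simp add: field_simps)
  qed
qed

text \<open>Evaluation at 0 shows which multiple it is.\<close>

lemma X_W_Suc: "X * W (Suc j) = Polynomial.smult (u j) (V j) + V (Suc j)"
proof -
  obtain a where a: "X * W (Suc j) = Polynomial.smult a (V j) + V (Suc j)" using ex_X_W_Suc by blast
  have "poly (X * W (Suc j)) 0 = 0" by simp
  then have "a * poly (V j) 0 + poly (V (Suc j)) 0 = 0" unfolding a by simp
  then have "a = u j" using V_at_0_nonzero[of j] unfolding u_def by (simp add: field_simps eq_neg_iff_add_eq_0)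
  with a show ?thesis by simp
qed

text \<open>The coefficients of the recurrence that remains when \<open>W\<close> is eliminated.\<close>

definition pp :: "nat \<Rightarrow> real poly" where "pp j = X * q j - [:u j + l j:]"
definition cc :: "nat \<Rightarrow> real" where "cc j = l (Suc j) * u j"

lemma V_Suc: "V (Suc j) = (X * q j - [:u j:]) * V j - Polynomial.smult (l j) (X * W j)"
proof -
  have V: "V (Suc j) = X * (q j * V j - Polynomial.smult (l j) (W j)) - Polynomial.smult (u j) (V j)"
    unfolding W_Suc[symmetric] X_W_Suc by simp
  show ?thesis unfolding V by (intro real_poly_eqI) (simp add: algebra_simps)
qed

lemma V_1: "V (Suc 0) = pp 0" using V_Suc[of 0] by (simp add: W_def V_def[of 0] pp_def l_def)

lemma V_rec: "V (Suc (Suc j)) = pp (Suc j) * V (Suc j) - Polynomial.smult (cc j) (V j)"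
  by (rule real_poly_eqI, subst V_Suc, subst X_W_Suc) (simp add: cc_def pp_def algebra_simps)

lemma l_Suc_nonzero: "l (Suc j) \<noteq> 0" using h_nn[of j] h_nn[of "Suc j"] by (simp add: l_def)
lemma cc_nonzero: "cc j \<noteq> 0" by (simp add: cc_def l_Suc_nonzero u_nonzero)

lemma degree_pp: "Polynomial.degree (pp j) = block_size nn j"
  and lead_pp: "lead_coeff (pp j) = 1"
  by (auto simp: pp_def q_def block_size_nn)

lemma pp_coeff_1: "block_size nn j = 2 \<Longrightarrow> Polynomial.coeff (pp j) 1 = - b (nn j)"
  by (auto simp: pp_def q_def block_size_nn split: if_splits)

end

section \<open>Asymptotic expansions at infinity\<close>

text \<open>Expansions in a full neighbourhood of infinity. They imply the expansions in all sectors, and the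
  functions met below are holomorphic at infinity.\<close>

definition real_expandable :: "(complex \<Rightarrow> complex) \<Rightarrow> bool" where
  "real_expandable G \<longleftrightarrow> (\<exists>s. \<forall>n. ((\<lambda>z. z ^ (n + 1) *
     (G z + (\<Sum>j\<le>n. complex_of_real (s j) / z ^ (j + 1)))) \<longlongrightarrow> 0) at_infinity)"

lemma sector_le_at_infinity: "sector_at_infinity \<delta> \<le> at_infinity"
  by (simp add: sector_at_infinity_def)

lemma tendsto_sector: "(f \<longlongrightarrow> l) at_infinity \<Longrightarrow> (f \<longlongrightarrow> l) (sector_at_infinity \<delta>)"
  using sector_le_at_infinity by (rule tendsto_mono)

lemma eventually_sector: "eventually Q at_infinity \<Longrightarrow> eventually Q (sector_at_infinity \<delta>)"
  using sector_le_at_infinity by (rule filter_leD)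

lemma sector_not_bot: "sector_at_infinity 1 \<noteq> bot"
proof
  assume "sector_at_infinity 1 = bot"
  then have "eventually (\<lambda>z. z \<in> {z. 1 < Arg z \<and> Arg z < pi - 1} \<longrightarrow> False) at_infinity"
    unfolding sector_at_infinity_def trivial_limit_def eventually_inf_principal by simp
  then obtain B where B: "\<And>z. cmod z \<ge> B \<Longrightarrow> \<not> (1 < Arg z \<and> Arg z < pi - 1)"
    unfolding eventually_at_infinity by auto
  define r where "r = max B 1"
  have "r > 0" by (simp add: r_def)
  then have "Arg (of_real r * \<i>) = pi / 2" by (subst Arg_times_of_real) simp_all
  moreover have "cmod (of_real r * \<i>) \<ge> B" using \<open>r > 0\<close> by (simp add: norm_mult r_def)
  ultimately show False using B[of "of_real r * \<i>"] pi_gt3 by simp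
qed

lemma asym_expansion_unique:
  assumes "asym_expansion G s" "asym_expansion G s'"
  shows "s = s'"
proof
  fix n
  show "s n = s' n"
  proof (induction n rule: less_induct)
    case (less n)
    let ?f = "\<lambda>s z. z ^ (n + 1) * (G z + (\<Sum>j\<le>n. complex_of_real (s j) / z ^ (j + 1)))"
    have "((\<lambda>z. ?f s z - ?f s' z) \<longlongrightarrow> 0 - 0) (sector_at_infinity 1)"
      using assms unfolding asym_expansion_def by (intro tendsto_diff) auto
    moreover have "eventually (\<lambda>z. ?f s z - ?f s' z = of_real (s n) - of_real (s' n)) (sector_at_infinity 1)"
      using eventually_sector[OF eventually_not_equal_at_infinity[of 0]]
    proof eventually_elim
      case (elim z)
      have "(\<Sum>j<n. complex_of_real (s j) / z ^ (j + 1)) = (\<Sum>j<n. complex_of_real (s' j) / z ^ (j + 1))"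
        using less by simp
      then show ?case using elim by (simp add: lessThan_Suc_atMost[symmetric] field_simps)
    qed
    ultimately have "((\<lambda>z. complex_of_real (s n) - of_real (s' n)) \<longlongrightarrow> 0) (sector_at_infinity 1)"
      by (simp add: filterlim_cong)
    then have "complex_of_real (s n) - of_real (s' n) = 0"
      using sector_not_bot tendsto_const_iff by blast
    then show ?case by simp
  qed
qed

lemma real_expandable_cong:
  assumes "eventually (\<lambda>z. G z = H z) at_infinity" "real_expandable G"
  shows "real_expandable H"
proof -
  obtain s where s: "\<And>n. ((\<lambda>z. z ^ (n + 1) * (G z + (\<Sum>j\<le>n. complex_of_real (s j) / z ^ (j + 1)))) \<longlongrightarrow> 0) at_infinity"
    using assms(2) unfolding real_expandable_def by blast
  have "((\<lambda>z. z ^ (n + 1) * (H z + (\<Sum>j\<le>n. complex_of_real (s j) / z ^ (j + 1)))) \<longlongrightarrow> 0) at_infinity" for n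
    by (rule Lim_transform_eventually[OF s[of n]]) (use assms(1) in eventually_elim, simp)
  then show ?thesis unfolding real_expandable_def by blast
qed

lemma real_expandable_scale:
  assumes "real_expandable G"
  shows "real_expandable (\<lambda>z. complex_of_real a * G z)"
proof -
  obtain s where s: "\<And>n. ((\<lambda>z. z ^ (n + 1) * (G z + (\<Sum>j\<le>n. complex_of_real (s j) / z ^ (j + 1)))) \<longlongrightarrow> 0) at_infinity"
    using assms unfolding real_expandable_def by blast
  have "((\<lambda>z. z ^ (n + 1) * (of_real a * G z + (\<Sum>j\<le>n. complex_of_real (a * s j) / z ^ (j + 1)))) \<longlongrightarrow> 0) at_infinity" for n
  proof -
    have "(\<Sum>j\<le>n. complex_of_real (a * s j) / z ^ (j + 1)) = of_real a * (\<Sum>j\<le>n. complex_of_real (s j) / z ^ (j + 1))" for z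
      by (simp add: sum_distrib_left)
    then have "(\<lambda>z. z ^ (n + 1) * (of_real a * G z + (\<Sum>j\<le>n. complex_of_real (a * s j) / z ^ (j + 1))))
      = (\<lambda>z. of_real a * (z ^ (n + 1) * (G z + (\<Sum>j\<le>n. complex_of_real (s j) / z ^ (j + 1)))))"
      by (simp only: distrib_left[symmetric] mult.left_commute)
    then show ?thesis using tendsto_mult_left[OF s[of n], of "of_real a"] by simp
  qed
  then show ?thesis unfolding real_expandable_def by (intro exI[of _ "\<lambda>j. a * s j"]) blast
qed

text \<open>The coefficients before the first nonzero one are found to vanish one after the other.\<close>

lemma first_coeff_eqI:
  assumes "real_expandable G" and lim: "((\<lambda>z. z ^ k * G z) \<longlongrightarrow> - complex_of_real d) at_infinity"
    and "d \<noteq> 0" "k \<ge> 1"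
  shows "first_coeff G = d"
proof -
  obtain s where s: "\<And>n. ((\<lambda>z. z ^ (n + 1) * (G z + (\<Sum>j\<le>n. complex_of_real (s j) / z ^ (j + 1)))) \<longlongrightarrow> 0) at_infinity"
    using assms(1) unfolding real_expandable_def by blast
  then have "asym_expansion G s" unfolding asym_expansion_def by (blast intro: tendsto_sector)
  then have ac: "asym_coeffs G = s" unfolding asym_coeffs_def using asym_expansion_unique by blast
  have sj: "s j = (if j = k - 1 then d else 0)" if "j \<le> k - 1" for j
    using that
  proof (induction j rule: less_induct)
    case (less j)
    have "((\<lambda>z. z ^ (j + 1) * G z + of_real (s j)) \<longlongrightarrow> 0) at_infinity"
    proof (rule Lim_transform_eventually[OF s[of j]])
      show "\<forall>\<^sub>F z in at_infinity. z ^ (j + 1) * (G z + (\<Sum>i\<le>j. complex_of_real (s i) / z ^ (i + 1))) =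
          z ^ (j + 1) * G z + of_real (s j)"
        using eventually_not_equal_at_infinity[of 0]
      proof eventually_elim
        case (elim z)
        have "(\<Sum>i<j. complex_of_real (s i) / z ^ (i + 1)) = 0" using less by (intro sum.neutral) auto
        then show ?case using elim by (simp add: lessThan_Suc_atMost[symmetric] algebra_simps)
      qed
    qed
    from tendsto_diff[OF this tendsto_const[of "of_real (s j)"]]
    have 1: "((\<lambda>z. z ^ (j + 1) * G z) \<longlongrightarrow> - of_real (s j)) at_infinity" by simp
    define m where "m = k - 1 - j"
    have k: "k = (j + 1) + m" using less.prems \<open>k \<ge> 1\<close> by (simp add: m_def)
    have "((\<lambda>z. (z ^ k * G z) * (inverse z) ^ m) \<longlongrightarrow> - complex_of_real d * 0 ^ m) at_infinity"
      by (intro tendsto_intros lim tendsto_inverse_0)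
    then have 2: "((\<lambda>z. z ^ (j + 1) * G z) \<longlongrightarrow> - complex_of_real d * 0 ^ m) at_infinity"
    proof (rule Lim_transform_eventually)
      show "\<forall>\<^sub>F z in at_infinity. z ^ k * G z * inverse z ^ m = z ^ (j + 1) * G z"
        using eventually_not_equal_at_infinity[of 0]
        by eventually_elim (simp add: k power_add power_inverse field_simps)
    qed
    from tendsto_unique[OF trivial_limit_at_infinity 1 2] have "complex_of_real (s j) = of_real (d * 0 ^ m)" by simp
    then have "s j = d * 0 ^ m" by (simp only: of_real_eq_iff)
    then show ?case using less.prems by (auto simp: m_def power_0_left)
  qed
  have "(LEAST j. s j \<noteq> 0) = k - 1"
  proof (rule Least_equality)
    show "s (k - 1) \<noteq> 0" using sj[of "k - 1"] \<open>d \<noteq> 0\<close> by simp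
    show "k - 1 \<le> j" if "s j \<noteq> 0" for j using sj[of j] that by (cases "j \<le> k - 1") (auto split: if_splits)
  qed
  then show ?thesis unfolding first_coeff_def ac using sj[of "k - 1"] by simp
qed

definition vanishing_holomorphic :: "real \<Rightarrow> (complex \<Rightarrow> complex) \<Rightarrow> bool" where
  "vanishing_holomorphic R G \<longleftrightarrow> G holomorphic_on {z. R < cmod z} \<and> (G \<longlongrightarrow> 0) at_infinity \<and>
     (\<forall>z. R < cmod z \<longrightarrow> G (cnj z) = cnj (G z))"

text \<open>In the variable \<open>1 / z\<close> the singularity at 0 is removable, and the limit is the derivative there.\<close>

lemma vanishing_holomorphic_limit:
  assumes "G holomorphic_on {z. R < cmod z}" "(G \<longlongrightarrow> 0) at_infinity" "R > 0"
  shows "\<exists>L. ((\<lambda>z. z * G z) \<longlongrightarrow> L) at_infinity"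
proof -
  define f where "f w = (if w = 0 then 0 else G (inverse w))" for w
  have "f holomorphic_on ball 0 (1 / R)"
  proof (rule no_isolated_singularity'[where K = "{0}"])
    fix w :: complex assume "w \<in> {0}"
    have "((G \<circ> inverse) \<longlongrightarrow> 0) (at 0)" using assms(2) lim_at_infinity_0 by blast
    then have "(f \<longlongrightarrow> 0) (at 0)"
      by (rule Lim_transform_eventually) (auto simp: f_def eventually_at_filter)
    then show "(f \<longlongrightarrow> f w) (at w within ball 0 (1 / R))"
      using \<open>w \<in> {0}\<close> by (auto simp: f_def intro: tendsto_within_subset)
  next
    have "(G \<circ> inverse) holomorphic_on ball 0 (1 / R) - {0}"
    proof (rule holomorphic_on_compose_gen[OF _ assms(1)])
      show "inverse holomorphic_on ball 0 (1 / R) - {0 :: complex}" by (intro holomorphic_intros) auto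
      show "inverse ` (ball 0 (1 / R) - {0}) \<subseteq> {z. R < cmod z}"
        using \<open>R > 0\<close> by (auto simp: norm_inverse norm_divide field_simps)
    qed
    then show "f holomorphic_on ball 0 (1 / R) - {0}"
      by (rule holomorphic_transform) (auto simp: f_def)
  qed auto
  then obtain L where "(f has_field_derivative L) (at 0)"
    using \<open>R > 0\<close> holomorphic_on_imp_differentiable_at[of f "ball 0 (1/R)" 0] field_differentiable_def by auto
  then have "((\<lambda>w. f w / w) \<longlongrightarrow> L) (at 0)" unfolding has_field_derivative_iff by (simp add: f_def)
  then have "(((\<lambda>z. z * G z) \<circ> inverse) \<longlongrightarrow> L) (at 0)"
    by (rule Lim_transform_eventually) (auto simp: f_def eventually_at_filter field_simps)
  then show ?thesis using lim_at_infinity_0 by blast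
qed

lemma filterlim_cnj_at_infinity: "filterlim cnj at_infinity at_infinity"
  unfolding filterlim_at_infinity_conv_norm_at_top by (simp add: filterlim_norm_at_top)

text \<open>The symmetry under conjugation forces the limit of \<open>z * G z\<close> to be real.\<close>

lemma vanishing_holomorphic_step:
  assumes "vanishing_holomorphic R G" "R > 0"
  shows "\<exists>a. vanishing_holomorphic R (\<lambda>z. z * G z + complex_of_real a)"
proof -
  from assms obtain L where L: "((\<lambda>z. z * G z) \<longlongrightarrow> L) at_infinity"
    using vanishing_holomorphic_limit unfolding vanishing_holomorphic_def by blast
  have "((\<lambda>z. cnj (cnj z * G (cnj z))) \<longlongrightarrow> cnj L) at_infinity"
    using tendsto_cnj[OF filterlim_compose[OF L filterlim_cnj_at_infinity]] .
  then have "((\<lambda>z. z * G z) \<longlongrightarrow> cnj L) at_infinity"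
  proof (rule Lim_transform_eventually)
    have "\<forall>\<^sub>F z in at_infinity. R < cmod z"
      by (auto simp: eventually_at_infinity intro!: exI[of _ "R + 1"])
    then show "\<forall>\<^sub>F z in at_infinity. cnj (cnj z * G (cnj z)) = z * G z"
      by eventually_elim (use assms in \<open>simp add: vanishing_holomorphic_def\<close>)
  qed
  from tendsto_unique[OF trivial_limit_at_infinity L this] have "L = cnj L" .
  then have "L = of_real (Re L)" by (simp add: complex_eq_iff)
  then have "((\<lambda>z. z * G z + complex_of_real (- Re L)) \<longlongrightarrow> 0) at_infinity"
    using tendsto_add[OF L tendsto_const[of "complex_of_real (- Re L)"]] by simp
  then have "vanishing_holomorphic R (\<lambda>z. z * G z + complex_of_real (- Re L))"
    using assms unfolding vanishing_holomorphic_def by (auto intro!: holomorphic_intros)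
  then show ?thesis by blast
qed

text \<open>Iterating \<open>G z \<mapsto> z * G z + a\<close> reads off one coefficient at a time; the iterates are the
  remainders of the expansion, multiplied by the powers of \<open>z\<close>.\<close>

lemma vanishing_holomorphic_expandable:
  assumes "vanishing_holomorphic R G" "R > 0"
  shows "real_expandable G"
proof -
  obtain a where a: "\<And>G. vanishing_holomorphic R G \<Longrightarrow> vanishing_holomorphic R (\<lambda>z. z * G z + complex_of_real (a G))"
    using vanishing_holomorphic_step[OF _ \<open>R > 0\<close>] by metis
  define g where "g = rec_nat G (\<lambda>_ G z. z * G z + complex_of_real (a G))"
  have g0: "g 0 = G" and gS: "g (Suc n) = (\<lambda>z. z * g n z + complex_of_real (a (g n)))" for n
    by (simp_all add: g_def)
  have vh: "vanishing_holomorphic R (g n)" for n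
    by (induction n) (simp_all add: g0 gS assms a)
  have eq: "g (Suc n) z = z ^ (n + 1) * (G z + (\<Sum>j\<le>n. complex_of_real (a (g j)) / z ^ (j + 1)))"
    if "z \<noteq> 0" for n z
  proof (induction n)
    case 0
    then show ?case using that by (simp add: gS g0 field_simps)
  next
    case (Suc n)
    then show ?case using that by (subst gS) (simp add: field_simps)
  qed
  have "((\<lambda>z. z ^ (n + 1) * (G z + (\<Sum>j\<le>n. complex_of_real (a (g j)) / z ^ (j + 1)))) \<longlongrightarrow> 0) at_infinity" for n
  proof (rule Lim_transform_eventually)
    show "(g (Suc n) \<longlongrightarrow> 0) at_infinity" using vh[of "Suc n"] by (simp add: vanishing_holomorphic_def)
    show "\<forall>\<^sub>F z in at_infinity. g (Suc n) z = z ^ (n + 1) * (G z + (\<Sum>j\<le>n. complex_of_real (a (g j)) / z ^ (j + 1)))"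
      using eventually_not_equal_at_infinity[of 0] by eventually_elim (rule eq)
  qed
  then show ?thesis unfolding real_expandable_def by (intro exI[of _ "\<lambda>j. a (g j)"]) blast
qed

text \<open>Divided by \<open>z\<close> to the power of its degree, the polynomial tends both to 0 and to its leading
  coefficient.\<close>

lemma poly_tendsto_0_sector:
  fixes p :: "complex poly"
  assumes "(poly p \<longlongrightarrow> 0) (sector_at_infinity 1)"
  shows "p = 0"
proof -
  let ?n = "Polynomial.degree p"
  have "((\<lambda>z. poly p z * inverse z ^ ?n) \<longlongrightarrow> 0 * 0 ^ ?n) (sector_at_infinity 1)"
    by (intro tendsto_intros assms tendsto_sector[OF tendsto_inverse_0])
  moreover have "((\<lambda>z. poly p z * inverse z ^ ?n) \<longlongrightarrow> lead_coeff p) (sector_at_infinity 1)"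
    using tendsto_sector[OF poly_divide_tendsto_aux[of p]] by (simp add: divide_inverse power_inverse)
  ultimately have "lead_coeff p = 0" using tendsto_unique[OF sector_not_bot] by force
  then show ?thesis by simp
qed

section \<open>Uniqueness of the continued fraction\<close>

text \<open>The recursion \<^const>\<open>cf\<close> without normalization. Both recursions are determined by their first term;
  the locale shows that they produce the same polynomials, and that \<^const>\<open>gj_c\<close> is the sequence of
  the partial numerators \<open>d\<close>.\<close>

locale continued_fraction =
  fixes G :: "nat \<Rightarrow> complex \<Rightarrow> complex" and p :: "nat \<Rightarrow> real poly" and d :: "nat \<Rightarrow> real"
  assumes expandable: "real_expandable (G j)"
    and vanishing: "(G j \<longlongrightarrow> 0) at_infinity"
    and reciprocal: "\<forall>\<^sub>F z in at_infinity. - 1 / G j z = (poly (cpoly (p j)) z + G (Suc j) z) / of_real (d j)"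
    and monic: "lead_coeff (p j) = 1"
    and degree_pos: "Polynomial.degree (p j) \<ge> 1"
    and d_nonzero: "d j \<noteq> 0"
begin

text \<open>Hence \<open>d j\<close> is the first nonzero coefficient of \<open>G j\<close>.\<close>

lemma scaled_limit: "((\<lambda>z. z ^ Polynomial.degree (p j) * G j z) \<longlongrightarrow> - of_real (d j)) at_infinity"
proof -
  let ?k = "Polynomial.degree (p j)"
  have lc: "lead_coeff (cpoly (p j)) = 1" using monic[of j] by (simp add: coeff_map_poly)
  have "((\<lambda>z. poly (cpoly (p j)) z / z ^ ?k + G (Suc j) z * inverse z ^ ?k) \<longlongrightarrow> 1 + 0 * 0 ^ ?k) at_infinity"
    using poly_divide_tendsto_aux[of "cpoly (p j)"] lc
    by (intro tendsto_intros vanishing tendsto_inverse_0) simp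
  then have "((\<lambda>z. - of_real (d j) / (poly (cpoly (p j)) z / z ^ ?k + G (Suc j) z * inverse z ^ ?k))
      \<longlongrightarrow> - of_real (d j) / 1) at_infinity"
    by (intro tendsto_divide tendsto_const) auto
  then have "((\<lambda>z. z ^ ?k * G j z) \<longlongrightarrow> - of_real (d j) / 1) at_infinity"
  proof (rule Lim_transform_eventually)
    show "\<forall>\<^sub>F z in at_infinity. - of_real (d j) / (poly (cpoly (p j)) z / z ^ ?k + G (Suc j) z * inverse z ^ ?k)
        = z ^ ?k * G j z"
      using eventually_not_equal_at_infinity[of 0] reciprocal[of j]
    proof eventually_elim
      case (elim z)
      define A where "A = poly (cpoly (p j)) z + G (Suc j) z"
      have e: "poly (cpoly (p j)) z / z ^ ?k + G (Suc j) z * inverse z ^ ?k = A / z ^ ?k"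
        by (simp add: A_def divide_inverse algebra_simps power_inverse)
      have "- 1 / G j z = A / of_real (d j)" using elim by (simp add: A_def)
      then have "G j z = - of_real (d j) / A"
        using d_nonzero[of j] by (cases "A = 0"; cases "G j z = 0") (auto simp: field_simps eq_neg_iff_add_eq_0)
      then show ?case unfolding e using elim by simp
    qed
  qed
  then show ?thesis by simp
qed

lemma first_coeff_scaled:
  assumes "\<forall>\<^sub>F z in at_infinity. H z = of_real a * G j z" "a \<noteq> 0"
  shows "first_coeff H = a * d j"
proof (rule first_coeff_eqI)
  have ev: "\<forall>\<^sub>F z in at_infinity. of_real a * G j z = H z" using assms(1) by eventually_elim simp
  show "real_expandable H" by (rule real_expandable_cong[OF ev real_expandable_scale[OF expandable]])
  show "((\<lambda>z. z ^ Polynomial.degree (p j) * H z) \<longlongrightarrow> - complex_of_real (a * d j)) at_infinity"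
  proof (rule Lim_transform_eventually)
    show "((\<lambda>z. of_real a * (z ^ Polynomial.degree (p j) * G j z)) \<longlongrightarrow> - complex_of_real (a * d j)) at_infinity"
      using tendsto_mult_left[OF scaled_limit, of "of_real a" j] by simp
    show "\<forall>\<^sub>F z in at_infinity. of_real a * (z ^ Polynomial.degree (p j) * G j z) = z ^ Polynomial.degree (p j) * H z"
      using ev by eventually_elim (metis mult.left_commute)
  qed
  show "a * d j \<noteq> 0" using assms(2) d_nonzero by simp
qed (rule degree_pos)

text \<open>One step of the normalized recursion, started at the multiple \<open>a * G j\<close> whose first coefficient
  \<open>a * d j\<close> is a sign. As \<open>1 / (a * d j) = a * d j\<close>, the reciprocal relation turns into the defining
  relation of \<^const>\<open>cf_remainder\<close>.\<close>

lemma step: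
  assumes H: "\<forall>\<^sub>F z in at_infinity. H z = of_real a * G j z" and unit: "\<bar>a * d j\<bar> = 1"
  shows "cf_sign H = a * d j" "cf_poly H = p j" "(cf_b H)\<^sup>2 = \<bar>d (Suc j)\<bar>"
    "\<forall>\<^sub>F z in at_infinity. cf_remainder H z / of_real ((cf_b H)\<^sup>2) = of_real (a * d j / \<bar>d (Suc j)\<bar>) * G (Suc j) z"
proof -
  define e where "e = a * d j"
  have e: "e = 1 \<or> e = -1" using unit by (auto simp: e_def abs_if split: if_splits)
  have a: "a = e / d j" "a \<noteq> 0" using d_nonzero[of j] e by (auto simp: e_def)
  show sign: "cf_sign H = a * d j" unfolding cf_sign_def using first_coeff_scaled[OF H] a by blast
  then have sign': "cf_sign H = e" by (simp add: e_def)
  have rem: "\<forall>\<^sub>F z in at_infinity. - 1 / H z - of_real e * poly (cpoly (p j)) z = of_real e * G (Suc j) z"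
    using H reciprocal[of j]
  proof eventually_elim
    case (elim z)
    have "- 1 / H z = (of_real (d j) / of_real e) * (- 1 / G j z)" using elim(1) a(1) by simp
    also have "\<dots> = of_real e * (poly (cpoly (p j)) z + G (Suc j) z)"
      unfolding elim using e d_nonzero[of j] by auto
    finally show ?case by (simp add: algebra_simps)
  qed
  have "((\<lambda>z. of_real e * G (Suc j) z) \<longlongrightarrow> of_real e * 0) at_infinity" by (intro tendsto_intros vanishing)
  then have lim: "((\<lambda>z. - 1 / H z - of_real e * poly (cpoly (p j)) z) \<longlongrightarrow> 0) at_infinity"
    using tendsto_cong[OF rem] by simp
  show poly: "cf_poly H = p j"
    unfolding cf_poly_def sign'
  proof (rule the_equality)
    show "lead_coeff (p j) = 1 \<and> (\<forall>\<delta>>0. ((\<lambda>z. - 1 / H z - of_real e * poly (cpoly (p j)) z) \<longlongrightarrow> 0) (sector_at_infinity \<delta>))"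
      using monic lim by (blast intro: tendsto_sector)
    fix p' :: "real poly"
    assume "lead_coeff p' = 1 \<and> (\<forall>\<delta>>0. ((\<lambda>z. - 1 / H z - of_real e * poly (cpoly p') z) \<longlongrightarrow> 0) (sector_at_infinity \<delta>))"
    then have "((\<lambda>z. - 1 / H z - of_real e * poly (cpoly p') z) \<longlongrightarrow> 0) (sector_at_infinity 1)" by simp
    from tendsto_mult_left[OF tendsto_diff[OF this tendsto_sector[OF lim]], of "of_real e"]
    have "((\<lambda>z. poly (cpoly (p j) - cpoly p') z) \<longlongrightarrow> 0) (sector_at_infinity 1)"
      using e by (auto simp: algebra_simps)
    then have "cpoly (p j) - cpoly p' = 0" by (intro poly_tendsto_0_sector) 
    then have "cpoly (p j - p') = 0" by (simp add: cpoly_diff)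
    then show "p' = p j" by (metis degree_0 degree_cpoly eq_iff_diff_eq_0 leading_coeff_0_iff coeff_map_poly of_real_0 of_real_eq_0_iff coeff_0)
  qed
  have rem': "\<forall>\<^sub>F z in at_infinity. cf_remainder H z = of_real e * G (Suc j) z"
    using rem unfolding cf_remainder_def sign' poly .
  have norm: "normalized (\<lambda>z. cf_remainder H z / complex_of_real (\<beta>\<^sup>2)) \<longleftrightarrow> \<beta>\<^sup>2 = \<bar>d (Suc j)\<bar>" if "\<beta> > 0" for \<beta>
  proof -
    have "\<forall>\<^sub>F z in at_infinity. cf_remainder H z / complex_of_real (\<beta>\<^sup>2) = of_real (e / \<beta>\<^sup>2) * G (Suc j) z"
      using rem' by eventually_elim simp
    then have "first_coeff (\<lambda>z. cf_remainder H z / complex_of_real (\<beta>\<^sup>2)) = e / \<beta>\<^sup>2 * d (Suc j)"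
      by (rule first_coeff_scaled) (use e that in auto)
    then have "\<bar>first_coeff (\<lambda>z. cf_remainder H z / complex_of_real (\<beta>\<^sup>2))\<bar> = \<bar>d (Suc j)\<bar> / \<beta>\<^sup>2"
      using e by (auto simp: abs_mult)
    then show ?thesis unfolding normalized_def using that by (auto simp: divide_eq_1_iff)
  qed
  have "cf_b H = sqrt \<bar>d (Suc j)\<bar>" unfolding cf_b_def
  proof (rule the_equality)
    show "sqrt \<bar>d (Suc j)\<bar> > 0 \<and> normalized (\<lambda>z. cf_remainder H z / complex_of_real ((sqrt \<bar>d (Suc j)\<bar>)\<^sup>2))"
      using norm[of "sqrt \<bar>d (Suc j)\<bar>"] d_nonzero[of "Suc j"] by simp
    show "\<beta> = sqrt \<bar>d (Suc j)\<bar>" if "\<beta> > 0 \<and> normalized (\<lambda>z. cf_remainder H z / complex_of_real (\<beta>\<^sup>2))" for \<beta>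
      using that norm[of \<beta>] by (metis less_imp_le real_sqrt_unique)
  qed
  then show b: "(cf_b H)\<^sup>2 = \<bar>d (Suc j)\<bar>" by simp
  show "\<forall>\<^sub>F z in at_infinity. cf_remainder H z / of_real ((cf_b H)\<^sup>2) = of_real (a * d j / \<bar>d (Suc j)\<bar>) * G (Suc j) z"
    unfolding b e_def[symmetric] using rem' by eventually_elim simp
qed

lemma cf_eq: "\<exists>a. (\<forall>\<^sub>F z in at_infinity. cf (G 0) j z = of_real a * G j z) \<and> \<bar>a * d j\<bar> = 1"
proof (induction j)
  case 0
  have "first_coeff (G 0) = d 0" using first_coeff_scaled[of "G 0" 1 0] by simp
  then show ?case using d_nonzero[of 0]
    by (intro exI[of _ "1 / \<bar>d 0\<bar>"]) (auto simp: abs_mult)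
next
  case (Suc j)
  then obtain a where a: "\<forall>\<^sub>F z in at_infinity. cf (G 0) j z = of_real a * G j z" "\<bar>a * d j\<bar> = 1" by blast
  show ?case
    using step(4)[OF a] a(2) d_nonzero[of "Suc j"]
    by (intro exI[of _ "a * d j / \<bar>d (Suc j)\<bar>"]) (auto simp: abs_mult)
qed

theorem gj_p_eq: "gj_p (G 0) j = p j"
  using cf_eq[of j] step(2) unfolding gj_p_def by blast

theorem gj_c_eq: "gj_c (G 0) j = d (Suc j)"
proof -
  obtain a where a: "\<forall>\<^sub>F z in at_infinity. cf (G 0) j z = of_real a * G j z" "\<bar>a * d j\<bar> = 1" using cf_eq by blast
  define a' where "a' = a * d j / \<bar>d (Suc j)\<bar>"
  have a': "\<forall>\<^sub>F z in at_infinity. cf (G 0) (Suc j) z = of_real a' * G (Suc j) z"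
    using step(4)[OF a] by (simp add: a'_def)
  have u': "\<bar>a' * d (Suc j)\<bar> = 1" using a(2) d_nonzero[of "Suc j"] by (simp add: a'_def abs_mult)
  have "(a * d j) * (a * d j) = 1" using a(2) by (metis abs_mult_self_eq mult_1)
  then have "(a * d j) * (a' * d (Suc j)) * \<bar>d (Suc j)\<bar> = d (Suc j)"
    using d_nonzero[of "Suc j"] unfolding a'_def by (simp add: field_simps)
  then show ?thesis unfolding gj_c_def step(1)[OF a] step(1)[OF a' u'] step(3)[OF a] .
qed

end

section \<open>Behaviour of the Cauchy transforms at infinity\<close>

context unit_interval_measure
begin

lemma not_unit_segment: "cmod z > 1 \<Longrightarrow> z \<notin> unit_segment"
  by (auto simp: unit_segment_def)

lemma dist_unit_segment: "t \<in> {-1..1} \<Longrightarrow> cmod z - 1 \<le> cmod (of_real t - z)"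
  using norm_triangle_ineq2[of z "of_real t"] by (auto simp: norm_minus_commute)

lemma E_norm_le: "\<exists>B. \<forall>z. cmod z > 1 \<longrightarrow> cmod (E p z) \<le> B / (cmod z - 1)"
proof -
  obtain B where B: "\<forall>t\<in>{-1..1}. \<bar>poly p t\<bar> \<le> B" using poly_bounded_on_unit by blast
  have "cmod (E p z) \<le> (B / (cmod z - 1)) * measure \<sigma> UNIV" if "cmod z > 1" for z
    unfolding E_def
  proof (rule norm_integral_le_unit[OF cauchy_integrand_borel])
    fix t :: real assume "t \<in> {-1..1}"
    then show "cmod (complex_of_real (poly p t) / (complex_of_real t - z)) \<le> B / (cmod z - 1)"
      using B dist_unit_segment[of t z] that by (auto simp: norm_divide intro!: frac_le)
  qed
  then show ?thesis by (intro exI[of _ "B * measure \<sigma> UNIV"]) simp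
qed

lemma eventually_cmod_gt: "\<forall>\<^sub>F z :: complex in at_infinity. cmod z > R"
  unfolding eventually_at_infinity by (intro exI[of _ "R + 1"]) auto

lemma E_tendsto_0: "(E p \<longlongrightarrow> 0) at_infinity"
proof -
  obtain B where B: "\<And>z. cmod z > 1 \<Longrightarrow> cmod (E p z) \<le> B / (cmod z - 1)" using E_norm_le by blast
  have "((\<lambda>z :: complex. B / (cmod z - 1)) \<longlongrightarrow> 0) at_infinity"
    using filterlim_tendsto_add_at_top[OF tendsto_const[of "-1"] filterlim_norm_at_top]
    by (intro tendsto_divide_0[OF tendsto_const] filterlim_at_top_imp_at_infinity) simp
  moreover have "\<forall>\<^sub>F z in at_infinity. norm (E p z) \<le> B / (cmod z - 1)"
    using eventually_cmod_gt[of 1] by eventually_elim (rule B)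
  ultimately show ?thesis by (rule Lim_null_comparison[rotated])
qed

lemma E_X_power: 
  assumes "z \<notin> unit_segment" "z \<noteq> 0"
  shows "E (X ^ n * p) z = z ^ n * (E p z + (\<Sum>k<n. of_real (I (X ^ k * p)) / z ^ Suc k))"
proof (induction n)
  case (Suc n)
  have "E (X ^ Suc n * p) z = E (X * (X ^ n * p)) z" by (simp add: mult.assoc del: mult_pCons_left)
  also have "\<dots> = z * E (X ^ n * p) z + of_real (I (X ^ n * p))" by (rule E_X[OF assms(1)])
  finally have e: "E (X ^ Suc n * p) z = z * (z ^ n * (E p z + (\<Sum>k<n. of_real (I (X ^ k * p)) / z ^ Suc k)))
      + of_real (I (X ^ n * p))" unfolding Suc.IH .
  show ?case unfolding e sum.lessThan_Suc using assms(2) by (simp add: field_simps)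
qed simp

text \<open>The remainder after \<open>n\<close> terms is the transform of \<open>X ^ n\<close>, a bounded quantity, divided by \<open>z ^ n\<close>.\<close>

lemma moment_series:
  assumes "cmod z > 1"
  shows "(\<lambda>k. of_real (- I (X ^ k)) / z ^ Suc k) sums stieltjes \<sigma> z"
proof -
  have z: "z \<noteq> 0" "z \<notin> unit_segment" using assms not_unit_segment by auto
  have "(\<Sum>k<n. of_real (- I (X ^ k)) / z ^ Suc k) = stieltjes \<sigma> z - E (X ^ n) z / z ^ n" for n
    using E_X_power[OF z(2,1), of n 1] z by (simp add: E_1 sum_negf)
  moreover have "(\<lambda>n. E (X ^ n) z / z ^ n) \<longlonglongrightarrow> 0"
  proof (rule Lim_null_comparison)
    have bound: "cmod (E (X ^ n) z) \<le> (1 / (cmod z - 1)) * measure \<sigma> UNIV" for n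
      unfolding E_def
    proof (rule norm_integral_le_unit[OF cauchy_integrand_borel])
      fix t :: real assume t: "t \<in> {-1..1}"
      have "\<bar>t\<bar> ^ n \<le> 1" using t by (simp add: abs_le_iff power_le_one)
      then show "cmod (complex_of_real (poly (X ^ n) t) / (complex_of_real t - z)) \<le> 1 / (cmod z - 1)"
        using dist_unit_segment[OF t, of z] assms by (auto simp: norm_divide norm_power poly_power intro!: frac_le)
    qed
    have "norm (E (X ^ n) z / z ^ n) = cmod (E (X ^ n) z) * inverse (cmod z) ^ n" for n
      by (simp add: norm_divide norm_power field_simps)
    then show "\<forall>\<^sub>F n in sequentially. norm (E (X ^ n) z / z ^ n) \<le> ((1 / (cmod z - 1)) * measure \<sigma> UNIV) * inverse (cmod z) ^ n"
      using mult_right_mono[OF bound, of "inverse (cmod z) ^ n" n for n] by (intro always_eventually allI) simp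
    have "(\<lambda>n. inverse (cmod z) ^ n) \<longlonglongrightarrow> 0"
      using assms by (intro LIMSEQ_power_zero) (simp add: inverse_less_1_iff)
    from tendsto_mult_right_zero[OF this]
    show "(\<lambda>n. ((1 / (cmod z - 1)) * measure \<sigma> UNIV) * inverse (cmod z) ^ n) \<longlonglongrightarrow> 0" .
  qed
  ultimately show ?thesis unfolding sums_def using tendsto_diff[OF tendsto_const] by fastforce
qed

text \<open>The moment series is a power series in \<open>1 / z\<close>.\<close>

lemma stieltjes_holomorphic: "stieltjes \<sigma> holomorphic_on {z. 1 < cmod z}"
proof -
  define f where "f w = (if w = 0 then of_real (- I 1) else stieltjes \<sigma> (inverse w) / w)" for w
  have "f holomorphic_on ball 0 1"
  proof (rule power_series_holomorphic)
    fix w :: complex assume w: "w \<in> ball 0 1"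
    show "(\<lambda>k. of_real (- I (X ^ k)) * (w - 0) ^ k) sums f w"
    proof (cases "w = 0")
      case True
      then show ?thesis using powser_sums_zero[of "\<lambda>k. complex_of_real (- I (X ^ k))"] by (simp add: f_def)
    next
      case False
      then have "cmod (inverse w) > 1" using w by (simp add: norm_inverse one_less_inverse)
      from sums_divide[OF moment_series[OF this], of w] False show ?thesis by (simp add: f_def field_simps)
    qed
  qed
  then have "(f \<circ> inverse) holomorphic_on {z. 1 < cmod z}"
    by (rule holomorphic_on_compose_gen[rotated])
       (auto intro!: holomorphic_intros simp: norm_inverse inverse_less_1_iff norm_divide)
  then have "(\<lambda>z. f (inverse z) / z) holomorphic_on {z. 1 < cmod z}"
    by (intro holomorphic_on_divide) (auto simp: o_def)
  then show ?thesis by (rule holomorphic_transform) (auto simp: f_def field_simps)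
qed

lemma E_P_holomorphic: "E (P n) holomorphic_on {z. 1 < cmod z}"
proof (rule holomorphic_transform)
  show "(\<lambda>z. poly (cpoly (P n)) z * stieltjes \<sigma> z + poly (cpoly (Q n)) z) holomorphic_on {z. 1 < cmod z}"
    by (intro holomorphic_intros stieltjes_holomorphic)
  show "\<And>z. z \<in> {z. 1 < cmod z} \<Longrightarrow> poly (cpoly (P n)) z * stieltjes \<sigma> z + poly (cpoly (Q n)) z = E (P n) z"
    using E_P[OF not_unit_segment] by simp
qed

text \<open>By orthogonality the terms of order below \<open>n\<close> in \<open>E_X_power\<close> vanish, and the next one is \<open>N n\<close>.\<close>

lemma E_P_asymptotic: "((\<lambda>z. z ^ Suc n * E (P n) z) \<longlongrightarrow> - of_real (N n)) at_infinity"
proof -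
  have low: "I (X ^ k * P n) = 0" if "k < n" for k
    using that P_orth[of "X ^ k" n] by (simp add: mult.commute degree_power_eq)
  have top: "I (X ^ n * P n) = N n"
  proof -
    have "Polynomial.degree (X ^ n) = n" "Polynomial.coeff (X ^ n) n = (1 :: real)"
      using lead_coeff_power[of X n] by (simp_all add: degree_power_eq)
    then have "Polynomial.degree (X ^ n - Polynomial.smult 1 (P n)) < n \<or> X ^ n - Polynomial.smult 1 (P n) = 0"
      by (intro monic_orth_diff[OF monic_orth_P]) auto
    from monic_orth_zero[OF monic_orth_P this] have "I (X ^ n * P n - P n * P n) = 0"
      by (simp add: algebra_simps)
    then show ?thesis by (simp only: I_diff N_def)
  qed
  have "((\<lambda>z. E (X ^ Suc n * P n) z - of_real (N n)) \<longlongrightarrow> 0 - of_real (N n)) at_infinity"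
    by (intro tendsto_intros E_tendsto_0)
  then have "((\<lambda>z. E (X ^ Suc n * P n) z - of_real (N n)) \<longlongrightarrow> - of_real (N n)) at_infinity" by simp
  then show ?thesis
  proof (rule Lim_transform_eventually)
    show "\<forall>\<^sub>F z in at_infinity. E (X ^ Suc n * P n) z - of_real (N n) = z ^ Suc n * E (P n) z"
      using eventually_cmod_gt[of 1]
    proof eventually_elim
      case (elim z)
      then have z: "z \<noteq> 0" "z \<notin> unit_segment" using not_unit_segment by auto
      have "(\<Sum>k<n. of_real (I (X ^ k * P n)) / z ^ Suc k) = 0" using low by simp
      then show ?case unfolding E_X_power[OF z(2,1)] using z(1) top by (simp add: mult.commute field_simps)
    qed
  qed
qed

lemma E_P_null: "((\<lambda>z. z ^ n * E (P n) z) \<longlongrightarrow> 0) at_infinity"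
proof -
  have "((\<lambda>z. inverse z * (z ^ Suc n * E (P n) z)) \<longlongrightarrow> 0 * - of_real (N n)) at_infinity"
    by (intro tendsto_mult tendsto_inverse_0 E_P_asymptotic)
  then have "((\<lambda>z. inverse z * (z ^ Suc n * E (P n) z)) \<longlongrightarrow> 0) at_infinity" by simp
  then show ?thesis
    by (rule Lim_transform_eventually)
       (use eventually_not_equal_at_infinity[of 0] in \<open>eventually_elim, simp add: field_simps\<close>)
qed

end

section \<open>The continued fraction of the perturbed transform\<close>

context geronimus_functional
begin

text \<open>Up to a factor \<open>z\<close> this is the function of the second kind of \<open>V j\<close> with respect to \<open>S\<close>, namely
  \<open>S\<close> applied to \<open>z * V j t / (t - z)\<close> in the variable \<open>t\<close>.\<close>

definition R :: "nat \<Rightarrow> complex \<Rightarrow> complex" where "R j z = E (V j) z - of_real (S (V j))"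

lemma E_V: assumes "z \<notin> unit_segment"
  shows "E (V j) z = (if j = 0 then E 1 z else E (P (nn j)) z + of_real (\<alpha> (nn j)) * E (P (nn j - 1)) z)"
  by (simp add: V_def E_add[OF assms] E_smult)

lemma R_Suc: "R (Suc j) = E (V (Suc j))" by (simp add: R_def S_V fun_eq_iff)

lemma R_Suc_W: assumes z: "z \<notin> unit_segment"
  shows "R (Suc j) z = z * E (W (Suc j)) z - of_real (u j) * R j z"
proof -
  have "z * E (W (Suc j)) z + of_real (I (W (Suc j))) = of_real (u j) * E (V j) z + E (V (Suc j)) z"
    using E_X[OF z, of "W (Suc j)"] unfolding X_W_Suc by (simp add: E_add[OF z] E_smult)
  moreover have "I (W (Suc j)) = u j * S (V j) + S (V (Suc j))"
    using S_X[of "W (Suc j)"] unfolding X_W_Suc by (simp add: S_add S_smult)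
  ultimately show ?thesis by (simp add: R_def algebra_simps)
qed

text \<open>\<open>S\<close> annihilates \<open>V j\<close> for \<open>j > 0\<close> only, and for \<open>j = 0\<close> an additional constant arises.\<close>

lemma E_W_Suc: assumes z: "z \<notin> unit_segment"
  shows "E (W (Suc j)) z = poly (cpoly (q j)) z * R j z - of_real (l j) * E (W j) z
    + (if j = 0 then of_real (h (nn 1 - 1)) else 0)"
proof -
  have W: "E (W (Suc j)) z = E (q j * V j) z - of_real (l j) * E (W j) z"
    unfolding W_Suc by (simp add: E_diff[OF z] E_smult)
  have "E (q j * V j) z = poly (cpoly (q j)) z * R j z + (if j = 0 then of_real (h (nn 1 - 1)) else 0)"
  proof (cases "h (nn j) = 0")
    case False
    then have q: "q j = 1" by (simp add: q_def)
    show ?thesis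
    proof (cases "j = 0")
      case True
      then show ?thesis using False q by (simp add: V_def R_def S_1 nn_Suc h_0 cpoly_1)
    next
      case j: False
      then obtain i where "j = Suc i" by (cases j) auto
      then show ?thesis using q by (simp add: R_Suc cpoly_1)
    qed
  next
    case True
    then have "q j * V j = X * V j - Polynomial.smult (b (nn j)) (V j)"
      by (intro real_poly_eqI) (simp add: q_def algebra_simps)
    then have e: "E (q j * V j) z = z * E (V j) z + of_real (I (V j)) - of_real (b (nn j)) * E (V j) z"
      by (simp only: E_diff[OF z] E_smult E_X[OF z])
    have qz: "poly (cpoly (q j)) z = z - of_real (b (nn j))" using True by (simp add: q_def)
    show ?thesis
    proof (cases "j = 0")
      case j: True
      have S1: "S 1 = 0" using True j S_1 h_0 by simp
      have "h (Suc 0) = N 0" using True j h_1 h_0 by simp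
      then show ?thesis using True j unfolding e qz
        by (simp add: V_def R_def S1 nn_Suc N_0 algebra_simps)
    next
      case False
      then obtain i where i: "j = Suc i" by (cases j) auto
      have "I (V j) = 0" using nn_Suc_pos[of i] True False I_P_Suc[of "nn j - 1"] i by (simp add: V_def \<alpha>_def)
      then show ?thesis using False unfolding e qz by (simp add: R_Suc i algebra_simps)
    qed
  qed
  with W show ?thesis by simp
qed

lemma poly_cpoly_pp: "poly (cpoly (pp j)) z = z * poly (cpoly (q j)) z - of_real (u j) - of_real (l j)"
  by (simp add: pp_def cpoly_diff cpoly_mult)

lemma R_1: assumes z: "z \<notin> unit_segment"
  shows "R (Suc 0) z = poly (cpoly (pp 0)) z * R 0 z + z * of_real (h (nn 1 - 1))"
  unfolding R_Suc_W[OF z] E_W_Suc[OF z] poly_cpoly_pp by (simp add: l_def algebra_simps)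

text \<open>The relations for \<open>V\<close> and \<open>W\<close> have passed to the transforms, and \<open>W\<close> is eliminated as before.\<close>

lemma R_rec: assumes z: "z \<notin> unit_segment"
  shows "R (Suc (Suc j)) z = poly (cpoly (pp (Suc j))) z * R (Suc j) z - of_real (cc j) * R j z"
proof -
  have "R (Suc (Suc j)) z = (z * poly (cpoly (q (Suc j))) z - of_real (u (Suc j))) * R (Suc j) z
     - of_real (l (Suc j)) * (z * E (W (Suc j)) z)"
    unfolding R_Suc_W[OF z, of "Suc j"] E_W_Suc[OF z, of "Suc j"] by (simp add: algebra_simps)
  also have "z * E (W (Suc j)) z = R (Suc j) z + of_real (u j) * R j z" using R_Suc_W[OF z, of j] by simp
  finally show ?thesis unfolding poly_cpoly_pp cc_def by (simp add: algebra_simps)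
qed

text \<open>In a block of size 2 the leading term comes from \<open>P (nn j)\<close>, otherwise from the correction
  \<open>\<alpha> (nn j) * P (nn j - 1)\<close>, which then does not vanish.\<close>

lemma R_asymptotic: "\<exists>\<kappa>. \<kappa> \<noteq> 0 \<and> ((\<lambda>z. z ^ (nn (Suc j) - 1) * R j z) \<longlongrightarrow> \<kappa>) at_infinity"
proof (cases j)
  case 0
  show ?thesis
  proof (cases "s = 0")
    case True
    have h0: "h 0 = 0" "S 1 = 0" using True S_1 h_0 by simp_all
    have "((\<lambda>z. z ^ Suc 0 * E (P 0) z) \<longlongrightarrow> - of_real (N 0)) at_infinity" by (rule E_P_asymptotic)
    then show ?thesis using 0 h0 by (intro exI[of _ "- of_real (N 0)"]) (simp add: R_def V_def nn_Suc)
  next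
    case False
    have "((\<lambda>z. E 1 z - of_real s) \<longlongrightarrow> 0 - of_real s) at_infinity" by (intro tendsto_intros E_tendsto_0)
    then show ?thesis using 0 False by (intro exI[of _ "- of_real s"]) (simp add: R_def V_def S_1 nn_Suc h_0)
  qed
next
  case (Suc i)
  then obtain m where m: "nn j = Suc m" "h m \<noteq> 0" and j: "j \<noteq> 0" using nn_Suc_eq_Suc by blast
  have ev: "\<forall>\<^sub>F z in at_infinity. z \<notin> unit_segment"
    using eventually_cmod_gt[of 1] by eventually_elim (rule not_unit_segment)
  have Rj: "R j z = E (P (Suc m)) z + of_real (\<alpha> (Suc m)) * E (P m) z" if "z \<notin> unit_segment" for z
    using E_V[OF that, of j] Suc m by (simp add: R_Suc)
  show ?thesis
  proof (cases "h (Suc m) = 0")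
    case True
    then have a: "\<alpha> (Suc m) = 0" by (simp add: \<alpha>_def)
    have "((\<lambda>z. z ^ (nn (Suc j) - 1) * R j z) \<longlongrightarrow> - of_real (N (Suc m))) at_infinity"
      by (rule Lim_transform_eventually[OF E_P_asymptotic])
         (use ev in \<open>eventually_elim, simp add: Rj a nn_Suc m True\<close>)
    then show ?thesis by (intro exI[of _ "- of_real (N (Suc m))"]) simp
  next
    case False
    have "((\<lambda>z. z ^ Suc m * E (P (Suc m)) z + of_real (\<alpha> (Suc m)) * (z ^ Suc m * E (P m) z)) \<longlongrightarrow>
        0 + of_real (\<alpha> (Suc m)) * (- of_real (N m))) at_infinity"
      by (intro tendsto_intros E_P_null E_P_asymptotic)
    then have "((\<lambda>z. z ^ (nn (Suc j) - 1) * R j z) \<longlongrightarrow> 0 + of_real (\<alpha> (Suc m)) * (- of_real (N m))) at_infinity"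
      by (rule Lim_transform_eventually)
         (use ev in \<open>eventually_elim, simp add: Rj nn_Suc m False algebra_simps\<close>)
    moreover have "\<alpha> (Suc m) \<noteq> 0" using False m by (simp add: \<alpha>_def)
    ultimately show ?thesis by (intro exI[of _ "0 + of_real (\<alpha> (Suc m)) * (- of_real (N m))"]) simp
  qed
qed

lemma R_eventually_nonzero: "\<forall>\<^sub>F z in at_infinity. R j z \<noteq> 0"
proof -
  obtain \<kappa> where "\<kappa> \<noteq> 0" "((\<lambda>z. z ^ (nn (Suc j) - 1) * R j z) \<longlongrightarrow> \<kappa>) at_infinity" using R_asymptotic by blast
  from tendsto_imp_eventually_ne[OF this(2,1)] show ?thesis by eventually_elim auto
qed

lemma R_ratio_tendsto_0: "((\<lambda>z. R (Suc j) z / R j z) \<longlongrightarrow> 0) at_infinity"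
proof -
  define m m' where "m = nn (Suc j) - 1" and "m' = nn (Suc (Suc j)) - 1"
  have m: "m' = m + (m' - m)" "m' - m > 0" using nn_Suc_pos[of j] by (auto simp: m_def m'_def nn_Suc[of "Suc j"])
  obtain \<kappa> where k: "\<kappa> \<noteq> 0" "((\<lambda>z. z ^ m * R j z) \<longlongrightarrow> \<kappa>) at_infinity" using R_asymptotic unfolding m_def by blast
  obtain \<kappa>' where k': "((\<lambda>z. z ^ m' * R (Suc j) z) \<longlongrightarrow> \<kappa>') at_infinity" using R_asymptotic unfolding m'_def by blast
  have "((\<lambda>z. (z ^ m' * R (Suc j) z) / (z ^ m * R j z) * inverse z ^ (m' - m)) \<longlongrightarrow> \<kappa>' / \<kappa> * 0 ^ (m' - m)) at_infinity"
    by (intro tendsto_intros k k' tendsto_inverse_0)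
  then have "((\<lambda>z. (z ^ m' * R (Suc j) z) / (z ^ m * R j z) * inverse z ^ (m' - m)) \<longlongrightarrow> 0) at_infinity"
    using m(2) by (simp add: power_0_left)
  then show ?thesis
  proof (rule Lim_transform_eventually)
    show "\<forall>\<^sub>F z in at_infinity. (z ^ m' * R (Suc j) z) / (z ^ m * R j z) * inverse z ^ (m' - m) = R (Suc j) z / R j z"
      using eventually_not_equal_at_infinity[of 0]
    proof eventually_elim
      case (elim z)
      have "z ^ m' = z ^ m * z ^ (m' - m)" using m(1) power_add by metis
      then show ?case using elim by (simp add: power_inverse)
    qed
  qed
qed

lemma R_holomorphic: "R j holomorphic_on {z. 1 < cmod z}"
proof (rule holomorphic_transform)
  show "(\<lambda>z. (if j = 0 then E (P 0) z else E (P (nn j)) z + of_real (\<alpha> (nn j)) * E (P (nn j - 1)) z) - of_real (S (V j)))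
      holomorphic_on {z. 1 < cmod z}"
    by (cases "j = 0"; simp del: P_0; intro holomorphic_intros E_P_holomorphic)
qed (use E_V[OF not_unit_segment, of _ j] in \<open>auto simp: R_def\<close>)

lemma R_cnj: "R j (cnj z) = cnj (R j z)"
  by (simp add: R_def E_cnj)

text \<open>The negative ratios of consecutive \<open>R\<close>, with \<open>- z\<close> taking the place of the predecessor of \<open>R 0\<close>.\<close>

definition G :: "nat \<Rightarrow> complex \<Rightarrow> complex" where
  "G j z = (case j of 0 \<Rightarrow> R 0 z / z | Suc i \<Rightarrow> - R (Suc i) z / R i z)"

lemma frakF_eq_G: "frakF \<sigma> s = G 0"
  by (simp add: fun_eq_iff frakF_def G_def R_def V_def S_1 E_1 diff_divide_distrib)

lemma G_vanishing: "(G j \<longlongrightarrow> 0) at_infinity"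
proof (cases j)
  case 0
  have "((\<lambda>z. (E 1 z - of_real s) * inverse z) \<longlongrightarrow> (0 - of_real s) * 0) at_infinity"
    by (intro tendsto_intros E_tendsto_0 tendsto_inverse_0)
  moreover have "G 0 = (\<lambda>z. (E 1 z - of_real s) * inverse z)"
    by (simp add: fun_eq_iff G_def R_def V_def S_1 divide_inverse)
  ultimately show ?thesis by (simp add: 0)
next
  case (Suc i)
  moreover have "G (Suc i) = (\<lambda>z. - (R (Suc i) z / R i z))" by (simp add: fun_eq_iff G_def)
  ultimately show ?thesis using tendsto_minus[OF R_ratio_tendsto_0[of i]] by simp
qed

lemma G_expandable: "real_expandable (G j)"
proof -
  obtain B where B: "\<And>z. cmod z \<ge> B \<Longrightarrow> R (j - 1) z \<noteq> 0"
    using R_eventually_nonzero[of "j - 1"] unfolding eventually_at_infinity by blast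
  define \<rho> where "\<rho> = max 1 B"
  have sub: "{z :: complex. \<rho> < cmod z} \<subseteq> {z. 1 < cmod z}" by (auto simp: \<rho>_def)
  have "G j holomorphic_on {z. \<rho> < cmod z}"
  proof (cases j)
    case 0
    then show ?thesis unfolding G_def using R_holomorphic[of 0] sub
      by (auto intro!: holomorphic_intros intro: holomorphic_on_subset simp: \<rho>_def)
  next
    case (Suc i)
    then show ?thesis unfolding G_def using R_holomorphic[of i] R_holomorphic[of j] sub B
      by (auto intro!: holomorphic_intros intro: holomorphic_on_subset simp: \<rho>_def)
  qed
  moreover have "G j (cnj z) = cnj (G j z)" for z by (simp add: G_def R_cnj split: nat.split)
  ultimately have "vanishing_holomorphic \<rho> (G j)"
    unfolding vanishing_holomorphic_def using G_vanishing by blast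
  then show ?thesis by (rule vanishing_holomorphic_expandable) (simp add: \<rho>_def)
qed

sublocale continued_fraction G pp "\<lambda>j. case j of 0 \<Rightarrow> h (nn 1 - 1) | Suc i \<Rightarrow> cc i"
proof
  fix j
  let ?d = "case j of 0 \<Rightarrow> h (nn 1 - 1) | Suc i \<Rightarrow> cc i"
  show d: "?d \<noteq> 0" using h_nn[of 0] cc_nonzero by (auto split: nat.split)
  show "\<forall>\<^sub>F z in at_infinity. - 1 / G j z = (poly (cpoly (pp j)) z + G (Suc j) z) / of_real ?d"
    using R_eventually_nonzero[of j] eventually_cmod_gt[of 1]
  proof eventually_elim
    case (elim z)
    then have z: "z \<noteq> 0" "z \<notin> unit_segment" using not_unit_segment by auto
    show ?case
    proof (cases j)
      case 0
      then show ?thesis using elim d z R_1[OF z(2)] by (simp add: G_def field_simps)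
    next
      case (Suc i)
      have "(poly (cpoly (pp j)) z + G (Suc j) z) * R j z = of_real (cc i) * R i z"
        using elim R_rec[OF z(2), of i] Suc by (simp add: G_def distrib_right)
      then have "poly (cpoly (pp j)) z + G (Suc j) z = of_real (cc i) * R i z / R j z"
        using elim by (simp add: field_simps)
      then show ?thesis using elim Suc cc_nonzero[of i] by (simp add: G_def)
    qed
  qed
  show "Polynomial.degree (pp j) \<ge> 1" by (simp add: degree_pp block_size_nn)
qed (simp_all add: G_expandable G_vanishing lead_pp)

lemma gj_p_frakF: "gj_p (frakF \<sigma> s) j = pp j"
  by (simp add: frakF_eq_G gj_p_eq)
lemma gj_c_frakF: "gj_c (frakF \<sigma> s) j = cc j"
  by (simp add: frakF_eq_G gj_c_eq)
lemma gj_P_frakF: "gj_P (frakF \<sigma> s) j = V j"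
  by (induction "frakF \<sigma> s" j rule: gj_P.induct)
     (simp_all add: gj_p_frakF gj_c_frakF V_1 V_rec, simp add: V_def)

end

section \<open>Block factors\<close>

lemma indicator_row_sums:
  fixes f :: "nat \<Rightarrow> 'a :: {real_normed_field}"
  shows "(\<lambda>k. ((if k = a then x else 0) + (if k = a' then y else 0) + (if k = a'' then w else 0)) * f k)
    sums (x * f a + y * f a' + w * f a'')"
proof -
  have "(\<lambda>k. (if k = a then x else 0) * f k) sums (x * f a)" for a x
    using sums_If_finite_set[of "{a}" "\<lambda>k. x * f k"] by (simp add: if_distrib[of "\<lambda>x. x * f _"] cong: if_cong)
  then show ?thesis unfolding distrib_right by (intro sums_add)
qed

text \<open>The combinatorics of matrices whose blocks have size 1 or 2. The matrices are described row by row;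
  in this form the products of the factors need only finite sums of two or three terms.\<close>

locale block_partition =
  fixes n :: "nat \<Rightarrow> nat"
  assumes n_0: "n 0 = 0" and n_step: "n (Suc j) = Suc (n j) \<or> n (Suc j) = Suc (Suc (n j))"
begin

lemma strict_mono_n: "strict_mono n"
  unfolding strict_mono_Suc_iff
proof
  fix j show "n j < n (Suc j)" using n_step[of j] by auto
qed

lemma n_less: "i < j \<Longrightarrow> n i < n j"
  by (rule strict_monoD[OF strict_mono_n])

lemma n_le: "i \<le> j \<Longrightarrow> n i \<le> n j"
  using n_less by (cases "i = j") (auto simp: le_less)

lemma n_pos: "i > 0 \<Longrightarrow> n i > 0" using n_less[of 0 i] n_0 by simp

definition in_block :: "nat \<Rightarrow> nat \<Rightarrow> bool" where "in_block a i \<longleftrightarrow> n i \<le> a \<and> a < n (Suc i)"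

lemma in_block_unique: "in_block a i \<Longrightarrow> in_block a j \<Longrightarrow> i = j"
  unfolding in_block_def using n_le[of "Suc i" j] n_le[of "Suc j" i] by (cases i j rule: linorder_cases) auto

lemma ex_in_block: "\<exists>i. in_block a i"
proof (induction a)
  case 0
  show ?case using n_0 n_less[of 0 1] by (auto simp: in_block_def intro: exI[of _ 0])
next
  case (Suc a)
  then obtain i where i: "in_block a i" by blast
  show ?case
  proof (cases "Suc a < n (Suc i)")
    case True
    then show ?thesis using i by (auto simp: in_block_def intro: exI[of _ i])
  next
    case False
    then have "Suc a = n (Suc i)" using i by (simp add: in_block_def)
    then have "in_block (Suc a) (Suc i)" using n_less[of "Suc i" "Suc (Suc i)"] by (simp add: in_block_def)
    then show ?thesis ..
  qed
qed

lemma in_block_disj: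
  assumes "in_block a i"
  shows "n (Suc i) = Suc (n i) \<and> a = n i \<or> n (Suc i) = Suc (Suc (n i)) \<and> a = n i
    \<or> n (Suc i) = Suc (Suc (n i)) \<and> a = Suc (n i)"
  using n_step[of i]
proof
  assume S: "n (Suc i) = Suc (n i)"
  then have "a = n i" using assms by (simp add: in_block_def)
  with S show ?thesis by simp
next
  assume S: "n (Suc i) = Suc (Suc (n i))"
  then have "a = n i \<or> a = Suc (n i)" using assms by (auto simp: in_block_def)
  with S show ?thesis by simp
qed

lemma block_of_eq: "in_block a i \<Longrightarrow> block_of n a = i"
  unfolding block_of_def using in_block_unique unfolding in_block_def by blast

lemma in_block_first: "in_block (n i) i" using n_less[of i "Suc i"] by (simp add: in_block_def)
lemma in_block_last: "in_block (n (Suc i) - 1) i" using n_less[of i "Suc i"] by (auto simp: in_block_def)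

lemma block_matrix_eq:
  "in_block a i \<Longrightarrow> in_block k j \<Longrightarrow> block_matrix n B a k = B i j (a - n i) (k - n j)"
  by (simp add: block_matrix_def Let_def block_of_eq)

lemma block_cases:
  assumes "in_block a i" "in_block k j"
  obtains (diag) "j = i" | (sub) "i = Suc j" | (super) "j = Suc i"
    | (below) "Suc j < i" "k < n i - 1" | (above) "Suc i < j" "k > Suc a"
proof -
  consider "j = i" | "i = Suc j" | "j = Suc i" | "Suc j < i" | "Suc i < j" by linarith
  then show thesis
  proof cases
    case 4
    then have "n (Suc j) < n i" by (rule n_less)
    then show thesis using assms 4 by (intro below) (auto simp: in_block_def)
  next
    case 5
    then have "n (Suc i) < n j" by (rule n_less)
    then show thesis using assms 5 by (intro above) (auto simp: in_block_def)
  qed (use diag sub super in auto)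
qed

lemma block_L_row:
  assumes a: "in_block a i"
  shows "block_L n l e a k = (if k = a then 1 else 0)
    + (if k = n i then (if a = Suc (n i) then e i else 0) else 0)
    + (if k = n i - 1 then (if i > 0 \<and> a = n (Suc i) - 1 then l i else 0) else 0)"
proof -
  obtain j where k: "in_block k j" using ex_in_block by blast
  have eq: "block_L n l e a k = (if i = j then (if block_size n j = 1 then [[1]] else [[1, 0], [e j, 1]]) ! (a - n i) ! (k - n j)
     else if i = Suc j then lower_right (block_size n i) (block_size n j) (l i) (a - n i) (k - n j)
     else 0)" unfolding block_L_def block_matrix_eq[OF a k] ..
  from a k show ?thesis
  proof (cases rule: block_cases)
    case diag
    have "i = 0 \<or> n i > 0" using n_pos[of i] by (cases "i = 0") auto
    then show ?thesis unfolding eq using in_block_disj[OF a] in_block_disj[OF k] unfolding diag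
      by (elim disjE conjE) (simp_all add: block_size_def)
  next
    case sub
    show ?thesis unfolding eq using in_block_disj[OF a] in_block_disj[OF k] unfolding sub
      by (elim disjE conjE) (simp_all add: lower_right_def block_size_def)
  next
    case super
    then show ?thesis unfolding eq using a k by (auto simp: in_block_def)
  next
    case below
    then show ?thesis unfolding eq using a by (auto simp: in_block_def)
  next
    case above
    then show ?thesis unfolding eq using a by (auto simp: in_block_def)
  qed
qed

lemma block_U_row:
  assumes a: "in_block a i"
  shows "block_U n u a k = (if k = Suc a then 1 else 0)
    + (if k = n i then (if a = n (Suc i) - 1 then u i else 0) else 0)"
proof -
  obtain j where k: "in_block k j" using ex_in_block by blast
  have eq: "block_U n u a k = (if i = j then (if block_size n j = 1 then [[u j]] else [[0, 1], [u j, 0]]) ! (a - n i) ! (k - n j)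
     else if j = Suc i then lower_left (block_size n i) 1 (a - n i) (k - n j)
     else 0)" unfolding block_U_def block_matrix_eq[OF a k] ..
  from a k show ?thesis
  proof (cases rule: block_cases)
    case diag
    show ?thesis unfolding eq using in_block_disj[OF a] in_block_disj[OF k] unfolding diag
      by (elim disjE conjE) (simp_all add: block_size_def)
  next
    case super
    show ?thesis unfolding eq using in_block_disj[OF a] in_block_disj[OF k] unfolding super
      by (elim disjE conjE) (simp_all add: lower_left_def block_size_def)
  qed (use a k in \<open>auto simp: eq in_block_def\<close>)
qed

lemma gen_jacobi_row:
  assumes a: "in_block a i"
  shows "gen_jacobi n G a k = (if k = Suc a then 1 else 0) + (if a = n (Suc i) - 1 then
      (if k = n i then - Polynomial.coeff (gj_p G i) 0 else 0)
      + (if k = Suc (n i) \<and> a = Suc (n i) then - Polynomial.coeff (gj_p G i) 1 else 0)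
      + (if i > 0 \<and> k = n (i - 1) then gj_c G (i - 1) else 0) else 0)"
proof -
  obtain j where k: "in_block k j" using ex_in_block by blast
  have eq: "gen_jacobi n G a k = (if i = j then
       (if block_size n j = 1 then [[- Polynomial.coeff (gj_p G j) 0]]
        else [[0, 1], [- Polynomial.coeff (gj_p G j) 0, - Polynomial.coeff (gj_p G j) 1]]) ! (a - n i) ! (k - n j)
     else if j = Suc i then lower_left (block_size n i) 1 (a - n i) (k - n j)
     else if i = Suc j then lower_left (block_size n i) (gj_c G j) (a - n i) (k - n j)
     else 0)" unfolding gen_jacobi_def block_matrix_eq[OF a k] ..
  from a k show ?thesis
  proof (cases rule: block_cases)
    case diag
    have "i = 0 \<or> n (i - 1) < n i" using n_less[of "i - 1" i] by (cases "i = 0") auto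
    then show ?thesis unfolding eq using in_block_disj[OF a] in_block_disj[OF k] unfolding diag
      by (elim disjE conjE) (simp_all add: block_size_def)
  next
    case sub
    show ?thesis unfolding eq using in_block_disj[OF a] in_block_disj[OF k] unfolding sub
      by (elim disjE conjE) (simp_all add: lower_left_def block_size_def)
  next
    case super
    have "n (i - 1) \<le> n i" by (rule n_le) simp
    then show ?thesis unfolding eq using in_block_disj[OF a] in_block_disj[OF k] unfolding super
      by (elim disjE conjE) (simp_all add: lower_left_def block_size_def)
  next
    case below
    then have "n j < n (i - 1)" by (intro n_less) simp
    moreover have "n (Suc j) \<le> n (i - 1)" using below by (intro n_le) simp
    ultimately show ?thesis unfolding eq using a k below by (auto simp: in_block_def)
  next
    case above
    have "n (i - 1) \<le> n i" by (rule n_le) simp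
    then show ?thesis unfolding eq using a k above by (auto simp: in_block_def)
  qed
qed

lemma block_L_apply_sums:
  fixes x :: "nat \<Rightarrow> 'a :: {real_normed_field}"
  assumes a: "in_block a i"
  shows "(\<lambda>k. of_real (block_L n l e a k) * x k) sums
    (x a + of_real (if a = Suc (n i) then e i else 0) * x (n i)
     + of_real (if i > 0 \<and> a = n (Suc i) - 1 then l i else 0) * x (n i - 1))"
proof -
  have "of_real (block_L n l e a k) * x k = ((if k = a then 1 else 0)
    + (if k = n i then of_real (if a = Suc (n i) then e i else 0) else 0)
    + (if k = n i - 1 then of_real (if i > 0 \<and> a = n (Suc i) - 1 then l i else 0) else 0)) * x k" for k
    unfolding block_L_row[OF a] by (intro arg_cong2[where f = "(*)"]) auto
  then show ?thesis 
    using indicator_row_sums[of a 1 "n i" "of_real (if a = Suc (n i) then e i else 0)" "n i - 1"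
      "of_real (if i > 0 \<and> a = n (Suc i) - 1 then l i else 0)" x] by (simp only: mult_1)
qed

lemma LU_row:
  assumes a: "in_block a i"
  shows "inf_mat_mult (block_L n l e) (block_U n u) a k = block_U n u a k
     + (if a = Suc (n i) then e i else 0) * block_U n u (n i) k
     + (if i > 0 \<and> a = n (Suc i) - 1 then l i else 0) * block_U n u (n i - 1) k"
  unfolding inf_mat_mult_def using sums_unique[OF block_L_apply_sums[OF a, of l e "\<lambda>j. block_U n u j k"]] by simp

lemma UL_row:
  assumes a: "in_block a i"
  shows "inf_mat_mult (block_U n u) (block_L n l e) a k = block_L n l e (Suc a) k
     + (if a = n (Suc i) - 1 then u i else 0) * block_L n l e (n i) k"
  unfolding inf_mat_mult_def block_U_row[OF a]
  using sums_unique[OF indicator_row_sums[of "Suc a" 1 "n i" "if a = n (Suc i) - 1 then u i else 0" 0 0 "\<lambda>j. block_L n l e j k"]]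
  by (simp cong: if_cong)

lemma block_L_cong:
  assumes "\<And>j. l (Suc j) = l' (Suc j)" "\<And>j. block_size n j = 2 \<Longrightarrow> e j = e' j"
  shows "block_L n l e = block_L n l' e'"
proof (intro ext)
  fix a k
  obtain i where a: "in_block a i" using ex_in_block by blast
  have e: "(if a = Suc (n i) then e i else 0) = (if a = Suc (n i) then e' i else 0)"
    using in_block_disj[OF a] assms(2)[of i] by (elim disjE conjE) (simp_all add: block_size_def)
  have l: "(if i > 0 \<and> a = n (Suc i) - 1 then l i else 0) = (if i > 0 \<and> a = n (Suc i) - 1 then l' i else 0)"
    using assms(1)[of "i - 1"] by (cases "i = 0") simp_all
  show "block_L n l e a k = block_L n l' e' a k" unfolding block_L_row[OF a] e l ..
qed

text \<open>The hypotheses are the entries of \<open>L U\<close> in the last row of a block; the first row of a block of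
  size 2 is a row of the shift on both sides.\<close>

lemma LU_eq_gen_jacobi:
  assumes p0: "\<And>i. - Polynomial.coeff (gj_p G i) 0 = u i + (if i > 0 then l i else 0)"
    and p1: "\<And>i. block_size n i = 2 \<Longrightarrow> e i = - Polynomial.coeff (gj_p G i) 1"
    and c: "\<And>i. gj_c G i = l (Suc i) * u i"
  shows "gen_jacobi n G = inf_mat_mult (block_L n l e) (block_U n u)"
proof (intro ext)
  fix a k
  obtain i where a: "in_block a i" using ex_in_block by blast
  have prev: "block_U n u (n i - 1) k = (if k = n i then 1 else 0) + (if k = n (i - 1) then u (i - 1) else 0)" if "i > 0"
  proof -
    have "in_block (n i - 1) (i - 1)" using in_block_last[of "i - 1"] that by simp
    from block_U_row[OF this, of u k] show ?thesis using that n_pos[OF that] by simp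
  qed
  have c': "gj_c G (i - Suc 0) = l i * u (i - Suc 0)" if "i > 0" using c[of "i - 1"] that by simp
  note rows = LU_row[OF a] gen_jacobi_row[OF a] block_U_row[OF a] block_U_row[OF in_block_first]
  consider (one) "n (Suc i) = Suc (n i)" "a = n i" | (first) "n (Suc i) = Suc (Suc (n i))" "a = n i"
    | (second) "n (Suc i) = Suc (Suc (n i))" "a = Suc (n i)"
    using in_block_disj[OF a] by metis
  then show "gen_jacobi n G a k = inf_mat_mult (block_L n l e) (block_U n u) a k"
  proof cases
    case first
    show ?thesis unfolding rows by (simp add: first)
  next
    case second
    then have e: "e i = - Polynomial.coeff (gj_p G i) 1" by (intro p1) (simp add: block_size_def)
    show ?thesis
    proof (cases "i > 0")
      case True
      show ?thesis unfolding rows prev[OF True] using e by (simp add: second p0 c' True distrib_left)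
    next
      case False
      then have i: "i = 0" by simp
      show ?thesis unfolding rows using e unfolding i by (simp add: second[unfolded i] p0 distrib_left)
    qed
  next
    case one
    show ?thesis
    proof (cases "i > 0")
      case True
      show ?thesis unfolding rows prev[OF True] by (simp add: one p0 c' True distrib_left)
    next
      case False
      then have i: "i = 0" by simp
      show ?thesis unfolding rows unfolding i by (simp add: one[unfolded i] p0)
    qed
  qed
qed

lemma shift_sums:
  fixes z :: "nat \<Rightarrow> real"
  assumes "summable z"
  shows "(\<lambda>a. case a of 0 \<Rightarrow> 0 | Suc k \<Rightarrow> z k) sums (\<Sum>k. z k)"
  using sums_Suc_iff[of "\<lambda>a. case a of 0 \<Rightarrow> 0 | Suc k \<Rightarrow> z k" "\<Sum>k. z k"] summable_sums[OF assms] by simp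

text \<open>Each \<open>l j\<close> is an entry, hence bounded by the operator norm. Conversely the nonzero entries lie on
  the diagonal and the next two lower diagonals, so that the operator is controlled by the identity
  and two powers of the shift.\<close>

lemma bounded_block_L:
  assumes e: "\<And>j. \<bar>e j\<bar> \<le> 1"
  shows "bounded_in_ell2 (block_L n l e) \<longleftrightarrow> (\<exists>A. \<forall>j>0. \<bar>l j\<bar> \<le> A)"
proof
  assume "bounded_in_ell2 (block_L n l e)"
  then obtain C where "\<forall>x\<in>ell2. (\<forall>i. summable (\<lambda>k. complex_of_real (block_L n l e i k) * x k)) \<and>
     (let y = (\<lambda>i. \<Sum>k. complex_of_real (block_L n l e i k) * x k)
      in y \<in> ell2 \<and> (\<Sum>i. (norm (y i))\<^sup>2) \<le> C * (\<Sum>i. (norm (x i))\<^sup>2))"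
    unfolding bounded_in_ell2_def by blast
  then have C: "\<And>x. x \<in> ell2 \<Longrightarrow> (\<lambda>i. \<Sum>k. complex_of_real (block_L n l e i k) * x k) \<in> ell2"
    "\<And>x. x \<in> ell2 \<Longrightarrow> (\<Sum>i. (norm (\<Sum>k. complex_of_real (block_L n l e i k) * x k))\<^sup>2) \<le> C * (\<Sum>i. (norm (x i))\<^sup>2)"
    by (simp_all add: Let_def)
  have "\<bar>l j\<bar> \<le> sqrt C" if "j > 0" for j
  proof -
    define m where "m = n j - 1"
    define x :: "nat \<Rightarrow> complex" where "x k = (if k = m then 1 else 0)" for k
    have x: "(\<lambda>k. (norm (x k))\<^sup>2) sums 1"
      using sums_single[of m "\<lambda>_. 1 :: real"] by (rule back_subst[where P = "\<lambda>f. f sums 1"]) (auto simp: x_def)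
    then have xe: "x \<in> ell2" by (auto simp: ell2_def sums_iff)
    define y where "y i = (\<Sum>k. complex_of_real (block_L n l e i k) * x k)" for i
    have "y \<in> ell2" using C(1)[OF xe] by (simp add: y_def[abs_def])
    then have sy: "summable (\<lambda>i. (norm (y i))\<^sup>2)" by (simp add: ell2_def)
    have ne: "x (n (Suc j) - 1) = 0" "x (n j) = 0" "x (n j - 1) = 1"
      using n_pos[OF that] n_less[of j "Suc j"] by (auto simp: x_def m_def)
    have "y (n (Suc j) - 1) = of_real (l j)"
      unfolding y_def sums_unique[OF block_L_apply_sums[OF in_block_last[of j], of l e x], symmetric] ne using that by simp
    then have "\<bar>l j\<bar>\<^sup>2 = sum (\<lambda>i. (norm (y i))\<^sup>2) {n (Suc j) - 1}" by simp
    also have "\<dots> \<le> (\<Sum>i. (norm (y i))\<^sup>2)" by (rule sum_le_suminf[OF sy]) auto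
    also have "\<dots> \<le> C" using C(2)[OF xe] sums_unique[OF x] by (simp add: y_def)
    finally show ?thesis by (rule real_le_rsqrt)
  qed
  then show "\<exists>A. \<forall>j>0. \<bar>l j\<bar> \<le> A" by blast
next
  assume "\<exists>A. \<forall>j>0. \<bar>l j\<bar> \<le> A"
  then obtain A where A: "\<And>j. j > 0 \<Longrightarrow> \<bar>l j\<bar> \<le> A" by blast
  show "bounded_in_ell2 (block_L n l e)"
    unfolding bounded_in_ell2_def Let_def
  proof (intro exI[of _ "6 + 6 * A\<^sup>2"] ballI conjI allI)
    fix x assume "x \<in> ell2"
    then have sx: "summable (\<lambda>k. (norm (x k))\<^sup>2)" by (simp add: ell2_def)
    show "summable (\<lambda>k. complex_of_real (block_L n l e i k) * x k)" for i
      using block_L_apply_sums ex_in_block[of i] sums_summable by blast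
    define y where "y i = (\<Sum>k. complex_of_real (block_L n l e i k) * x k)" for i
    define sh :: "(nat \<Rightarrow> real) \<Rightarrow> nat \<Rightarrow> real" where "sh z a = (case a of 0 \<Rightarrow> 0 | Suc k \<Rightarrow> z k)" for z a
    define z where "z k = (norm (x k))\<^sup>2" for k
    have z0: "z k \<ge> 0" for k by (simp add: z_def)
    define S where "S = (\<Sum>k. z k)"
    have 0: "z sums S" using sx by (simp add: S_def z_def[abs_def] summable_sums)
    have sh_sums: "sh f sums T" if "f sums T" for f T
      using shift_sums[OF sums_summable[OF that]] sums_unique[OF that] by (simp add: sh_def[abs_def])
    note 1 = sh_sums[OF 0] and 2 = sh_sums[OF sh_sums[OF 0]]
    have bound: "(norm (y a))\<^sup>2 \<le> 3 * z a + (3 + 3 * A\<^sup>2) * sh z a + (3 * A\<^sup>2) * sh (sh z) a" for a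
    proof -
      obtain i where a: "in_block a i" using ex_in_block by blast
      define p q r where "p = x a" and "q = complex_of_real (if a = Suc (n i) then e i else 0) * x (n i)"
        and "r = complex_of_real (if i > 0 \<and> a = n (Suc i) - 1 then l i else 0) * x (n i - 1)"
      have "y a = p + q + r" unfolding y_def p_def q_def r_def
        using sums_unique[OF block_L_apply_sums[OF a, of l e x]] by simp
      then have "norm (y a) \<le> norm p + norm q + norm r" using norm_triangle_ineq[of "p + q" r] norm_triangle_ineq[of p q] by simp
      then have "(norm (y a))\<^sup>2 \<le> (norm p + norm q + norm r)\<^sup>2" by (rule power_mono) simp
      also have "\<dots> \<le> 3 * ((norm p)\<^sup>2 + (norm q)\<^sup>2 + (norm r)\<^sup>2)"
        using sum_squares_ge_zero[of "norm p - norm q" "norm q - norm r"] zero_le_power2[of "norm p - norm r"]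
        by (simp add: power2_eq_square algebra_simps)
      also have "(norm p)\<^sup>2 = z a" by (simp add: p_def z_def)
      also have "(norm q)\<^sup>2 \<le> sh z a"
      proof (cases "a = Suc (n i)")
        case True
        then have "(norm q)\<^sup>2 = \<bar>e i\<bar>\<^sup>2 * z (n i)" by (simp add: q_def z_def norm_mult power_mult_distrib)
        also have "\<dots> \<le> 1 * z (n i)" using e[of i] z0 by (intro mult_right_mono) (auto simp: abs_square_le_1)
        finally show ?thesis using True by (simp add: sh_def)
      next
        case False
        then show ?thesis using z0 by (auto simp: q_def sh_def split: nat.split)
      qed
      also have "(norm r)\<^sup>2 \<le> A\<^sup>2 * (sh z a + sh (sh z) a)"
      proof (cases "i > 0 \<and> a = n (Suc i) - 1")
        case True
        then have "(norm r)\<^sup>2 = \<bar>l i\<bar>\<^sup>2 * z (n i - 1)" by (simp add: r_def z_def norm_mult power_mult_distrib)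
        also have "\<dots> \<le> A\<^sup>2 * z (n i - 1)" using A[of i] True z0 by (intro mult_right_mono power_mono) auto
        also have "z (n i - 1) \<le> sh z a + sh (sh z) a"
        proof -
          obtain m where m: "n i = Suc m" using n_pos[of i] True by (cases "n i") auto
          have "a = Suc m \<or> a = Suc (Suc m)" using True n_step[of i] m by auto
          then show ?thesis using m z0 by (auto simp: sh_def split: nat.split)
        qed
        finally show ?thesis by (simp add: mult_left_mono)
      next
        case False
        then show ?thesis using z0 by (auto simp: r_def sh_def split: nat.split)
      qed
      finally show ?thesis by (simp add: algebra_simps)
    qed
    have tot: "(\<lambda>a. 3 * z a + (3 + 3 * A\<^sup>2) * sh z a + (3 * A\<^sup>2) * sh (sh z) a) sums (3 * S + (3 + 3 * A\<^sup>2) * S + (3 * A\<^sup>2) * S)"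
      by (intro sums_add sums_mult 0 1 2)
    have sy: "summable (\<lambda>a. (norm (y a))\<^sup>2)"
      by (rule summable_comparison_test[OF _ sums_summable[OF tot]]) (use bound in auto)
    then show "(\<lambda>i. \<Sum>k. complex_of_real (block_L n l e i k) * x k) \<in> ell2" by (simp add: ell2_def y_def)
    have "(\<Sum>a. (norm (y a))\<^sup>2) \<le> 3 * S + (3 + 3 * A\<^sup>2) * S + (3 * A\<^sup>2) * S"
      using suminf_le[OF bound sy sums_summable[OF tot]] sums_unique[OF tot] by simp
    then show "(\<Sum>i. (norm (\<Sum>k. complex_of_real (block_L n l e i k) * x k))\<^sup>2) \<le> (6 + 6 * A\<^sup>2) * (\<Sum>i. (norm (x i))\<^sup>2)"
      by (simp add: y_def S_def z_def algebra_simps)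
  qed
qed

end

section \<open>The common lower factor of both factorizations\<close>

context geronimus_functional
begin

sublocale nn: block_partition nn
  by standard (auto simp: nn_Suc)

text \<open>In a block of size 2 the entry \<open>e j\<close> of both factorizations is \<open>b (nn j)\<close>.\<close>

definition L_factor :: "nat \<Rightarrow> nat \<Rightarrow> real" where "L_factor = block_L nn l (\<lambda>j. b (nn j))"

lemma LU_lower_factor_iff: "LU_lower_factor nn (frakF \<sigma> s) L \<longleftrightarrow> L = L_factor"
proof
  assume "LU_lower_factor nn (frakF \<sigma> s) L"
  then obtain u' l' e' where u': "\<And>j. u' j = u j" and l': "\<And>j. l' (Suc j) = cc j / u' j"
    and e': "\<And>j. block_size nn j = 2 \<Longrightarrow> e' j = - Polynomial.coeff (pp j) 1" and L: "L = block_L nn l' e'"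
    unfolding LU_lower_factor_def gj_P_frakF gj_p_frakF gj_c_frakF u_def by blast
  have "l' (Suc j) = l (Suc j)" for j using l'[of j] u'[of j] u_nonzero[of j] by (simp add: cc_def)
  moreover have "e' j = b (nn j)" if "block_size nn j = 2" for j
    using e'[OF that] pp_coeff_1[OF that] by simp
  ultimately show "L = L_factor" unfolding L L_factor_def by (intro nn.block_L_cong)
next
  assume L: "L = L_factor"
  have p0: "- Polynomial.coeff (pp j) 0 = u j + (if j > 0 then l j else 0)" for j
    by (simp add: pp_def q_def l_def)
  have "gen_jacobi nn (frakF \<sigma> s) = inf_mat_mult (block_L nn l (\<lambda>j. b (nn j))) (block_U nn u)"
    by (rule nn.LU_eq_gen_jacobi) (simp_all only: gj_p_frakF gj_c_frakF p0 cc_def pp_coeff_1 minus_minus)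
  note J = this
  show "LU_lower_factor nn (frakF \<sigma> s) L"
    unfolding LU_lower_factor_def gj_P_frakF gj_c_frakF
  proof (rule exI[of _ u], rule exI[of _ l], rule exI[of _ "\<lambda>j. b (nn j)"], intro conjI allI impI)
    fix j
    show "u j = - poly (V (Suc j)) 0 / poly (V j) 0" by (rule u_def)
    show "l (Suc j) = cc j / u j" by (simp add: cc_def u_nonzero)
    show "block_size nn j = 2 \<Longrightarrow> b (nn j) = - Polynomial.coeff (gj_p (frakF \<sigma> s) j) 1"
      by (simp only: gj_p_frakF pp_coeff_1 minus_minus)
  qed (use J in \<open>simp_all add: L L_factor_def\<close>)
qed

lemma monic_jacobi_entry: "monic_jacobi \<sigma> i j =
    (if j = i then b i else if j = Suc i then 1 else if i = Suc j then c j else 0)"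
  by (simp add: monic_jacobi_def jacobi_coeffs_eq)

lemma P_independent:
  assumes "Polynomial.smult x (P (Suc m)) + Polynomial.smult y (P m) = Polynomial.smult x' (P (Suc m)) + Polynomial.smult y' (P m)"
  shows "x = x'" "y = y'"
proof -
  have "Polynomial.coeff (P m) (Suc m) = 0" by (intro coeff_eq_0) simp
  then show "x = x'" using arg_cong[OF assms, of "\<lambda>p. Polynomial.coeff p (Suc m)"] by simp
  with assms have "Polynomial.smult y (P m) = Polynomial.smult y' (P m)" by simp
  from arg_cong[OF this, of "\<lambda>p. Polynomial.coeff p m"] show "y = y'" by simp
qed

lemma l_in_block_of_size_2: assumes "j > 0" "h (nn j) = 0" shows "l j = c (nn j - 1)"
proof -
  obtain i where "j = Suc i" using assms by (cases j) auto
  then obtain m where m: "nn j = Suc m" "h m \<noteq> 0" using nn_Suc_eq_Suc by blast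
  then show ?thesis using assms h_rec[of m] by (simp add: l_def nn_Suc)
qed

lemma l_in_block_of_size_1: assumes "j > 0" "h (nn j) \<noteq> 0" shows "l j = \<alpha> (nn j)"
  using assms by (simp add: l_def nn_Suc \<alpha>_def)

text \<open>Expand \<open>X_W_Suc\<close>, where \<open>W (j + 1) = P a\<close>, in the \<open>P\<close> and compare coefficients with the
  recurrence of \<open>P\<close>.\<close>

lemma jacobi_entries_at_block_end:
  assumes a: "nn (Suc j) = Suc a"
  shows "h (nn j) \<noteq> 0 \<Longrightarrow> b a = u j + \<alpha> (Suc a)" "h (nn j) \<noteq> 0 \<Longrightarrow> j > 0 \<Longrightarrow> c (a - 1) = u j * l j"
    "h (nn j) = 0 \<Longrightarrow> b a = \<alpha> (Suc a)" "h (nn j) = 0 \<Longrightarrow> c (a - 1) = u j"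
proof -
  have X: "X * P a = Polynomial.smult (u j) (V j) + P (Suc a) + Polynomial.smult (\<alpha> (Suc a)) (P a)"
    using X_W_Suc[of j] a by (simp add: W_def V_def[of "Suc j"] add.assoc)
  show "b a = u j + \<alpha> (Suc a)" if "h (nn j) \<noteq> 0"
  proof (cases a)
    case 0
    then have "j = 0" using a that nn_Suc_pos[of "j - 1"] by (cases j) (auto simp: nn_Suc)
    then have "X * 1 = Polynomial.smult (u j) 1 + P (Suc 0) + Polynomial.smult (\<alpha> (Suc 0)) 1" using X 0 by (simp add: V_def)
    from arg_cong[OF this, of "\<lambda>p. Polynomial.coeff p 0"] show ?thesis using 0 by (simp add: P_1)
  next
    case (Suc m)
    then have j: "j > 0" using a that nn_0 by (metis Suc_inject gr0I nat.distinct(1) nn_Suc)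
    have Vj: "V j = P a + Polynomial.smult (\<alpha> a) (P m)" using j a that Suc by (simp add: V_def nn_Suc)
    have "Polynomial.smult (b a) (P a) + Polynomial.smult (c m) (P m)
       = Polynomial.smult (u j + \<alpha> (Suc a)) (P a) + Polynomial.smult (u j * \<alpha> a) (P m)"
      using X unfolding Vj Suc by (simp add: P_rec smult_add_left smult_add_right algebra_simps)
    then show ?thesis using P_independent Suc by blast
  qed
  show "c (a - 1) = u j * l j" if "h (nn j) \<noteq> 0" "j > 0"
  proof -
    note j0 = that(2)
    have nj: "nn j = a" using a that by (simp add: nn_Suc)
    then obtain m where Suc: "a = Suc m" using nn.n_pos[OF j0] by (cases a) auto
    have Vj: "V j = P a + Polynomial.smult (\<alpha> a) (P m)" using that Suc nj by (simp add: V_def)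
    have "Polynomial.smult (b a) (P a) + Polynomial.smult (c m) (P m)
       = Polynomial.smult (u j + \<alpha> (Suc a)) (P a) + Polynomial.smult (u j * \<alpha> a) (P m)"
      using X unfolding Vj Suc by (simp add: P_rec smult_add_left smult_add_right algebra_simps)
    then have "c m = u j * \<alpha> a" using P_independent Suc by blast
    then show ?thesis using l_in_block_of_size_1[OF that(2,1)] nj Suc by simp
  qed
  assume h0: "h (nn j) = 0"
  then have a': "a = Suc (nn j)" using a by (simp add: nn_Suc)
  have Vj: "V j = P (nn j)" using h0 by (simp add: V_def \<alpha>_def)
  have "Polynomial.smult (b a) (P a) + Polynomial.smult (c (nn j)) (P (nn j))
       = Polynomial.smult (\<alpha> (Suc a)) (P a) + Polynomial.smult (u j) (P (nn j))"
    using X unfolding Vj a' by (simp add: P_rec smult_add_left smult_add_right algebra_simps)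
  from P_independent[OF this[unfolded a']] show "b a = \<alpha> (Suc a)" "c (a - 1) = u j" using a' by auto
qed

lemma monic_jacobi_eq_UL:
  "monic_jacobi \<sigma> = inf_mat_mult (block_U nn u) (block_L nn l (\<lambda>j. b (nn j)))"
proof (intro ext)
  fix a k
  obtain i where a: "nn.in_block a i" using nn.ex_in_block by blast
  show "monic_jacobi \<sigma> a k = inf_mat_mult (block_U nn u) (block_L nn l (\<lambda>j. b (nn j))) a k"
  proof (cases "a = nn (Suc i) - 1")
    case False
    then have a': "a = nn i" "h (nn i) = 0" "nn.in_block (Suc a) i" "Suc a = nn (Suc i) - 1"
      using a by (auto simp: nn.in_block_def nn_Suc split: if_splits)
    have "i > 0 \<Longrightarrow> nn i > 0" by (rule nn.n_pos)
    then show ?thesis unfolding nn.UL_row[OF a] nn.block_L_row[OF a'(3)] monic_jacobi_entry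
      using False a' l_in_block_of_size_2[of i] by (cases "i = 0") auto
  next
    case True
    then have Sa: "nn (Suc i) = Suc a" using nn_Suc_pos[of i] by simp
    have "nn.in_block (Suc a) (Suc i)" using nn.in_block_first[of "Suc i"] Sa by simp
    note row = nn.block_L_row[OF this, of l "\<lambda>j. b (nn j)" k] nn.block_L_row[OF nn.in_block_first[of i], of l "\<lambda>j. b (nn j)" k]
    have next_l: "(if k = a then (if Suc a = nn (Suc (Suc i)) - 1 then l (Suc i) else 0) else 0) = (if k = a then \<alpha> (Suc a) else 0)"
      using l_in_block_of_size_1[of "Suc i"] Sa by (auto simp: nn_Suc[of "Suc i"] \<alpha>_def)
    note D = jacobi_entries_at_block_end[OF Sa]
    have L1: "block_L nn l (\<lambda>j. b (nn j)) (Suc a) k = (if k = Suc a then 1 else 0) + (if k = a then \<alpha> (Suc a) else 0)"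
      unfolding row(1) using next_l Sa by auto
    show ?thesis
    proof (cases "h (nn i) = 0")
      case h0: True
      then have na: "a = Suc (nn i)" using Sa by (simp add: nn_Suc)
      then have "nn i \<noteq> nn (Suc i) - 1" using Sa by simp
      then have L2: "block_L nn l (\<lambda>j. b (nn j)) (nn i) k = (if k = nn i then 1 else 0)" unfolding row(2) by simp
      have bc: "b (Suc (nn i)) = \<alpha> (Suc a)" "c (nn i) = u i" using D(3,4)[OF h0] na by simp_all
      show ?thesis unfolding nn.UL_row[OF a] L1 L2 monic_jacobi_entry if_P[OF True]
        using bc by (auto simp: na)
    next
      case h1: False
      then have na: "a = nn i" using Sa by (simp add: nn_Suc)
      have L2: "block_L nn l (\<lambda>j. b (nn j)) (nn i) k = (if k = nn i then 1 else 0) + (if k = nn i - 1 then (if i > 0 then l i else 0) else 0)"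
        unfolding row(2) using Sa na by simp
      have "i > 0 \<Longrightarrow> nn i > 0" by (rule nn.n_pos)
      then show ?thesis unfolding nn.UL_row[OF a] L1 L2 monic_jacobi_entry
        using True h1 na D(1,2) by (cases "i = 0") (auto simp: algebra_simps)
    qed
  qed
qed

text \<open>The condition on the \<open>l j\<close> leaves only the \<open>e j\<close> open, and these are diagonal entries of \<open>U L\<close>.\<close>

lemma UL_lower_factor_iff: "UL_lower_factor nn \<sigma> s L \<longleftrightarrow> L = L_factor"
proof
  assume "UL_lower_factor nn \<sigma> s L"
  then obtain u' l' e' where l': "\<And>j. j \<ge> 1 \<Longrightarrow> l' j = - h (nn (Suc j) - 1) / h (nn j - 1)"
    and L: "L = block_L nn l' e'" and J: "monic_jacobi \<sigma> = inf_mat_mult (block_U nn u') L"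
    unfolding UL_lower_factor_def h_P_hat by blast
  have "l' (Suc j) = l (Suc j)" for j using l'[of "Suc j"] by (simp add: l_def)
  moreover have "e' j = b (nn j)" if "block_size nn j = 2" for j
  proof -
    have S: "nn (Suc j) = Suc (Suc (nn j))" using that by (simp add: block_size_nn nn_Suc split: if_splits)
    then have "nn.in_block (Suc (nn j)) j" by (simp add: nn.in_block_def)
    note row = nn.block_L_row[OF this, of l' e' "nn j"]
    have "b (nn j) = monic_jacobi \<sigma> (nn j) (nn j)" by (simp add: monic_jacobi_entry)
    also have "\<dots> = block_L nn l' e' (Suc (nn j)) (nn j)"
      unfolding J L nn.UL_row[OF nn.in_block_first] using S by simp
    also have "\<dots> = e' j" unfolding row using nn.n_pos[of j] by (cases "j = 0") auto
    finally show ?thesis by simp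
  qed
  ultimately show "L = L_factor" unfolding L L_factor_def by (intro nn.block_L_cong)
next
  assume L: "L = L_factor"
  show "UL_lower_factor nn \<sigma> s L" unfolding UL_lower_factor_def h_P_hat
    by (rule exI[of _ u], rule exI[of _ l], rule exI[of _ "\<lambda>j. b (nn j)"])
       (use L monic_jacobi_eq_UL in \<open>auto simp: l_def L_factor_def\<close>)
qed

text \<open>For a block of size 1, \<open>l j = \<alpha> (nn j)\<close>; for a block of size 2, \<open>\<alpha> (nn j) = 0\<close> while \<open>l j\<close> is a
  coefficient \<open>c\<close>, which is at most 1.\<close>

lemma bounded_L_factor: "bounded_in_ell2 L_factor \<longleftrightarrow> (\<exists>A. \<forall>j>0. \<bar>\<alpha> (nn j)\<bar> \<le> A)"
proof -
  have "bounded_in_ell2 L_factor \<longleftrightarrow> (\<exists>A. \<forall>j>0. \<bar>l j\<bar> \<le> A)"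
    unfolding L_factor_def by (rule nn.bounded_block_L) (rule abs_b_le)
  also have "\<dots> \<longleftrightarrow> (\<exists>A. \<forall>j>0. \<bar>\<alpha> (nn j)\<bar> \<le> A)"
  proof
    assume "\<exists>A. \<forall>j>0. \<bar>l j\<bar> \<le> A"
    then obtain A where A: "\<And>j. j > 0 \<Longrightarrow> \<bar>l j\<bar> \<le> A" by blast
    have "\<bar>\<alpha> (nn j)\<bar> \<le> max A 0" if "j > 0" for j
      using A[OF that] l_in_block_of_size_1[OF that] by (cases "h (nn j) = 0") (auto simp: \<alpha>_def)
    then show "\<exists>A. \<forall>j>0. \<bar>\<alpha> (nn j)\<bar> \<le> A" by blast
  next
    assume "\<exists>A. \<forall>j>0. \<bar>\<alpha> (nn j)\<bar> \<le> A"
    then obtain A where A: "\<And>j. j > 0 \<Longrightarrow> \<bar>\<alpha> (nn j)\<bar> \<le> A" by blast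
    have "\<bar>l j\<bar> \<le> max A 1" if "j > 0" for j
      using A[OF that] l_in_block_of_size_1[OF that] l_in_block_of_size_2[OF that] c_le_1[of "nn j - 1"] c_pos[of "nn j - 1"]
      by (cases "h (nn j) = 0") (auto simp: abs_of_pos)
    then show "\<exists>A. \<forall>j>0. \<bar>l j\<bar> \<le> A" by blast
  qed
  finally show ?thesis .
qed

end

section \<open>Uniqueness of Pade approximants\<close>

text \<open>The reversal \<open>x ^ n * p (1 / x)\<close> with respect to a formal degree \<open>n\<close>; it passes between the variables
  \<open>z\<close> and \<open>1 / z\<close>.\<close>

definition reflect :: "nat \<Rightarrow> 'a :: comm_semiring_1 poly \<Rightarrow> 'a poly" where
  "reflect n p = (\<Sum>i\<le>n. Polynomial.monom (Polynomial.coeff p i) (n - i))"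

lemma degree_reflect: "Polynomial.degree (reflect n p) \<le> n"
  unfolding reflect_def by (intro degree_sum_le order_trans[OF degree_monom_le]) auto

lemma poly_reflect_0: "poly (reflect n p) 0 = Polynomial.coeff p n"
proof -
  have "poly (reflect n p) 0 = (\<Sum>i\<le>n. if i = n then Polynomial.coeff p n else 0)"
    unfolding reflect_def poly_sum by (intro sum.cong) (auto simp: poly_monom power_0_left)
  then show ?thesis by simp
qed

lemma coeff_reflect: "i \<le> n \<Longrightarrow> Polynomial.coeff (reflect n p) i = Polynomial.coeff p (n - i)"
proof -
  assume i: "i \<le> n"
  have "Polynomial.coeff (reflect n p) i = (\<Sum>k\<le>n. if k = n - i then Polynomial.coeff p (n - i) else 0)"
    unfolding reflect_def coeff_sum by (intro sum.cong) (use i in auto)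
  then show ?thesis by simp
qed

lemma poly_reflect:
  fixes p :: "'a :: field poly"
  assumes "Polynomial.degree p \<le> n" "x \<noteq> 0"
  shows "poly (reflect n p) x = x ^ n * poly p (1 / x)"
proof -
  have "poly p (1 / x) = (\<Sum>i\<le>Polynomial.degree p. Polynomial.coeff p i * (1 / x) ^ i)" by (rule poly_altdef)
  also have "\<dots> = (\<Sum>i\<le>n. Polynomial.coeff p i * (1 / x) ^ i)"
    using assms(1) by (intro sum.mono_neutral_left) (auto simp: coeff_eq_0)
  finally have "x ^ n * poly p (1 / x) = (\<Sum>i\<le>n. Polynomial.coeff p i * (x ^ n * (1 / x) ^ i))"
    by (simp add: sum_distrib_left mult.left_commute)
  also have "\<dots> = poly (reflect n p) x"
    unfolding reflect_def poly_sum poly_monom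
  proof (intro sum.cong refl)
    fix i assume "i \<in> {..n}"
    then have "x ^ n = x ^ (n - i) * x ^ i" by (simp flip: power_add)
    then show "Polynomial.coeff p i * (x ^ n * (1 / x) ^ i) = Polynomial.coeff p i * x ^ (n - i)"
      using assms(2) by (simp add: power_divide)
  qed
  finally show ?thesis by simp
qed

lemma coprime_complex_polyI:
  fixes A B :: "complex poly"
  assumes "B \<noteq> 0" "\<And>x. poly A x = 0 \<Longrightarrow> poly B x = 0 \<Longrightarrow> False"
  shows "coprime A B"
proof (rule coprimeI)
  fix c assume c: "c dvd A" "c dvd B"
  have "c \<noteq> 0" using c(2) assms(1) dvd_0_left by metis
  have "Polynomial.degree c = 0"
  proof (rule ccontr)
    assume "Polynomial.degree c \<noteq> 0"
    then obtain x where "poly c x = 0" using alg_closed_imp_poly_has_root[of c] by auto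
    then have "poly A x = 0" "poly B x = 0" using c by (elim dvdE, simp)+
    then show False by (rule assms(2))
  qed
  then show "is_unit c" unfolding is_unit_iff_degree[OF \<open>c \<noteq> 0\<close>] .
qed

text \<open>The linear factors of \<open>B\<close> are cancelled one by one: a root of \<open>B\<close> is not a root of \<open>A\<close>, hence it
  is a root of \<open>C\<close>.\<close>

lemma coprime_complex_poly_dvd:
  fixes A B C :: "complex poly"
  assumes "coprime A B" "B \<noteq> 0" "B dvd A * C"
  shows "B dvd C"
  using assms
proof (induction "Polynomial.degree B" arbitrary: B C rule: less_induct)
  case less
  show ?case
  proof (cases "Polynomial.degree B = 0")
    case True
    then have "is_unit B" unfolding is_unit_iff_degree[OF less.prems(2)] .
    then show ?thesis by (rule unit_imp_dvd)
  next
    case False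
    then obtain x where "poly B x = 0" using alg_closed_imp_poly_has_root[of B] by auto
    then have xB: "[:-x, 1:] dvd B" by (simp only: poly_eq_0_iff_dvd)
    then obtain B1 where B1: "B = [:-x, 1:] * B1" by (rule dvdE)
    have "\<not> is_unit [:-x, 1:]" by (subst is_unit_iff_degree) simp_all
    then have "\<not> [:-x, 1:] dvd A" using coprime_common_divisor[OF less.prems(1) _ xB] by blast
    then have "poly A x \<noteq> 0" by (simp only: poly_eq_0_iff_dvd not_False_eq_True)
    moreover have "poly (A * C) x = 0"
      using dvd_trans[OF xB less.prems(3)] by (simp only: poly_eq_0_iff_dvd)
    ultimately have "poly C x = 0" by simp
    then have "[:-x, 1:] dvd C" by (simp only: poly_eq_0_iff_dvd)
    then obtain C1 where C1: "C = [:-x, 1:] * C1" by (rule dvdE)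
    have "B1 \<noteq> 0" using less.prems(2) B1 by auto
    have "[:-x, 1:] * B1 dvd [:-x, 1:] * (A * C1)"
      using less.prems(3) unfolding B1 C1 by (simp only: mult.left_commute)
    then have d: "B1 dvd A * C1" by (subst (asm) dvd_mult_cancel_left) simp
    have "coprime A B1"
    proof (rule coprimeI)
      fix c assume c: "c dvd A" "c dvd B1"
      then have "c dvd B" unfolding B1 by (intro dvd_mult)
      with less.prems(1) c(1) show "is_unit c" by (rule coprime_common_divisor)
    qed
    moreover have "Polynomial.degree B1 < Polynomial.degree B"
      unfolding B1 using \<open>B1 \<noteq> 0\<close> by (subst degree_mult_eq) simp_all
    ultimately have "B1 dvd C1" using less.hyps \<open>B1 \<noteq> 0\<close> d by blast
    then show ?thesis unfolding B1 C1 by (intro mult_dvd_mono dvd_refl)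
  qed
qed

lemma ratio_map_smult: "k \<noteq> 0 \<Longrightarrow> ratio_map (Polynomial.smult k A) (Polynomial.smult k B) = ratio_map A B"
proof
  fix z assume "k \<noteq> 0"
  then show "ratio_map (Polynomial.smult k A) (Polynomial.smult k B) z = ratio_map A B z"
    by (cases z) auto
qed

text \<open>The difference \<open>A * B' - A' * B\<close>, taken at \<open>1 / z\<close>, is of order \<open>z\<close> to the power \<open>- 2 * n - 1\<close>,
  although its degree is at most \<open>2 * n\<close>. So its reversal is a polynomial that tends to 0.\<close>

lemma pade_cross_equation:
  assumes "is_pade s n n A B" "is_pade s n n A' B'"
  shows "A * B' = A' * B"
proof -
  define D where "D = A * B' - A' * B"
  define f where "f A B z = (\<Sum>j<n + n. complex_of_real (s j) / z ^ (j + 1)) + poly A (1 / z) / poly B (1 / z)"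
    for A B :: "complex poly" and z
  have deg: "Polynomial.degree D \<le> 2 * n" unfolding D_def using assms
    by (intro degree_diff_le order_trans[OF degree_mult_le]) (auto simp: is_pade_def)
  have lim: "((\<lambda>z. poly B (1 / z)) \<longlongrightarrow> poly B 0) at_infinity" for B :: "complex poly"
  proof -
    have "((\<lambda>z :: complex. 1 / z) \<longlongrightarrow> 0) at_infinity"
      by (rule tendsto_divide_0[OF tendsto_const filterlim_ident])
    from tendsto_poly[OF this, of B] show ?thesis .
  qed
  have O: "f A B \<in> O[at_infinity](\<lambda>z. 1 / z ^ (2 * n + 1))" "f A' B' \<in> O[at_infinity](\<lambda>z. 1 / z ^ (2 * n + 1))"
    using assms by (simp_all add: is_pade_def f_def[abs_def] mult_2)
  have "(\<lambda>z. (f A B z - f A' B' z) * (poly B (1 / z) * poly B' (1 / z))) \<in> O[at_infinity](\<lambda>z. 1 / z ^ (2 * n + 1) * 1)"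
  proof (rule landau_o.big.mult)
    show "(\<lambda>z. f A B z - f A' B' z) \<in> O[at_infinity](\<lambda>z. 1 / z ^ (2 * n + 1))"
      using O by (rule sum_in_bigo)
    show "(\<lambda>z. poly B (1 / z) * poly B' (1 / z)) \<in> O[at_infinity](\<lambda>_. 1)"
      using tendsto_mult[OF lim[of B] lim[of B']] by (intro bigoI_tendsto[where c = "poly B 0 * poly B' 0"]) auto
  qed
  moreover have "\<forall>\<^sub>F z in at_infinity. (f A B z - f A' B' z) * (poly B (1 / z) * poly B' (1 / z)) = poly D (1 / z)"
  proof -
    have "poly B 0 \<noteq> 0" "poly B' 0 \<noteq> 0" using assms by (auto simp: is_pade_def)
    from tendsto_imp_eventually_ne[OF lim this(1)] tendsto_imp_eventually_ne[OF lim this(2)]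
    show ?thesis
    proof eventually_elim
      case (elim z)
      have "f A B z - f A' B' z = poly A (1 / z) / poly B (1 / z) - poly A' (1 / z) / poly B' (1 / z)"
        unfolding f_def by simp
      moreover have "(a / b - a' / b') * (b * b') = a * b' - a' * b" if "b \<noteq> 0" "b' \<noteq> 0" for a b a' b' :: complex
        using that by (simp add: field_simps)
      ultimately show ?case using elim by (simp add: D_def)
    qed
  qed
  ultimately have D: "(\<lambda>z. poly D (1 / z)) \<in> O[at_infinity](\<lambda>z. 1 / z ^ (2 * n + 1))"
    using landau_o.big.in_cong by force
  have "((\<lambda>z. z ^ (2 * n) * poly D (1 / z)) \<longlongrightarrow> 0) at_infinity"
  proof -
    have "(\<lambda>z. z ^ (2 * n) * poly D (1 / z)) \<in> O[at_infinity](\<lambda>z. z ^ (2 * n) * (1 / z ^ (2 * n + 1)))"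
      by (rule landau_o.big.mult_left[OF D])
    also have "(\<lambda>z :: complex. z ^ (2 * n) * (1 / z ^ (2 * n + 1))) \<in> \<Theta>[at_infinity](\<lambda>z. inverse z)"
      by (intro bigthetaI_cong) (use eventually_not_equal_at_infinity[of 0] in \<open>eventually_elim, simp add: field_simps\<close>)
    finally obtain C where "\<forall>\<^sub>F z in at_infinity. norm (z ^ (2 * n) * poly D (1 / z)) \<le> C * norm (inverse z)"
      by (elim landau_o.bigE)
    then show ?thesis
      by (intro tendsto_0_le[OF tendsto_inverse_0, where K = C]) (simp add: mult.commute)
  qed
  then have "(poly (reflect (2 * n) D) \<longlongrightarrow> 0) at_infinity"
  proof (rule Lim_transform_eventually)
    show "\<forall>\<^sub>F z in at_infinity. z ^ (2 * n) * poly D (1 / z) = poly (reflect (2 * n) D) z"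
      using eventually_not_equal_at_infinity[of 0] by eventually_elim (simp add: poly_reflect[OF deg])
  qed
  then have r0: "reflect (2 * n) D = 0" by (intro poly_tendsto_0_sector tendsto_sector)
  have "D = 0"
  proof (rule poly_eqI)
    fix i
    show "Polynomial.coeff D i = Polynomial.coeff 0 i"
      using coeff_reflect[of "2 * n - i" "2 * n" D] r0 deg by (cases "i \<le> 2 * n") (auto simp: coeff_eq_0)
  qed
  then show ?thesis by (simp add: D_def)
qed

lemma pade_eq:
  assumes P: "is_pade s n n A B" and cop: "coprime A B"
  shows "pade s n n = (\<lambda>z. ratio_map A B (sphere_recip z))"
  unfolding pade_def
proof (rule the_equality)
  show "\<exists>A' B'. is_pade s n n A' B' \<and> coprime A' B' \<and>
      (\<lambda>z. ratio_map A B (sphere_recip z)) = (\<lambda>z. ratio_map A' B' (sphere_recip z))"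
    using assms by blast
  fix f assume "\<exists>A' B'. is_pade s n n A' B' \<and> coprime A' B' \<and> f = (\<lambda>z. ratio_map A' B' (sphere_recip z))"
  then obtain A' B' where P': "is_pade s n n A' B'" and cop': "coprime A' B'"
    and f: "f = (\<lambda>z. ratio_map A' B' (sphere_recip z))" by blast
  have eq: "A * B' = A' * B" by (rule pade_cross_equation[OF P P'])
  have B: "B \<noteq> 0" "B' \<noteq> 0" using P P' by (auto simp: is_pade_def)
  have "B dvd A * B'" unfolding eq by simp
  then have 1: "B dvd B'" by (rule coprime_complex_poly_dvd[OF cop B(1)])
  have "B' dvd A' * B" unfolding eq[symmetric] by simp
  then have 2: "B' dvd B" by (rule coprime_complex_poly_dvd[OF cop' B(2)])
  from 1 obtain c where c: "B' = B * c" by (auto simp: dvd_def)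
  then have "c \<noteq> 0" using B by auto
  have "Polynomial.degree B = Polynomial.degree B'" using dvd_imp_degree_le[OF 1] dvd_imp_degree_le[OF 2] B by simp
  then have "Polynomial.degree c = 0" using c B \<open>c \<noteq> 0\<close> by (simp add: degree_mult_eq)
  then obtain k where k: "c = [:k:]" by (rule degree_eq_zeroE)
  then have "k \<noteq> 0" using \<open>c \<noteq> 0\<close> by auto
  have B': "B' = Polynomial.smult k B" using c k by simp
  then have "B * A' = B * Polynomial.smult k A" using eq by (simp add: mult.commute)
  then have A': "A' = Polynomial.smult k A" using B(1) mult_cancel_left[of B A' "Polynomial.smult k A"] by blast
  show "f = (\<lambda>z. ratio_map A B (sphere_recip z))" unfolding f A' B' ratio_map_smult[OF \<open>k \<noteq> 0\<close>] ..
qed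

section \<open>The diagonal approximants at the normal indices\<close>

context geronimus_functional
begin

text \<open>The combination of the polynomials \<^const>\<open>P_hat\<close> that corresponds to \<open>V j\<close>. It vanishes at 0, and the
  quotient \<open>QQ j\<close> by the variable is the polynomial of the second kind of \<open>V j\<close> for \<open>S\<close>.\<close>

definition M :: "nat \<Rightarrow> real poly" where
  "M j = Q (nn j) + Polynomial.smult (\<alpha> (nn j)) (Q (nn j - 1)) + Polynomial.smult s (V j)"

definition QQ :: "nat \<Rightarrow> real poly" where "QQ j = synthetic_div (M j) 0"

lemma degree_Q: "Polynomial.degree (Q n) \<le> n"
proof (induction n rule: Q.induct)
  case (3 n)
  have "Polynomial.degree ([:- b (Suc n), 1:] * Q (Suc n)) \<le> Suc (Suc n)"
    using 3 by (intro order_trans[OF degree_mult_le]) simp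
  then show ?case unfolding Q.simps using 3 by (intro degree_diff_le) (auto intro: order_trans[OF degree_smult_le])
qed auto

lemma moment_eq: "moment \<sigma> k = I (X ^ k)"
  by (simp add: moment_def I_def poly_power)

lemma frakF_partial_sum:
  assumes z: "z \<notin> unit_segment" "z \<noteq> 0"
  shows "frakF \<sigma> s z + (\<Sum>i<Suc k. complex_of_real (frak_s \<sigma> s i) / z ^ (i + 1)) = E (X ^ k) z / z ^ Suc k"
proof -
  define T where "T = (\<Sum>i<k. complex_of_real (I (X ^ i)) / z ^ Suc i)"
  have e1: "(\<Sum>i<Suc k. complex_of_real (frak_s \<sigma> s i) / z ^ (i + 1)) = of_real s / z + T / z"
    unfolding T_def sum.lessThan_Suc_shift by (simp add: frak_s_def moment_eq sum_divide_distrib field_simps)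
  have e2: "E (X ^ k) z = z ^ k * (stieltjes \<sigma> z + T)"
    using E_X_power[OF z, of k 1] unfolding T_def by (simp add: E_1)
  show ?thesis unfolding e1 e2 frakF_def using z(2) by (simp add: field_simps)
qed

lemma z_E_tendsto: "((\<lambda>z. z * E p z) \<longlongrightarrow> - of_real (I p)) at_infinity"
proof -
  have "((\<lambda>z. E (X * p) z - of_real (I p)) \<longlongrightarrow> 0 - of_real (I p)) at_infinity"
    by (intro tendsto_intros E_tendsto_0)
  then have "((\<lambda>z. E (X * p) z - of_real (I p)) \<longlongrightarrow> - of_real (I p)) at_infinity" by simp
  then show ?thesis
  proof (rule Lim_transform_eventually)
    show "\<forall>\<^sub>F z in at_infinity. E (X * p) z - of_real (I p) = z * E p z"
      using eventually_cmod_gt[of 1] by eventually_elim (simp only: E_X[OF not_unit_segment], simp)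
  qed
qed

context
  fixes j m :: nat
  assumes j: "j > 0" and m: "nn j = Suc m"
begin

lemma h_pred_nonzero: "h m \<noteq> 0" using h_nn[of "j - 1"] j m by simp

lemma Vj: "V j = P (Suc m) + Polynomial.smult (\<alpha> (Suc m)) (P m)" using j m by (simp add: V_def)

lemma degree_V: "Polynomial.degree (V j) = Suc m" "Polynomial.coeff (V j) (Suc m) = 1"
proof -
  have "Polynomial.degree (Polynomial.smult (\<alpha> (Suc m)) (P m)) < Suc m"
    by (rule le_less_trans[OF degree_smult_le]) simp
  then show "Polynomial.degree (V j) = Suc m" unfolding Vj by (subst degree_add_eq_left) simp_all
  show "Polynomial.coeff (V j) (Suc m) = 1" unfolding Vj by (simp add: coeff_eq_0)
qed

lemma M_eq: "M j = X * QQ j"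
proof -
  have "poly (M j) 0 = h (Suc m) + \<alpha> (Suc m) * h m"
    by (simp add: M_def m Vj h_eq algebra_simps)
  then have "poly (M j) 0 = 0" using h_pred_nonzero by (simp add: \<alpha>_def)
  then show ?thesis using synthetic_div_correct'[of 0 "M j"] by (simp add: QQ_def)
qed

lemma degree_QQ: "Polynomial.degree (QQ j) \<le> m"
proof -
  have "Polynomial.degree (M j) \<le> Suc m"
    unfolding M_def m using degree_Q[of "Suc m"] degree_Q[of m] degree_V(1)
    by (intro degree_add_le order_trans[OF degree_smult_le]) auto
  then show ?thesis by (simp add: QQ_def degree_synthetic_div)
qed

lemma frakF_V_QQ:
  assumes z: "z \<notin> unit_segment" "z \<noteq> 0"
  shows "frakF \<sigma> s z * poly (cpoly (V j)) z + poly (cpoly (QQ j)) z = E (V j) z / z"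
proof -
  have "z * poly (cpoly (QQ j)) z = poly (cpoly (M j)) z"
    unfolding M_eq by (simp add: cpoly_mult)
  also have "\<dots> = poly (cpoly (Q (Suc m))) z + of_real (\<alpha> (Suc m)) * poly (cpoly (Q m)) z + of_real s * poly (cpoly (V j)) z"
    by (simp add: M_def m cpoly_add cpoly_smult)
  moreover have "z * frakF \<sigma> s z = stieltjes \<sigma> z - of_real s" using z(2) by (simp add: frakF_def field_simps)
  moreover have "E (V j) z = poly (cpoly (V j)) z * stieltjes \<sigma> z + poly (cpoly (Q (Suc m))) z + of_real (\<alpha> (Suc m)) * poly (cpoly (Q m)) z"
    using E_V[OF z(1), of j] E_P[OF z(1), of "Suc m"] E_P[OF z(1), of m] j m
    by (simp add: Vj cpoly_add cpoly_smult algebra_simps)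
  ultimately have "z * (frakF \<sigma> s z * poly (cpoly (V j)) z + poly (cpoly (QQ j)) z) = E (V j) z"
    by (simp add: distrib_left mult.assoc[symmetric]) (simp add: algebra_simps)
  then show ?thesis using z(2) by (simp add: field_simps)
qed

text \<open>A common zero would make the two rows of the Wronskian of \<open>P\<close> and \<open>Q\<close> proportional.\<close>

lemma V_QQ_no_common_root: "poly (cpoly (V j)) z = 0 \<Longrightarrow> poly (cpoly (QQ j)) z = 0 \<Longrightarrow> False"
proof -
  assume V0: "poly (cpoly (V j)) z = 0" and Q0: "poly (cpoly (QQ j)) z = 0"
  let ?a = "complex_of_real (\<alpha> (Suc m))"
  have "poly (cpoly (M j)) z = 0" unfolding M_eq using Q0 by (simp add: cpoly_mult)
  then have q: "poly (cpoly (Q (Suc m))) z = - ?a * poly (cpoly (Q m)) z" using V0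
    by (simp add: M_def m cpoly_add cpoly_smult eq_neg_iff_add_eq_0)
  have p: "poly (cpoly (P (Suc m))) z = - ?a * poly (cpoly (P m)) z" using V0
    by (simp add: Vj cpoly_add cpoly_smult eq_neg_iff_add_eq_0)
  have "poly (cpoly (P m * Q (Suc m) - P (Suc m) * Q m)) z = of_real (N m)" unfolding wronskian by simp
  then show False by (simp add: cpoly_diff cpoly_mult p q)
qed

definition num :: "complex poly" where "num = - reflect (Suc m) (cpoly (QQ j))"
definition den :: "complex poly" where "den = reflect (Suc m) (cpoly (V j))"

lemma poly_num: "x \<noteq> 0 \<Longrightarrow> poly num x = - (x ^ Suc m * poly (cpoly (QQ j)) (1 / x))"
  using degree_QQ unfolding num_def by (simp add: poly_reflect)
lemma poly_den: "x \<noteq> 0 \<Longrightarrow> poly den x = x ^ Suc m * poly (cpoly (V j)) (1 / x)"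
  using degree_V unfolding den_def by (simp add: poly_reflect)
lemma num_0: "poly num 0 = 0"
  using degree_QQ unfolding num_def by (simp add: poly_reflect_0 coeff_eq_0)
lemma den_0: "poly den 0 = 1"
  using degree_V unfolding den_def by (simp add: poly_reflect_0 coeff_map_poly)

lemma coprime_num_den: "coprime num den"
proof (rule coprime_complex_polyI)
  show "den \<noteq> 0" using den_0 by auto
  fix x assume x: "poly num x = 0" "poly den x = 0"
  then have "x \<noteq> 0" using den_0 by auto
  then show False using x V_QQ_no_common_root[of "1 / x"] by (simp add: poly_num poly_den)
qed

text \<open>The partial sum differs from the function by a term of order \<open>z\<close> to the power \<open>- 2 * m - 3\<close>
  (\<open>frakF_partial_sum\<close>), and so does the quotient (\<open>frakF_V_QQ\<close>): the transform of \<open>V j\<close> is of the order of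
  \<open>z\<close> to the power \<open>- m - 1\<close>, and \<open>V j\<close> has degree \<open>m + 1\<close>.\<close>

lemma is_pade_num_den: "is_pade (frak_s \<sigma> s) (Suc m) (Suc m) num den"
  unfolding is_pade_def
proof (intro conjI)
  show "Polynomial.degree num \<le> Suc m" "Polynomial.degree den \<le> Suc m"
    unfolding num_def den_def using degree_reflect by simp_all
  show "poly den 0 \<noteq> 0" using den_0 by simp
  let ?f = "\<lambda>z. (\<Sum>i<Suc m + Suc m. complex_of_real (frak_s \<sigma> s i) / z ^ (i + 1)) + poly num (1 / z) / poly den (1 / z)"
  let ?k = "2 * m + 1"
  have "((\<lambda>z. poly (cpoly (V j)) z / z ^ Suc m) \<longlongrightarrow> 1) at_infinity"
    using poly_divide_tendsto_aux[of "cpoly (V j)"] degree_V by (simp add: coeff_map_poly)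
  moreover have "((\<lambda>z. z ^ Suc m * E (P (Suc m)) z + of_real (\<alpha> (Suc m)) * (z ^ Suc m * E (P m) z))
      \<longlongrightarrow> 0 + of_real (\<alpha> (Suc m)) * (- of_real (N m))) at_infinity"
    by (intro tendsto_intros E_P_null E_P_asymptotic)
  ultimately have "((\<lambda>z. z * E (X ^ ?k) z - (z ^ Suc m * E (P (Suc m)) z + of_real (\<alpha> (Suc m)) * (z ^ Suc m * E (P m) z)) /
      (poly (cpoly (V j)) z / z ^ Suc m)) \<longlongrightarrow>
      - of_real (I (X ^ ?k)) - (0 + of_real (\<alpha> (Suc m)) * (- of_real (N m))) / 1) at_infinity"
    by (intro tendsto_diff tendsto_divide z_E_tendsto) auto
  then have "((\<lambda>z. ?f z / (1 / z ^ (Suc m + Suc m + 1))) \<longlongrightarrow>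
      - of_real (I (X ^ ?k)) - (0 + of_real (\<alpha> (Suc m)) * (- of_real (N m))) / 1) at_infinity"
  proof (rule Lim_transform_eventually)
    have "cpoly (V j) \<noteq> 0" using degree_V by (metis Zero_not_Suc degree_0 degree_cpoly)
    then have "finite {z. poly (cpoly (V j)) z = 0}" by (rule poly_roots_finite)
    then have ev: "\<forall>\<^sub>F z in at_infinity. poly (cpoly (V j)) z \<noteq> 0"
    proof -
      assume "finite {z. poly (cpoly (V j)) z = 0}"
      then have "bounded {z. poly (cpoly (V j)) z = 0}" by (rule finite_imp_bounded)
      then obtain B where "\<And>z. poly (cpoly (V j)) z = 0 \<Longrightarrow> cmod z \<le> B" by (auto simp: bounded_iff)
      then show ?thesis using eventually_cmod_gt[of B] by (auto elim!: eventually_mono) (metis not_less)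
    qed
    show "\<forall>\<^sub>F z in at_infinity. z * E (X ^ ?k) z - (z ^ Suc m * E (P (Suc m)) z + of_real (\<alpha> (Suc m)) * (z ^ Suc m * E (P m) z)) /
      (poly (cpoly (V j)) z / z ^ Suc m) = ?f z / (1 / z ^ (Suc m + Suc m + 1))"
      using eventually_cmod_gt[of 1] ev
    proof eventually_elim
      case (elim z)
      then have z: "z \<noteq> 0" "z \<notin> unit_segment" using not_unit_segment by auto
      let ?V = "poly (cpoly (V j)) z" and ?Q = "poly (cpoly (QQ j)) z"
      have 1: "(\<Sum>i<Suc m + Suc m. complex_of_real (frak_s \<sigma> s i) / z ^ (i + 1)) = E (X ^ ?k) z / z ^ Suc ?k - frakF \<sigma> s z"
      proof -
        have k: "Suc ?k = Suc m + Suc m" by simp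
        show ?thesis using frakF_partial_sum[OF z(2,1), of ?k] unfolding k eq_diff_eq by (subst add.commute)
      qed
      have 2: "poly num (1 / z) / poly den (1 / z) = - ?Q / ?V"
        using z elim by (simp add: poly_num poly_den)
      have Qz: "?Q = E (V j) z / z - frakF \<sigma> s z * ?V" using frakF_V_QQ[OF z(2,1)] by (simp add: algebra_simps)
      have q: "- ?Q / ?V = frakF \<sigma> s z - E (V j) z / (z * ?V)"
        unfolding Qz using elim(2) z(1) by (simp add: field_simps)
      have 3: "?f z = E (X ^ ?k) z / z ^ Suc ?k - E (V j) z / (z * ?V)"
        unfolding 1 2 q by simp
      have 4: "E (V j) z = E (P (Suc m)) z + of_real (\<alpha> (Suc m)) * E (P m) z"
        using E_V[OF z(2), of j] j m by simp
      have 5: "z ^ Suc ?k = z ^ Suc m * z ^ Suc m" "z ^ (Suc m + Suc m + 1) = z * (z ^ Suc m * z ^ Suc m)"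
        by (simp_all flip: power_Suc power_add add: mult_2)
      have alg: "(a / (w * w) - e / (z * v)) / (1 / (z * (w * w))) = z * a - (w * e) / (v / w)"
        if "w \<noteq> 0" "v \<noteq> 0" for a w e v :: complex
        using that z(1) by (simp add: field_simps)
      have "?f z / (1 / z ^ (Suc m + Suc m + 1)) = z * E (X ^ ?k) z - (z ^ Suc m * E (V j) z) / (?V / z ^ Suc m)"
        unfolding 3 5 using elim(2) z(1) by (intro alg) auto
      then show ?case unfolding 4 by (simp only: distrib_left mult.left_commute)
    qed
  qed
  then show "?f \<in> O[at_infinity](\<lambda>z. 1 / z ^ (Suc m + Suc m + 1))"
    by (rule bigoI_tendsto) (use eventually_not_equal_at_infinity[of 0] in \<open>eventually_elim, simp\<close>)
qed

lemma pade_value: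
  "pade (frak_s \<sigma> s) (nn j) (nn j) None = Some 0"
  "z \<noteq> 0 \<Longrightarrow> pade (frak_s \<sigma> s) (nn j) (nn j) (Some z) =
     (if poly (cpoly (V j)) z = 0 then None else Some (- poly (cpoly (QQ j)) z / poly (cpoly (V j)) z))"
  unfolding m pade_eq[OF is_pade_num_den coprime_num_den]
  by (simp_all add: num_0 den_0 poly_num poly_den)

end

end

section \<open>Growth of orthogonal polynomials off the interval\<close>

context unit_interval_measure
begin

lemma N_nonneg: "0 \<le> N n" using N_pos[of n] by linarith

text \<open>The value of \<open>P n\<close> at a complex point.\<close>

definition Pz :: "nat \<Rightarrow> complex \<Rightarrow> complex" where "Pz n z = poly (cpoly (P n)) z"

lemma Pz_0: "Pz 0 z = 1" by (simp add: Pz_def cpoly_1)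
lemma Pz_1: "Pz (Suc 0) z = z - of_real (b 0)" by (simp add: Pz_def P_1)
lemma Pz_rec: "Pz (Suc (Suc n)) z = (z - of_real (b (Suc n))) * Pz (Suc n) z - of_real (c n) * Pz n z"
  by (simp add: Pz_def P_rec cpoly_diff cpoly_smult cpoly_mult cpoly_add algebra_simps)

text \<open>The quotient \<open>Pz (n + 1) z / Pz n z\<close> stays within distance 2 of \<open>z\<close>, because \<open>\<bar>b\<bar> \<le> 1\<close>, \<open>0 < c \<le> 1\<close> and
  the reciprocal of the preceding quotient is at most 1 in modulus.\<close>

lemma Pz_growth:
  assumes "cmod z \<ge> 3"
  shows "cmod (Pz (Suc n) z - z * Pz n z) \<le> 2 * cmod (Pz n z) \<and> cmod (Pz n z) \<ge> 1"
proof (induction n)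
  case 0
  show ?case using abs_b_le[of 0] by (simp add: Pz_0 Pz_1)
next
  case (Suc n)
  have "cmod (z * Pz n z) - cmod (Pz (Suc n) z) \<le> cmod (Pz (Suc n) z - z * Pz n z)"
    using norm_triangle_ineq2[of "z * Pz n z" "Pz (Suc n) z"] by (simp add: norm_minus_commute)
  moreover have "3 * cmod (Pz n z) \<le> cmod (z * Pz n z)" unfolding norm_mult using assms by (intro mult_right_mono) auto
  ultimately have ge: "cmod (Pz n z) \<le> cmod (Pz (Suc n) z)" using Suc by linarith
  have "Pz (Suc (Suc n)) z - z * Pz (Suc n) z = - (of_real (b (Suc n)) * Pz (Suc n) z + of_real (c n) * Pz n z)"
    by (simp add: Pz_rec algebra_simps)
  then have "cmod (Pz (Suc (Suc n)) z - z * Pz (Suc n) z) \<le> \<bar>b (Suc n)\<bar> * cmod (Pz (Suc n) z) + c n * cmod (Pz n z)"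
    using norm_triangle_ineq[of "of_real (b (Suc n)) * Pz (Suc n) z" "of_real (c n) * Pz n z"] c_pos[of n]
    by (simp only: norm_minus_cancel norm_mult norm_of_real abs_of_pos)
  also have "\<dots> \<le> 1 * cmod (Pz (Suc n) z) + 1 * cmod (Pz n z)"
    by (intro add_mono mult_right_mono abs_b_le c_le_1) auto
  finally show ?case using ge Suc by linarith
qed

lemma Pz_Suc_ge:
  assumes "cmod z \<ge> 3"
  shows "cmod (Pz (Suc n) z) \<ge> (cmod z - 2) * cmod (Pz n z)"
  using Pz_growth[OF assms, of n] norm_triangle_ineq2[of "z * Pz n z" "Pz (Suc n) z"]
  by (simp add: norm_mult norm_minus_commute left_diff_distrib)

lemma Pz_ge_power:
  assumes "cmod z \<ge> 4"
  shows "cmod (Pz n z) \<ge> 2 ^ n"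
proof (induction n)
  case (Suc n)
  have "2 * 2 ^ n \<le> (cmod z - 2) * cmod (Pz n z)" using assms Suc by (intro mult_mono) auto
  also have "\<dots> \<le> cmod (Pz (Suc n) z)" using assms by (intro Pz_Suc_ge) auto
  finally show ?case by simp
qed (simp add: Pz_0)

definition J :: "complex \<Rightarrow> nat \<Rightarrow> real" where "J z n = (\<Sum>k<n. (cmod (Pz k z))\<^sup>2 / N k)"

lemma J_Suc: "J z (Suc n) = J z n + (cmod (Pz n z))\<^sup>2 / N n"
  by (simp add: J_def)

text \<open>The Christoffel-Darboux formula at the points \<open>z\<close> and \<open>cnj z\<close>.\<close>

lemma christoffel_darboux: "Im (Pz (Suc n) z * cnj (Pz n z)) = N n * Im z * J z (Suc n)"
proof (induction n)
  case 0
  show ?case by (simp add: J_def Pz_0 Pz_1)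
next
  case (Suc n)
  have "Pz (Suc (Suc n)) z * cnj (Pz (Suc n) z)
     = (z - of_real (b (Suc n))) * of_real ((cmod (Pz (Suc n) z))\<^sup>2) - of_real (c n) * cnj (Pz (Suc n) z * cnj (Pz n z))"
    unfolding complex_norm_square by (simp add: Pz_rec algebra_simps)
  note rec = this
  have Im_eq: "Im ((z - of_real \<beta>) * of_real \<rho> - of_real \<gamma> * cnj v) = Im z * \<rho> + \<gamma> * Im v" for \<beta> \<rho> \<gamma> v
    by simp
  have "Im (Pz (Suc (Suc n)) z * cnj (Pz (Suc n) z))
      = Im z * (cmod (Pz (Suc n) z))\<^sup>2 + c n * Im (Pz (Suc n) z * cnj (Pz n z))"
    unfolding rec by (rule Im_eq)
  also have "\<dots> = Im z * (cmod (Pz (Suc n) z))\<^sup>2 + N (Suc n) * Im z * J z (Suc n)"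
    unfolding Suc.IH N_Suc by simp
  also have "\<dots> = N (Suc n) * Im z * (J z (Suc n) + (cmod (Pz (Suc n) z))\<^sup>2 / N (Suc n))"
    by (simp add: distrib_left)
  also have "J z (Suc n) + (cmod (Pz (Suc n) z))\<^sup>2 / N (Suc n) = J z (Suc (Suc n))"
    by (rule J_Suc[symmetric])
  finally show ?case .
qed

lemma J_nonneg: "J z n \<ge> 0"
  unfolding J_def by (intro sum_nonneg divide_nonneg_pos) auto

text \<open>Adding a real multiple of \<open>\<bar>Pz n z\<bar>\<^sup>2\<close> leaves the imaginary part in the Christoffel-Darboux formula
  unchanged, so the bound is uniform in \<open>a\<close>.\<close>

lemma pencil_lower:
  assumes "0 \<le> y" "y \<le> \<bar>Im z\<bar>"
  shows "N n * y * J z (Suc n) \<le> cmod (Pz (Suc n) z + of_real a * Pz n z) * cmod (Pz n z)"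
proof -
  have "N n * y * J z (Suc n) \<le> N n * \<bar>Im z\<bar> * J z (Suc n)"
    using assms N_pos[of n] N_nonneg[of n] by (intro mult_right_mono mult_left_mono J_nonneg) auto
  also have "\<dots> = \<bar>Im (Pz (Suc n) z * cnj (Pz n z))\<bar>"
    unfolding christoffel_darboux using N_pos[of n] N_nonneg[of n] J_nonneg[of z "Suc n"] by (simp add: abs_mult)
  also have "Im (Pz (Suc n) z * cnj (Pz n z)) = Im ((Pz (Suc n) z + of_real a * Pz n z) * cnj (Pz n z))"
    by (simp add: algebra_simps)
  also have "\<bar>\<dots>\<bar> \<le> cmod ((Pz (Suc n) z + of_real a * Pz n z) * cnj (Pz n z))" by (rule abs_Im_le_cmod)
  finally show ?thesis by (simp add: norm_mult)
qed

text \<open>The sum \<open>J\<close> grows geometrically, because the formula makes its next term at least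
  \<open>y\<^sup>2\<close> times the sum so far.\<close>

lemma J_growth:
  assumes "0 \<le> y" "y \<le> \<bar>Im z\<bar>"
  shows "(1 + y\<^sup>2) ^ n / N 0 \<le> J z (Suc n)"
proof (induction n)
  case 0
  show ?case by (simp add: J_def Pz_0)
next
  case (Suc n)
  let ?p = "cmod (Pz n z)" and ?q = "cmod (Pz (Suc n) z)"
  have 1: "N n * y * J z (Suc n) \<le> ?q * ?p" using pencil_lower[OF assms, of n 0] by simp
  have "?p\<^sup>2 / N n \<le> J z (Suc n)" using J_nonneg[of z n] by (simp add: J_def)
  then have "?p\<^sup>2 \<le> N n * J z (Suc n)" using N_pos[of n] N_nonneg[of n] by (simp add: field_simps)
  then have "y * ?p\<^sup>2 \<le> y * (N n * J z (Suc n))" using assms(1) by (rule mult_left_mono)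
  then have "y * ?p * ?p \<le> N n * y * J z (Suc n)" by (simp add: power2_eq_square mult_ac)
  then have "y * ?p * ?p \<le> ?q * ?p" using 1 by (rule order_trans)
  then have pq: "y * ?p \<le> ?q" by (cases "?p = 0") (auto simp: mult_le_cancel_right)
  have "N (Suc n) * (y\<^sup>2 * J z (Suc n)) \<le> N n * (y\<^sup>2 * J z (Suc n))"
    by (intro mult_right_mono N_Suc_le mult_nonneg_nonneg J_nonneg) auto
  also have "\<dots> = y * (N n * y * J z (Suc n))" by (simp add: power2_eq_square algebra_simps)
  also have "\<dots> \<le> y * (?q * ?p)" using 1 assms by (intro mult_left_mono) auto
  also have "\<dots> = ?q * (y * ?p)" by simp
  also have "\<dots> \<le> ?q * ?q" using pq by (intro mult_left_mono) auto
  finally have "y\<^sup>2 * J z (Suc n) \<le> ?q\<^sup>2 / N (Suc n)" using N_pos[of "Suc n"] N_nonneg[of "Suc n"]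
    by (simp add: power2_eq_square field_simps)
  then have "(1 + y\<^sup>2) * J z (Suc n) \<le> J z (Suc (Suc n))" unfolding J_Suc[of z "Suc n"] distrib_right by simp
  moreover have "(1 + y\<^sup>2) * ((1 + y\<^sup>2) ^ n / N 0) \<le> (1 + y\<^sup>2) * J z (Suc n)"
    using Suc by (intro mult_left_mono) auto
  ultimately show ?case by simp
qed

lemma E_pencil_le:
  assumes "d > 0" "\<And>t. t \<in> {-1..1} \<Longrightarrow> d \<le> cmod (of_real t - z)" "\<bar>a\<bar> \<le> A"
  shows "cmod (E (P (Suc n)) z + of_real a * E (P n) z) \<le> sqrt (N 0 * N n) * (1 + A) / d"
proof -
  have "cmod (E (P (Suc n)) z + of_real a * E (P n) z) \<le> cmod (E (P (Suc n)) z) + \<bar>a\<bar> * cmod (E (P n) z)"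
    by (rule order_trans[OF norm_triangle_ineq]) (simp add: norm_mult)
  also have "\<dots> \<le> sqrt (N 0 * N n) / d + A * (sqrt (N 0 * N n) / d)"
  proof (intro add_mono mult_mono)
    have "cmod (E (P (Suc n)) z) \<le> sqrt (N 0 * N (Suc n)) / d" by (rule norm_E_P_le[OF assms(1,2)])
    also have "\<dots> \<le> sqrt (N 0 * N n) / d"
      using assms(1) N_Suc_le[of n] N_pos[of 0] N_nonneg[of 0] by (intro divide_right_mono real_sqrt_le_mono mult_left_mono) auto
    finally show "cmod (E (P (Suc n)) z) \<le> sqrt (N 0 * N n) / d" .
    show "cmod (E (P n) z) \<le> sqrt (N 0 * N n) / d" by (rule norm_E_P_le[OF assms(1,2)])
  qed (use assms(3) in auto)
  finally show ?thesis by (simp add: algebra_simps add_divide_distrib)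
qed

text \<open>The Cauchy-Schwarz bound for the numerator contains \<open>sqrt (N n)\<close>; \<open>pencil_lower\<close> bounds the
  denominator from below by \<open>y * sqrt (N n * J z (n + 1))\<close>.\<close>

lemma ratio_bound_nonreal:
  assumes y: "0 < y" "y \<le> \<bar>Im z\<bar>" and a: "\<bar>a\<bar> \<le> A"
  shows "Pz (Suc n) z + of_real a * Pz n z \<noteq> 0"
    "cmod ((E (P (Suc n)) z + of_real a * E (P n) z) / (Pz (Suc n) z + of_real a * Pz n z))
      \<le> N 0 * (1 + A) / y\<^sup>2 / sqrt ((1 + y\<^sup>2) ^ n)"
proof -
  let ?V = "Pz (Suc n) z + of_real a * Pz n z" and ?J = "J z (Suc n)" and ?p = "cmod (Pz n z)"
  have Jg: "(1 + y\<^sup>2) ^ n / N 0 \<le> ?J" using y by (intro J_growth) auto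
  have pos: "(1 + y\<^sup>2) ^ n / N 0 > 0" by (intro divide_pos_pos zero_less_power add_pos_nonneg) auto
  then have J0: "?J > 0" using Jg by linarith
  have low: "N n * y * ?J \<le> cmod ?V * ?p" using y by (intro pencil_lower) auto
  have "?p\<^sup>2 / N n \<le> ?J" using J_nonneg[of z n] by (simp add: J_def)
  then have "?p\<^sup>2 \<le> N n * ?J" by (simp add: field_simps)
  then have p: "?p \<le> sqrt (N n * ?J)" by (rule real_le_rsqrt)
  define r where "r = sqrt (N n * ?J)"
  have "N n * ?J > 0" using J0 by simp
  then have r: "r > 0" "r * r = N n * ?J" by (simp_all add: r_def abs_of_pos del: abs_mult)
  have "y * (r * r) \<le> cmod ?V * ?p" using low r by (simp add: mult.commute mult.left_commute)
  also have "\<dots> \<le> cmod ?V * r" using p by (intro mult_left_mono) (auto simp: r_def)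
  finally have "y * r * r \<le> cmod ?V * r" by (simp add: mult.assoc)
  then have V: "y * r \<le> cmod ?V" using r(1) by simp
  have "y * r > 0" using y r by simp
  with V show "?V \<noteq> 0" by auto
  have "y \<le> cmod (of_real t - z)" for t using abs_Im_le_cmod[of "of_real t - z"] y by simp
  then have "cmod (E (P (Suc n)) z + of_real a * E (P n) z) \<le> sqrt (N 0 * N n) * (1 + A) / y"
    using y a by (intro E_pencil_le) auto
  then have "cmod ((E (P (Suc n)) z + of_real a * E (P n) z) / ?V) \<le> (sqrt (N 0 * N n) * (1 + A) / y) / (y * r)"
    unfolding norm_divide using V \<open>y * r > 0\<close> a y N_pos[of 0] N_nonneg[of 0] N_pos[of n] N_nonneg[of n] by (intro frac_le) auto
  also have "\<dots> = sqrt (N 0) * (1 + A) / y\<^sup>2 / sqrt ?J"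
    using N_pos[of n] N_nonneg[of n] y J0 by (simp add: r_def real_sqrt_mult power2_eq_square field_simps)
  also have "\<dots> \<le> sqrt (N 0) * (1 + A) / y\<^sup>2 / sqrt ((1 + y\<^sup>2) ^ n / N 0)"
    using Jg pos a y N_pos[of 0] N_nonneg[of 0] by (intro divide_left_mono real_sqrt_le_mono) auto
  also have "\<dots> = N 0 * (1 + A) / y\<^sup>2 / sqrt ((1 + y\<^sup>2) ^ n)"
    using N_pos[of 0] N_nonneg[of 0] real_sqrt_mult_self[of "N 0"] by (simp add: real_sqrt_divide field_simps)
  finally show "cmod ((E (P (Suc n)) z + of_real a * E (P n) z) / ?V) \<le> N 0 * (1 + A) / y\<^sup>2 / sqrt ((1 + y\<^sup>2) ^ n)" .
qed

lemma ratio_bound_far: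
  assumes z: "cmod z \<ge> A + 4" and a: "\<bar>a\<bar> \<le> A"
  shows "Pz (Suc n) z + of_real a * Pz n z \<noteq> 0"
    "cmod ((E (P (Suc n)) z + of_real a * E (P n) z) / (Pz (Suc n) z + of_real a * Pz n z)) \<le> N 0 * (1 + A) / 2 ^ n"
proof -
  let ?V = "Pz (Suc n) z + of_real a * Pz n z" and ?p = "cmod (Pz n z)"
  have A: "A \<ge> 0" using a by linarith
  have p: "?p \<ge> 2 ^ n" using z A by (intro Pz_ge_power) auto
  have "(2 + A) * ?p \<le> (cmod z - 2) * ?p" using z by (intro mult_right_mono) auto
  also have "\<dots> \<le> cmod (Pz (Suc n) z)" using z A by (intro Pz_Suc_ge) auto
  also have "\<dots> \<le> cmod ?V + \<bar>a\<bar> * ?p"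
    using norm_triangle_ineq4[of ?V "of_real a * Pz n z"] by (simp add: norm_mult)
  also have "\<bar>a\<bar> * ?p \<le> A * ?p" using a by (intro mult_right_mono) auto
  finally have "cmod ?V \<ge> 2 * ?p" by (simp add: algebra_simps)
  then have V: "cmod ?V \<ge> 2 ^ n" using p norm_ge_zero[of "Pz n z"] by linarith
  moreover have "(2 :: real) ^ n > 0" by simp
  ultimately show "?V \<noteq> 0" by (metis norm_zero not_le)
  have "sqrt (N 0 * N n) \<le> sqrt (N 0 * N 0)"
    using N_antimono[of 0 n] N_pos[of 0] N_nonneg[of 0] by (intro real_sqrt_le_mono mult_left_mono) auto
  then have N: "sqrt (N 0 * N n) \<le> N 0" using N_pos[of 0] N_nonneg[of 0] by simp
  have "cmod (E (P (Suc n)) z + of_real a * E (P n) z) \<le> sqrt (N 0 * N n) * (1 + A) / 1"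
    using z A a by (intro E_pencil_le) (use dist_unit_segment[of _ z] in fastforce)+
  also have "\<dots> \<le> N 0 * (1 + A)" using N A by (simp add: mult_right_mono)
  finally show "cmod ((E (P (Suc n)) z + of_real a * E (P n) z) / ?V) \<le> N 0 * (1 + A) / 2 ^ n"
    unfolding norm_divide using V A N_pos[of 0] N_nonneg[of 0] by (intro frac_le) auto
qed

text \<open>The quotient \<open>P (n + 1) / P n + a\<close> differs from \<open>x + a\<close> by at most 2 for \<open>\<bar>x\<bar> \<ge> 3\<close>, and therefore changes
  sign between \<open>x0\<close> and \<open>\<bar>a\<bar> + 2\<close>, or between their negatives.\<close>

lemma real_root_far:
  assumes x0: "x0 \<ge> 3" and a: "\<bar>a\<bar> \<ge> x0 + 2"
  shows "\<exists>x. \<bar>x\<bar> \<ge> x0 \<and> poly (P (Suc n)) x + a * poly (P n) x = 0"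
proof -
  have Pr: "Pz n (of_real x) = of_real (poly (P n) x)" for n x by (simp add: Pz_def poly_cpoly_of_real)
  define f where "f x = poly (P (Suc n)) x / poly (P n) x + a" for x
  have nz: "poly (P n) x \<noteq> 0" and near: "\<bar>f x - (x + a)\<bar> \<le> 2" if "\<bar>x\<bar> \<ge> 3" for x
  proof -
    have e: "Pz (Suc n) (of_real x) - of_real x * Pz n (of_real x) = of_real (poly (P (Suc n)) x - x * poly (P n) x)"
      by (simp add: Pr)
    have "cmod (of_real x) \<ge> 3" using that by simp
    note g = Pz_growth[OF this, of n, unfolded e, unfolded Pr norm_of_real]
    then have g1: "\<bar>poly (P (Suc n)) x - x * poly (P n) x\<bar> \<le> 2 * \<bar>poly (P n) x\<bar>" by (rule conjunct1)
    show nz: "poly (P n) x \<noteq> 0" using conjunct2[OF g] by auto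
    have "f x - (x + a) = (poly (P (Suc n)) x - x * poly (P n) x) / poly (P n) x" using nz by (simp add: f_def diff_divide_distrib)
    then have "\<bar>f x - (x + a)\<bar> = \<bar>poly (P (Suc n)) x - x * poly (P n) x\<bar> / \<bar>poly (P n) x\<bar>" by (simp add: abs_divide)
    also have "\<dots> \<le> 2"
    proof -
      have "\<bar>poly (P n) x\<bar> > 0" using nz by simp
      then show ?thesis using g1 by (simp only: pos_divide_le_eq)
    qed
    finally show "\<bar>f x - (x + a)\<bar> \<le> 2" .
  qed
  have cont: "continuous_on S f" if "\<And>x. x \<in> S \<Longrightarrow> \<bar>x\<bar> \<ge> 3" for S
    unfolding f_def using that nz by (intro continuous_intros) auto
  have "\<exists>x. \<bar>x\<bar> \<ge> x0 \<and> f x = 0"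
  proof (cases "a \<ge> 0")
    case True
    then have a': "a \<ge> x0 + 2" using a by simp
    have "f (- (a + 2)) \<le> 0" using near[of "- (a + 2)"] a' x0 by linarith
    moreover have "f (- x0) \<ge> 0" using near[of "- x0"] a' x0 by linarith
    moreover have "- (a + 2) \<le> - x0" using a' by simp
    moreover have "continuous_on {- (a + 2)..- x0} f" using x0 by (intro cont) auto
    ultimately obtain x where "- (a + 2) \<le> x" "x \<le> - x0" "f x = 0" using IVT'[of f "- (a + 2)" 0 "- x0"] by blast
    then show ?thesis by (intro exI[of _ x]) linarith
  next
    case False
    then have a': "a \<le> - (x0 + 2)" using a by simp
    have "f x0 \<le> 0" using near[of x0] a' x0 by linarith
    moreover have "f (2 - a) \<ge> 0" using near[of "2 - a"] a' x0 by linarith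
    moreover have "x0 \<le> 2 - a" using a' by simp
    moreover have "continuous_on {x0..2 - a} f" using x0 by (intro cont) auto
    ultimately obtain x where "x0 \<le> x" "x \<le> 2 - a" "f x = 0" using IVT'[of f x0 0 "2 - a"] by blast
    then show ?thesis by (intro exI[of _ x]) linarith
  qed
  then obtain x where x: "\<bar>x\<bar> \<ge> x0" "f x = 0" by blast
  then have "poly (P n) x \<noteq> 0" using nz x0 by simp
  moreover from x(2) have "poly (P (Suc n)) x / poly (P n) x = - a" unfolding f_def by linarith
  ultimately have "poly (P (Suc n)) x + a * poly (P n) x = 0" by (simp add: divide_eq_eq)
  with x(1) show ?thesis by blast
qed

end

section \<open>The chordal metric\<close>

lemma chordal_Some_le: "chordal (Some a) (Some b) \<le> 2 * cmod (a - b)"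
proof -
  have "1 * 1 \<le> sqrt (1 + (cmod a)\<^sup>2) * sqrt (1 + (cmod b)\<^sup>2)" by (intro mult_mono) auto
  then have "2 * cmod (a - b) / (sqrt (1 + (cmod a)\<^sup>2) * sqrt (1 + (cmod b)\<^sup>2)) \<le> 2 * cmod (a - b) / 1"
    by (intro divide_left_mono) auto
  then show ?thesis by simp
qed

lemma chordal_ball_finite:
  assumes "\<delta> > 0"
  shows "\<exists>r>0. \<forall>w. chordal (Some x) w < r \<longrightarrow> (\<exists>v. w = Some v \<and> cmod (x - v) < \<delta>)"
proof -
  define M where "M = sqrt (1 + (cmod x)\<^sup>2)"
  have M: "M \<ge> 1" by (simp add: M_def)
  define r where "r = min (1 / M) (\<delta> / (M * (1 + cmod x)))"
  have x1: "1 + cmod x > 0" by (intro add_pos_nonneg) auto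
  have "r > 0" using M assms x1 by (simp add: r_def)
  moreover have "\<exists>v. w = Some v \<and> cmod (x - v) < \<delta>" if w: "chordal (Some x) w < r" for w
  proof (cases w)
    case None
    then have "2 / M < 1 / M" using w by (simp add: M_def r_def)
    then show ?thesis using M by (simp add: divide_less_cancel)
  next
    case (Some v)
    define d where "d = cmod (x - v)"
    have "sqrt (1 + (cmod v)\<^sup>2) \<le> 1 + cmod v" by (rule real_le_lsqrt) (auto simp: power2_eq_square algebra_simps)
    also have "cmod v \<le> cmod x + d" using norm_triangle_sub[of v x] by (simp add: d_def norm_minus_commute)
    finally have s: "sqrt (1 + (cmod v)\<^sup>2) \<le> 1 + cmod x + d" by simp
    have vpos: "sqrt (1 + (cmod v)\<^sup>2) > 0" by (simp add: add_pos_nonneg)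
    have "2 * d / (M * sqrt (1 + (cmod v)\<^sup>2)) < r" using w Some by (simp add: M_def d_def)
    then have "2 * d < r * (M * sqrt (1 + (cmod v)\<^sup>2))" using M vpos by (simp add: field_simps)
    also have "\<dots> \<le> r * (M * (1 + cmod x + d))" using s M \<open>r > 0\<close> by (intro mult_left_mono) auto
    also have "\<dots> = r * M * (1 + cmod x) + r * M * d" by (simp add: algebra_simps)
    also have "r * M * d \<le> 1 * d"
    proof (intro mult_right_mono)
      have "r * M \<le> 1 / M * M" using M by (intro mult_right_mono) (auto simp: r_def)
      then show "r * M \<le> 1" using M by simp
    qed (simp add: d_def)
    also have "r * M * (1 + cmod x) \<le> \<delta>"
    proof -
      have "r * (M * (1 + cmod x)) \<le> \<delta> / (M * (1 + cmod x)) * (M * (1 + cmod x))"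
        using M x1 by (intro mult_right_mono) (auto simp: r_def)
      then show ?thesis using M x1 by (simp add: mult.assoc)
    qed
    finally have "d < \<delta>" by simp
    then show ?thesis using Some by (simp add: d_def)
  qed
  ultimately show ?thesis by blast
qed

lemma chordal_ball_infinity:
  assumes "\<rho> > 0"
  shows "\<exists>r>0. \<forall>v. chordal None (Some v) < r \<longrightarrow> \<rho> < cmod v"
proof (intro exI[of _ "2 / sqrt (1 + \<rho>\<^sup>2)"] conjI allI impI)
  show "2 / sqrt (1 + \<rho>\<^sup>2) > 0" by (simp add: add_pos_nonneg)
  fix v assume "chordal None (Some v) < 2 / sqrt (1 + \<rho>\<^sup>2)"
  then have "sqrt (1 + \<rho>\<^sup>2) < sqrt (1 + (cmod v)\<^sup>2)"
    by (simp add: field_simps add_pos_nonneg)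
  then have "\<rho>\<^sup>2 < (cmod v)\<^sup>2" by simp
  then show "\<rho> < cmod v" by (rule power_less_imp_less_base) simp
qed

lemma chordal_infinity_lt:
  assumes "r > 0"
  shows "\<exists>\<rho>>0. \<forall>v. cmod v \<ge> \<rho> \<longrightarrow> chordal None (Some v) < r"
proof (intro exI[of _ "2 / r"] conjI allI impI)
  show "2 / r > 0" using assms by simp
  fix v assume v: "2 / r \<le> cmod v"
  have "cmod v < sqrt (1 + (cmod v)\<^sup>2)" by (rule real_less_rsqrt) simp
  then have "2 / r < sqrt (1 + (cmod v)\<^sup>2)" using v by linarith
  then show "chordal None (Some v) < r" using assms
    by (simp add: field_simps add_pos_nonneg)
qed

context geronimus_functional
begin

lemma pade_error:
  assumes j: "j > 0" and m: "nn j = Suc m" and w: "w \<noteq> 0" "w \<notin> unit_segment"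
    and V: "Pz (Suc m) w + of_real (\<alpha> (Suc m)) * Pz m w \<noteq> 0"
    and B: "cmod ((E (P (Suc m)) w + of_real (\<alpha> (Suc m)) * E (P m) w) / (Pz (Suc m) w + of_real (\<alpha> (Suc m)) * Pz m w)) \<le> B"
  shows "chordal (pade (frak_s \<sigma> s) (nn j) (nn j) (Some w)) (frakF_sphere \<sigma> s (Some w)) \<le> 2 * (B / cmod w)"
proof -
  let ?V = "poly (cpoly (V j)) w" and ?Q = "poly (cpoly (QQ j)) w"
  have Vw: "?V = Pz (Suc m) w + of_real (\<alpha> (Suc m)) * Pz m w"
    by (simp add: Vj[OF j m] Pz_def cpoly_add cpoly_smult)
  have Ew: "E (V j) w = E (P (Suc m)) w + of_real (\<alpha> (Suc m)) * E (P m) w" using E_V[OF w(2), of j] j m by simp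
  have V0: "?V \<noteq> 0" using V Vw by simp
  have "- ?Q / ?V - frakF \<sigma> s w = - (E (V j) w / w / ?V)"
    using frakF_V_QQ[OF j m w(2,1)] V0 by (simp add: field_simps)
  then have "cmod (- ?Q / ?V - frakF \<sigma> s w) = cmod (E (V j) w / ?V) / cmod w"
    by (simp add: norm_divide norm_mult)
  also have "\<dots> \<le> B / cmod w" using B unfolding Ew Vw by (intro divide_right_mono) auto
  finally have "cmod (- ?Q / ?V - frakF \<sigma> s w) \<le> B / cmod w" .
  moreover have "chordal (pade (frak_s \<sigma> s) (nn j) (nn j) (Some w)) (frakF_sphere \<sigma> s (Some w))
      \<le> 2 * cmod (- ?Q / ?V - frakF \<sigma> s w)"
    unfolding pade_value(2)[OF j m w(1)] if_not_P[OF V0] frakF_sphere_def option.case by (rule chordal_Some_le)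
  ultimately show ?thesis by linarith
qed

lemma nn_ge: "j \<le> nn j"
  using strict_mono_imp_increasing[OF nn_strict_mono] by blast

lemma nn_pred_at_top: "filterlim (\<lambda>j. nn j - 1) at_top sequentially"
proof (rule filterlim_at_top_mono[OF filterlim_minus_const_nat_at_top[of 1]])
  show "\<forall>\<^sub>F j in sequentially. j - 1 \<le> nn j - 1"
    by (intro always_eventually allI diff_le_mono nn_ge)
qed

end

section \<open>Convergence of the approximants\<close>

lemma loc_unif_convI:
  assumes "\<And>z. z \<in> S \<Longrightarrow> \<exists>r>0. \<exists>e. e \<longlonglongrightarrow> 0 \<and>
    (\<forall>j>0. \<forall>w\<in>S. chordal z w < r \<longrightarrow> chordal (f j w) (g w) \<le> e j)"
  shows "loc_unif_conv S f g"
  unfolding loc_unif_conv_def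
proof
  fix z assume "z \<in> S"
  from assms[OF this] obtain r e where r: "r > 0" and e: "e \<longlonglongrightarrow> 0"
    and le: "\<And>j w. j > 0 \<Longrightarrow> w \<in> S \<Longrightarrow> chordal z w < r \<Longrightarrow> chordal (f j w) (g w) \<le> e j" by blast
  have "\<forall>\<^sub>F j in sequentially. \<forall>w\<in>S. chordal z w < r \<longrightarrow> chordal (f j w) (g w) < \<eta>" if "\<eta> > 0" for \<eta>
    using order_tendstoD(2)[OF e that] eventually_gt_at_top[of 0]
    by eventually_elim (use le le_less_trans in blast)
  with r show "\<exists>r>0. \<forall>\<eta>>0. \<forall>\<^sub>F j in sequentially. \<forall>w\<in>S. chordal z w < r \<longrightarrow> chordal (f j w) (g w) < \<eta>" by blast
qed

context geronimus_functional
begin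

text \<open>Nonreal points have a neighbourhood where the imaginary part stays away from 0; all other points
  outside the slit, including infinity, have one where \<open>\<bar>w\<bar> \<ge> A + 4\<close>. This is how the length of the slit
  is chosen.\<close>

lemma bounded_imp_convergent:
  assumes A: "\<And>j. j > 0 \<Longrightarrow> \<bar>\<alpha> (nn j)\<bar> \<le> A"
  shows "loc_unif_conv (slit_sphere (A + 3)) (\<lambda>j. pade (frak_s \<sigma> s) (nn j) (nn j)) (frakF_sphere \<sigma> s)"
proof (rule loc_unif_convI)
  have A0: "A \<ge> 0" using A[of 1] by simp
  let ?p = "\<lambda>j. pade (frak_s \<sigma> s) (nn j) (nn j)" and ?F = "frakF_sphere \<sigma> s" and ?S = "slit_sphere (A + 3)"
  have ex_m: "\<exists>m. nn j = Suc m \<and> \<bar>\<alpha> (Suc m)\<bar> \<le> A" if "j > 0" for j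
    using nn_ge[of j] A[OF that] that by (cases "nn j") auto
  define e where "e j = 2 * (N 0 * (1 + A) / 2 ^ (nn j - 1))" for j
  have far: "chordal (?p j (Some w)) (?F (Some w)) \<le> e j" if "j > 0" "cmod w \<ge> A + 4" for j w
  proof -
    obtain m where m: "nn j = Suc m" and a: "\<bar>\<alpha> (Suc m)\<bar> \<le> A" using ex_m[OF \<open>j > 0\<close>] by blast
    have w: "w \<noteq> 0" "w \<notin> unit_segment" using that(2) A0 not_unit_segment[of w] by auto
    have "chordal (?p j (Some w)) (?F (Some w)) \<le> 2 * (N 0 * (1 + A) / 2 ^ m / cmod w)"
      by (rule pade_error[OF \<open>j > 0\<close> m w ratio_bound_far[OF that(2) a]])
    also have "N 0 * (1 + A) / 2 ^ m / cmod w \<le> N 0 * (1 + A) / 2 ^ m / 1"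
      using that(2) A0 N_nonneg[of 0] by (intro divide_left_mono) auto
    finally show ?thesis using m by (simp add: e_def)
  qed
  have e_lim: "e \<longlonglongrightarrow> 0"
  proof -
    have "(\<lambda>k. 2 * (N 0 * (1 + A)) * (1 / 2) ^ k) \<longlonglongrightarrow> 2 * (N 0 * (1 + A)) * 0"
      by (intro tendsto_intros LIMSEQ_power_zero) simp
    from filterlim_compose[OF this nn_pred_at_top] show ?thesis by (simp add: e_def[abs_def] power_divide)
  qed
  have e_nonneg: "e j \<ge> 0" for j using A0 N_nonneg[of 0] by (simp add: e_def)
  fix z assume z: "z \<in> ?S"
  consider (infinity) "z = None" | (real) x where "z = Some x" "Im x = 0" | (nonreal) x where "z = Some x" "Im x \<noteq> 0"
    by (cases z) auto
  then show "\<exists>r>0. \<exists>e. e \<longlonglongrightarrow> 0 \<and> (\<forall>j>0. \<forall>w\<in>?S. chordal z w < r \<longrightarrow> chordal (?p j w) (?F w) \<le> e j)"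
  proof cases
    case infinity
    obtain r where r: "r > 0" "\<And>v. chordal None (Some v) < r \<Longrightarrow> A + 4 < cmod v"
      using chordal_ball_infinity[of "A + 4"] A0 by auto
    have "chordal (?p j w) (?F w) \<le> e j" if "j > 0" "chordal None w < r" for j w
    proof (cases w)
      case None
      obtain m where m: "nn j = Suc m" using ex_m[OF \<open>j > 0\<close>] by blast
      show ?thesis using e_nonneg[of j] by (simp add: None pade_value(1)[OF \<open>j > 0\<close> m] frakF_sphere_def)
    next
      case (Some v)
      have "A + 4 < cmod v" using r(2) that(2) Some by blast
      then show ?thesis using far[OF \<open>j > 0\<close>, of v] Some by simp
    qed
    then show ?thesis using r(1) e_lim unfolding infinity by blast
  next
    case (real x)
    have x: "x = of_real (Re x)" using real(2) by (simp add: complex_eq_iff)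
    have "Re x \<notin> {- 1 - (A + 3)..1 + (A + 3)}" using z unfolding real(1) slit_sphere_def by (subst (asm) x) auto
    then have gt: "cmod x > A + 4" by (subst x) (auto simp: abs_if)
    obtain r where r: "r > 0" "\<And>w. chordal (Some x) w < r \<Longrightarrow> \<exists>v. w = Some v \<and> cmod (x - v) < cmod x - (A + 4)"
      using chordal_ball_finite[of "cmod x - (A + 4)" x] gt by auto
    have "chordal (?p j w) (?F w) \<le> e j" if j: "j > 0" and w: "chordal (Some x) w < r" for j w
    proof -
      obtain v where v: "w = Some v" "cmod (x - v) < cmod x - (A + 4)" using r(2)[OF w] by blast
      then have "cmod v \<ge> A + 4" using norm_triangle_ineq2[of x v] by linarith
      then show ?thesis using far[OF j, of v] v(1) by simp
    qed
    then show ?thesis using r(1) e_lim unfolding real(1) by blast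
  next
    case (nonreal x)
    define y where "y = \<bar>Im x\<bar> / 2"
    have y: "y > 0" using nonreal by (simp add: y_def)
    define e' where "e' j = 2 * (N 0 * (1 + A) / y\<^sup>2 / sqrt ((1 + y\<^sup>2) ^ (nn j - 1)) / y)" for j
    have "e' \<longlonglongrightarrow> 0"
    proof -
      have "(\<lambda>k. 2 * (N 0 * (1 + A) / y\<^sup>2 / y) * (1 / sqrt (1 + y\<^sup>2)) ^ k) \<longlonglongrightarrow> 2 * (N 0 * (1 + A) / y\<^sup>2 / y) * 0"
        using y by (intro tendsto_intros LIMSEQ_power_zero) (simp add: abs_of_pos add_pos_nonneg)
      from filterlim_compose[OF this nn_pred_at_top] show ?thesis
        by (simp add: e'_def[abs_def] power_divide real_sqrt_power mult_ac)
    qed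
    obtain r where r: "r > 0" "\<And>w. chordal (Some x) w < r \<Longrightarrow> \<exists>v. w = Some v \<and> cmod (x - v) < y"
      using chordal_ball_finite[OF y, of x] by auto
    have "chordal (?p j w) (?F w) \<le> e' j" if j: "j > 0" and w: "chordal (Some x) w < r" for j w
    proof -
      obtain v where v: "w = Some v" "cmod (x - v) < y" using r(2)[OF w] by blast
      have Imv: "y \<le> \<bar>Im v\<bar>" using abs_Im_le_cmod[of "x - v"] v(2) by (simp add: y_def) 
      then have cv: "y \<le> cmod v" using abs_Im_le_cmod[of v] by linarith
      have vn: "v \<noteq> 0" "v \<notin> unit_segment" using Imv y by (auto simp: unit_segment_def)
      obtain m where m: "nn j = Suc m" and a: "\<bar>\<alpha> (Suc m)\<bar> \<le> A" using ex_m[OF j] by blast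
      have "chordal (?p j (Some v)) (?F (Some v)) \<le> 2 * (N 0 * (1 + A) / y\<^sup>2 / sqrt ((1 + y\<^sup>2) ^ m) / cmod v)"
        by (rule pade_error[OF j m vn ratio_bound_nonreal[OF y Imv a]])
      also have "N 0 * (1 + A) / y\<^sup>2 / sqrt ((1 + y\<^sup>2) ^ m) / cmod v \<le> N 0 * (1 + A) / y\<^sup>2 / sqrt ((1 + y\<^sup>2) ^ m) / y"
      proof (rule divide_left_mono[OF cv])
        show "0 \<le> N 0 * (1 + A) / y\<^sup>2 / sqrt ((1 + y\<^sup>2) ^ m)"
          using A0 N_nonneg[of 0] by (intro divide_nonneg_nonneg mult_nonneg_nonneg) auto
        show "0 < cmod v * y" using y vn(1) by simp
      qed
      also have "2 * (N 0 * (1 + A) / y\<^sup>2 / sqrt ((1 + y\<^sup>2) ^ m) / y) = e' j" using m by (simp add: e'_def)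
      finally show ?thesis using v(1) by simp
    qed
    then show ?thesis using r(1) \<open>e' \<longlonglongrightarrow> 0\<close> unfolding nonreal(1) by blast
  qed
qed

text \<open>Only convergence near infinity is used. There the limit has modulus below 1, at chordal distance at
  least 1 from infinity, whereas at a zero of \<open>V j\<close> the approximant takes the value infinity.\<close>

lemma convergent_imp_bounded:
  assumes conv: "loc_unif_conv (slit_sphere \<epsilon>) (\<lambda>j. pade (frak_s \<sigma> s) (nn j) (nn j)) (frakF_sphere \<sigma> s)"
  shows "\<exists>A. \<forall>j>0. \<bar>\<alpha> (nn j)\<bar> \<le> A"
proof -
  let ?p = "\<lambda>j. pade (frak_s \<sigma> s) (nn j) (nn j)" and ?F = "frakF_sphere \<sigma> s" and ?S = "slit_sphere \<epsilon>"
  have None: "None \<in> ?S" by (auto simp: slit_sphere_def)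
  obtain r where r: "r > 0"
    and ev: "\<forall>\<^sub>F j in sequentially. \<forall>w\<in>?S. chordal None w < r \<longrightarrow> chordal (?p j w) (?F w) < 1"
  proof -
    from bspec[OF conv[unfolded loc_unif_conv_def] None] obtain r where "r > 0" and
      "\<forall>\<eta>>0. \<forall>\<^sub>F j in sequentially. \<forall>w\<in>?S. chordal None w < r \<longrightarrow> chordal (?p j w) (?F w) < \<eta>" by blast
    then show thesis by (intro that[of r]) auto
  qed
  obtain \<rho> where \<rho>: "\<And>v. cmod v \<ge> \<rho> \<Longrightarrow> chordal None (Some v) < r" using chordal_infinity_lt[OF r] by blast
  have "\<forall>\<^sub>F z in at_infinity. cmod (G 0 z) < 1"
    using order_tendstoD(2)[OF tendsto_norm[OF G_vanishing[of 0]], of 1] by simp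
  then obtain \<rho>' where \<rho>': "\<And>z. cmod z \<ge> \<rho>' \<Longrightarrow> cmod (frakF \<sigma> s z) < 1"
    unfolding eventually_at_infinity frakF_eq_G by blast
  define x0 where "x0 = max (max 3 (2 + \<bar>\<epsilon>\<bar>)) (max \<rho> \<rho>')"
  obtain K where K: "\<And>j w. j \<ge> K \<Longrightarrow> w \<in> ?S \<Longrightarrow> chordal None w < r \<Longrightarrow> chordal (?p j w) (?F w) < 1"
    using ev unfolding eventually_sequentially by blast
  have tail: "\<bar>\<alpha> (nn j)\<bar> < x0 + 2" if j: "j > 0" "j \<ge> K" for j
  proof (rule ccontr)
    assume big: "\<not> \<bar>\<alpha> (nn j)\<bar> < x0 + 2"
    obtain m where m: "nn j = Suc m" using nn_ge[of j] j(1) by (cases "nn j") auto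
    have "x0 \<ge> 3" by (simp add: x0_def)
    moreover have "\<bar>\<alpha> (Suc m)\<bar> \<ge> x0 + 2" using big m by simp
    ultimately obtain x where x: "\<bar>x\<bar> \<ge> x0" "poly (P (Suc m)) x + \<alpha> (Suc m) * poly (P m) x = 0"
      using real_root_far by blast
    have xne: "complex_of_real x \<noteq> 0" using x(1) by (auto simp: x0_def)
    have "poly (cpoly (V j)) (of_real x) = of_real (poly (P (Suc m)) x + \<alpha> (Suc m) * poly (P m) x)"
      unfolding poly_cpoly_of_real by (simp add: Vj[OF j(1) m])
    then have "?p j (Some (of_real x)) = None" using pade_value(2)[OF j(1) m xne] x(2) by simp
    moreover have xr: "cmod (of_real x) \<ge> \<rho>" "cmod (of_real x) \<ge> \<rho>'" using x(1) by (auto simp: x0_def)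
    moreover have "Some (of_real x) \<in> ?S" using x(1) by (auto simp: slit_sphere_def x0_def)
    ultimately have "chordal None (?F (Some (of_real x))) < 1"
      using K[OF j(2) _ \<rho>] by metis
    then have "chordal None (Some (frakF \<sigma> s (of_real x))) < 1" unfolding frakF_sphere_def option.case .
    moreover have "cmod (frakF \<sigma> s (of_real x)) < 1" by (rule \<rho>'[OF xr(2)])
    moreover have "chordal None (Some f) \<ge> 1" if "cmod f < 1" for f
    proof -
      have "(cmod f)\<^sup>2 \<le> 1" using that by (simp add: power_le_one)
      then have "sqrt (1 + (cmod f)\<^sup>2) \<le> sqrt 4" by (intro real_sqrt_le_mono) linarith
      then have "sqrt (1 + (cmod f)\<^sup>2) \<le> 2" by simp
      then show ?thesis by (simp add: field_simps add_pos_nonneg)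
    qed
    ultimately show False by force
  qed
  have "\<bar>\<alpha> (nn j)\<bar> \<le> (x0 + 2) + (\<Sum>i<K. \<bar>\<alpha> (nn i)\<bar>)" if "j > 0" for j
  proof (cases "j \<ge> K")
    case True
    then show ?thesis using tail[OF that] by (simp add: add_increasing2 sum_nonneg)
  next
    case False
    then have "\<bar>\<alpha> (nn j)\<bar> \<le> (\<Sum>i<K. \<bar>\<alpha> (nn i)\<bar>)" by (intro member_le_sum) auto
    moreover have "x0 + 2 \<ge> 0" by (simp add: x0_def le_max_iff_disj)
    ultimately show ?thesis by linarith
  qed
  then show ?thesis by blast
qed

end

theorem theorem6p9:
  fixes \<sigma> :: "real measure" and sm1 :: real
  assumes "sets \<sigma> = sets borel" and "finite_measure \<sigma>"
    and "measure_support \<sigma> \<subseteq> {-1..1}" and "infinite (measure_support \<sigma>)"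
    and "frakF \<sigma> sm1 \<in> D_plus_minf"
  shows
    "let n = normal_index (frak_s \<sigma> sm1);
         stmt_i = (\<exists>L. LU_lower_factor n (frakF \<sigma> sm1) L \<and> bounded_in_ell2 L);
         stmt_ii = (\<exists>L. UL_lower_factor n \<sigma> sm1 L \<and> bounded_in_ell2 L);
         stmt_iii = (\<exists>\<epsilon>\<ge>0. loc_unif_conv (slit_sphere \<epsilon>)
           (\<lambda>j. pade (frak_s \<sigma> sm1) (n j) (n j)) (frakF_sphere \<sigma> sm1))
     in (stmt_i \<longleftrightarrow> stmt_ii) \<and> (stmt_ii \<longleftrightarrow> stmt_iii)"
proof -
  interpret finite_measure \<sigma> by fact
  interpret geronimus_functional \<sigma> sm1
    by unfold_locales (use assms in auto)
  have "bounded_in_ell2 L_factor \<longleftrightarrow> (\<exists>\<epsilon>\<ge>0. loc_unif_conv (slit_sphere \<epsilon>)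
           (\<lambda>j. pade (frak_s \<sigma> sm1) (nn j) (nn j)) (frakF_sphere \<sigma> sm1))"
    unfolding bounded_L_factor
  proof
    assume "\<exists>A. \<forall>j>0. \<bar>\<alpha> (nn j)\<bar> \<le> A"
    then obtain A where A: "\<And>j. j > 0 \<Longrightarrow> \<bar>\<alpha> (nn j)\<bar> \<le> A" by blast
    then have "A + 3 \<ge> 0" using A[of 1] abs_ge_zero[of "\<alpha> (nn 1)"] by linarith
    with bounded_imp_convergent[OF A] show "\<exists>\<epsilon>\<ge>0. loc_unif_conv (slit_sphere \<epsilon>)
           (\<lambda>j. pade (frak_s \<sigma> sm1) (nn j) (nn j)) (frakF_sphere \<sigma> sm1)" by blast
  qed (use convergent_imp_bounded in blast)
  then show ?thesis unfolding Let_def LU_lower_factor_iff UL_lower_factor_iff by auto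
qed

end
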